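(* Let $n\ge 2$ and $0<\lambda\le\Lambda$. There exist an absolute constant $\epsilon_0>0$, a constant $M$ depending only on $n$, and constants $\delta,\eta_0>0$ depending only on $n,\lambda,\Lambda$ such that the following holds. Let $Lu=a^{ij}(x)u_{ij}+b^i(x)u_i$ be an operator on $B_{4n}\subset\mathbb{R}^n$ with measurable coefficients satisfying $\lambda I\le (a^{ij}(x))\le\Lambda I$, and let $S=\|b\|_{L^n(B_{4n})}$. Let $\gamma\ge 0$ and let $u\in W^{2,n}(B_{4n})$ satisfy $L_\gamma u\le 0$ in $B_{4n}$ (that is, $Lu\le 0$ where $|\nabla u|>\gamma$). Assume that $A_1(0)\cap Q_1$ is nonempty and let $x_0\in A_1(0)\cap Q_1$. If $\gamma<\epsilon_0$ and $S<\eta_0$, then $$\frac{|\{u\le u(x_0)+M\}\cap B_{4n}|}{|B_{4n}|}\ge\delta.$$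
   Context: $B_r$ is the ball of radius $r$ centered at $0$ in $\mathbb{R}^n$; $Q_r(x)=\{z:\max_j|z_j-x_j|\le r/2\}$ is the cube of side length $r$ centered at $x$, and $Q_r=Q_r(0)$; $|E|$ is Lebesgue measure. Repeated indices are summed; $(a^{ij}(x))$ is symmetric; $b=(b^1,\dots,b^n)$. "$L_\gamma u\le 0$" means that $Lu\le 0$ holds only at points where $|\nabla u|>\gamma$ (in the Lebesgue point sense, i.e. for almost every $x$ with $|\nabla u(x)|>\gamma$). Functions in $W^{2,n}$ are identified with their continuous representatives, which are continuous up to the boundary of the ball. Contact sets: a paraboloid of opening $a$ and vertex $y$ is $P(x)=c-\frac a2|x-y|^2$. For a set $B\subset\mathbb{R}^n$, $A_a(B)$ is the set of points at which paraboloids of opening $a$ with vertex in $B$, slid from below the graph of $u$ until they touch it, touch the graph of $u$ by below; i.e. the set of $x$ in the closed domain ball of $u$ (here $\overline{B_{4n}}$) such that for some $y\in B$ the function $z\mapsto u(z)+\frac a2|z-y|^2$ attains its minimum over that closed ball at $x$. Also $A_a(y):=A_a(\{y\})$. *)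

theory Defs
  imports "HOL-Analysis.Analysis"
begin

text \<open>
  The claim asserts a constant that is uniform in the dimension \<open>n\<close>, so \<open>n\<close> has to be quantified
  inside the statement and cannot be the cardinality of an index type. Points of \<open>n\<close>-space are
  therefore the extensional functions on \<open>{..<n}\<close> (the space of the product measure). As a subset of
  \<^typ>\<open>nat \<Rightarrow> real\<close> with the library's product topology this carries the usual topology, so that
  \<^const>\<open>compact\<close> and \<^const>\<open>continuous_on\<close> have their usual meaning there. Whatever functions do
  outside \<open>Rn n\<close> is irrelevant.
\<close>

type_synonym rvec = "nat \<Rightarrow> real"

definition Rn :: "nat \<Rightarrow> rvec set" where
  "Rn n = ({..<n} \<rightarrow>\<^sub>E UNIV)"

definition origin :: "nat \<Rightarrow> rvec" where
  "origin n = (\<lambda>i\<in>{..<n}. 0)"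

definition leb :: "nat \<Rightarrow> rvec measure" where
  "leb n = completion (\<Pi>\<^sub>M i\<in>{..<n}. lborel)"

definition enorm :: "nat \<Rightarrow> rvec \<Rightarrow> real" where
  "enorm n x = L2_set x {..<n}"

definition edist :: "nat \<Rightarrow> rvec \<Rightarrow> rvec \<Rightarrow> real" where
  "edist n x y = enorm n (\<lambda>i. x i - y i)"

definition nball :: "nat \<Rightarrow> real \<Rightarrow> rvec set" where
  "nball n r = {x \<in> Rn n. enorm n x < r}"

definition ncball :: "nat \<Rightarrow> real \<Rightarrow> rvec set" where
  "ncball n r = {x \<in> Rn n. enorm n x \<le> r}"

definition cube :: "nat \<Rightarrow> real \<Rightarrow> rvec \<Rightarrow> rvec set" where
  "cube n r x = {z \<in> Rn n. \<forall>j<n. \<bar>z j - x j\<bar> \<le> r / 2}"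

definition pderiv_at :: "nat \<Rightarrow> (rvec \<Rightarrow> real) \<Rightarrow> rvec \<Rightarrow> real" where
  "pderiv_at i f x = deriv (\<lambda>t. f (x(i := t))) (x i)"

text \<open>Infinitely differentiable on all of \<open>n\<close>-space: the iterated partial derivatives of all
  orders exist and are continuous.\<close>

definition smooth :: "nat \<Rightarrow> (rvec \<Rightarrow> real) \<Rightarrow> bool" where
  "smooth n f \<longleftrightarrow>
     (\<forall>is. set is \<subseteq> {..<n} \<longrightarrow>
        continuous_on (Rn n) (foldr pderiv_at is f) \<and>
        (\<forall>i<n. \<forall>x\<in>Rn n. (\<lambda>t. foldr pderiv_at is f (x(i := t))) differentiable (at (x i))))"

definition test_function :: "nat \<Rightarrow> rvec set \<Rightarrow> (rvec \<Rightarrow> real) \<Rightarrow> bool" where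
  "test_function n U \<phi> \<longleftrightarrow>
     smooth n \<phi> \<and> (\<exists>K. compact K \<and> K \<subseteq> U \<and> (\<forall>x\<in>Rn n - K. \<phi> x = 0))"

definition locally_integrable :: "nat \<Rightarrow> rvec set \<Rightarrow> (rvec \<Rightarrow> real) \<Rightarrow> bool" where
  "locally_integrable n U f \<longleftrightarrow>
     (\<forall>K. compact K \<and> K \<subseteq> U \<longrightarrow> set_integrable (leb n) K f)"

definition weak_pderiv ::
    "nat \<Rightarrow> rvec set \<Rightarrow> nat \<Rightarrow> (rvec \<Rightarrow> real) \<Rightarrow> (rvec \<Rightarrow> real) \<Rightarrow> bool" where
  "weak_pderiv n U i f g \<longleftrightarrow>
     locally_integrable n U f \<and> locally_integrable n U g \<and>
     (\<forall>\<phi>. test_function n U \<phi> \<longrightarrow>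
        (LINT x:U|leb n. f x * pderiv_at i \<phi> x) = - (LINT x:U|leb n. g x * \<phi> x))"

definition in_Lp :: "nat \<Rightarrow> nat \<Rightarrow> rvec set \<Rightarrow> (rvec \<Rightarrow> real) \<Rightarrow> bool" where
  "in_Lp n p U f \<longleftrightarrow>
     set_borel_measurable (leb n) U f \<and> set_integrable (leb n) U (\<lambda>x. \<bar>f x\<bar> ^ p)"

text \<open>\<open>u\<close> belongs to the Sobolev space of order two and exponent \<open>p\<close> on \<open>U\<close>, with (a chosen version
  of) its weak gradient \<open>Du\<close> and weak Hessian \<open>D2u\<close>.\<close>

definition sobolev2 ::
    "nat \<Rightarrow> nat \<Rightarrow> rvec set \<Rightarrow> (rvec \<Rightarrow> real) \<Rightarrow> (nat \<Rightarrow> rvec \<Rightarrow> real) \<Rightarrow>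
     (nat \<Rightarrow> nat \<Rightarrow> rvec \<Rightarrow> real) \<Rightarrow> bool" where
  "sobolev2 n p U u Du D2u \<longleftrightarrow>
     in_Lp n p U u \<and>
     (\<forall>i<n. in_Lp n p U (Du i) \<and> weak_pderiv n U i u (Du i)) \<and>
     (\<forall>i<n. \<forall>j<n. in_Lp n p U (D2u i j) \<and> weak_pderiv n U j (Du i) (D2u i j))"

definition vector_Lp_norm :: "nat \<Rightarrow> nat \<Rightarrow> rvec set \<Rightarrow> (nat \<Rightarrow> rvec \<Rightarrow> real) \<Rightarrow> real" where
  "vector_Lp_norm n p U b = root p (LINT x:U|leb n. enorm n (\<lambda>i. b i x) ^ p)"

definition elliptic_on ::
    "nat \<Rightarrow> rvec set \<Rightarrow> real \<Rightarrow> real \<Rightarrow> (nat \<Rightarrow> nat \<Rightarrow> rvec \<Rightarrow> real) \<Rightarrow> bool" where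
  "elliptic_on n U lam Lam a \<longleftrightarrow>
     (\<forall>x\<in>U. (\<forall>i<n. \<forall>j<n. a i j x = a j i x) \<and>
       (\<forall>\<xi>\<in>Rn n.
          lam * (enorm n \<xi>)\<^sup>2 \<le> (\<Sum>i<n. \<Sum>j<n. a i j x * \<xi> i * \<xi> j) \<and>
          (\<Sum>i<n. \<Sum>j<n. a i j x * \<xi> i * \<xi> j) \<le> Lam * (enorm n \<xi>)\<^sup>2))"

definition L_op ::
    "nat \<Rightarrow> (nat \<Rightarrow> nat \<Rightarrow> rvec \<Rightarrow> real) \<Rightarrow> (nat \<Rightarrow> rvec \<Rightarrow> real) \<Rightarrow>
     (nat \<Rightarrow> rvec \<Rightarrow> real) \<Rightarrow> (nat \<Rightarrow> nat \<Rightarrow> rvec \<Rightarrow> real) \<Rightarrow> rvec \<Rightarrow> real" where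
  "L_op n a b Du D2u x = (\<Sum>i<n. \<Sum>j<n. a i j x * D2u i j x) + (\<Sum>i<n. b i x * Du i x)"

definition L_gamma_nonpos ::
    "nat \<Rightarrow> rvec set \<Rightarrow> real \<Rightarrow> (nat \<Rightarrow> nat \<Rightarrow> rvec \<Rightarrow> real) \<Rightarrow> (nat \<Rightarrow> rvec \<Rightarrow> real) \<Rightarrow>
     (nat \<Rightarrow> rvec \<Rightarrow> real) \<Rightarrow> (nat \<Rightarrow> nat \<Rightarrow> rvec \<Rightarrow> real) \<Rightarrow> bool" where
  "L_gamma_nonpos n U \<gamma> a b Du D2u \<longleftrightarrow>
     (AE x in leb n. x \<in> U \<longrightarrow> enorm n (\<lambda>i. Du i x) > \<gamma> \<longrightarrow> L_op n a b Du D2u x \<le> 0)"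

text \<open>The points of the closed ball of radius \<open>R\<close> at which a paraboloid of opening \<open>a\<close> with vertex
  in \<open>B\<close>, slid from below, touches the graph of \<open>u\<close>.\<close>

definition contact_set ::
    "nat \<Rightarrow> real \<Rightarrow> (rvec \<Rightarrow> real) \<Rightarrow> real \<Rightarrow> rvec set \<Rightarrow> rvec set" where
  "contact_set n R u a B =
     {x \<in> ncball n R. \<exists>y\<in>B. \<forall>z\<in>ncball n R.
        u x + a / 2 * (edist n x y)\<^sup>2 \<le> u z + a / 2 * (edist n z y)\<^sup>2}"

end

theory Submission
  imports Defs
begin

text \<open>
  Instead of paraboloids, slide the cusps \<open>- C |z - y|^(1/2)\<close> with vertices \<open>y\<close> in the unit cube from
  below, with \<open>C\<close> a large multiple of \<open>n^2\<close>. Their gradient is large everywhere, so the equation is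
  available at every contact point other than the vertex, while contact at the vertex puts the vertex
  itself into the sublevel set. The contact condition with the paraboloid keeps the contact points in
  the interior and in the sublevel set. At a contact point \<open>x \<noteq> y\<close> the gradient determines the vertex,
  and the cusp stays above a paraboloid of opening \<open>(C/2) |x - y|^(-3/2)\<close> there, which bounds the Hessian from
  below; ellipticity then bounds the Hessian from above through its trace, so that the map from
  contact point to vertex has Lipschitz constant at most a multiple of \<open>1 + |b|\<close>. Only this bound is
  needed: covering the contact points by a grid of small cubes gives the measure estimate for the
  vertices without Jacobians or the area formula. The argument is applied to mollifications of \<open>u\<close>,
  whose Hessians converge in \<open>L^n\<close>; the points where the gradients are not yet close form a small set.
\<close>

section \<open>Shifts and Lebesgue measure on the product space\<close>

text \<open>A paraboloid is flat near its vertex, exactly where the equation is silent. The cusp has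
  gradient of length \<open>C / (2 A)\<close> with \<open>A = |x - y|^(1/2)\<close>, which is at
  least \<open>4\<close> on the box used; this leaves room for two errors of size \<open>1\<close>,
  from mollifying and from moving inside a grid cell, above any \<gamma> < 1. So the threshold for
  \<gamma> is \<open>1\<close> in every dimension. The singularity does no harm: the Hessian bound
  grows like \<open>A^(-3)\<close>, but recovering \<open>x - y\<close> from the gradient costs a
  factor \<open>A^3\<close>. \<open>C\<close> depends on \<open>n\<close> alone, hence so does
  \<open>M\<close>; ellipticity enters only through the Lipschitz constant of the map from contact
  point to vertex. The order of choices is decisive: first the error \<kappa>, then the
  mollification, then the grid size \<open>h\<close>. So \<open>h\<close> may depend on the
  uncontrolled Lipschitz constants of the mollified function, and neither occurs in the final bound.
  The equation holds only almost everywhere, while contact points are arbitrary; bounds are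
  therefore proved at almost every point near a contact point and integrated over a cell. Fubini is
  used on the uncompleted product measure, so Borel versions replace the given functions.\<close>

abbreviation prodleb :: "nat \<Rightarrow> rvec measure" where
  "prodleb n \<equiv> PiM {..<n} (\<lambda>_. lborel)"

text \<open>Cubes instead of balls: as products of intervals they inherit volume, compactness and
  Borel measurability from the factors.\<close>

definition nbox :: "nat \<Rightarrow> real \<Rightarrow> rvec set" where
  "nbox n r = (\<Pi>\<^sub>E i\<in>{..<n}. {-r..r})"

definition vsub :: "nat \<Rightarrow> rvec \<Rightarrow> rvec \<Rightarrow> rvec" where
  "vsub n x v = (\<lambda>i\<in>{..<n}. x i - v i)"

global_interpretation lborel_prod: product_sigma_finite "\<lambda>_::nat. lborel :: real measure"
  by standard

lemma sigma_finite_prodleb: "sigma_finite_measure (prodleb n)"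
  by (rule lborel_prod.sigma_finite) simp

lemma space_prodleb: "space (prodleb n) = Rn n"
  by (simp add: space_PiM Rn_def)

lemma nbox_iff: "x \<in> nbox n r \<longleftrightarrow> x \<in> Rn n \<and> (\<forall>i<n. \<bar>x i\<bar> \<le> r)"
  by (auto simp: nbox_def Rn_def PiE_iff abs_le_iff minus_le_iff)

lemma nbox_sets [measurable, simp]: "nbox n r \<in> sets (prodleb n)"
  unfolding nbox_def by (rule sets_PiM_I_finite) auto

lemma emeasure_nbox: "r \<ge> 0 \<Longrightarrow> emeasure (prodleb n) (nbox n r) = ennreal ((2 * r) ^ n)"
  unfolding nbox_def by (subst lborel_prod.emeasure_PiM) (auto simp: ennreal_power)

lemma nbox_finite: "emeasure (prodleb n) (nbox n r) < \<infinity>"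
proof (cases "r \<ge> 0")
  case False
  then have "nbox n r = {} \<or> n = 0" by (force simp: nbox_iff)
  then show ?thesis by (auto simp: nbox_def)
qed (simp add: emeasure_nbox)

text \<open>The product measure is determined by its values on boxes, and the preimage of a box
  under a coordinatewise map is again a box. This serves translations and the reflections
  \<open>v \<mapsto> x - v\<close>.\<close>

lemma distr_prodleb:
  assumes "\<And>i. i < n \<Longrightarrow> F i \<in> borel_measurable borel"
    and "\<And>i. i < n \<Longrightarrow> distr lborel borel (F i) = lborel"
  shows "distr (prodleb n) (prodleb n) (\<lambda>x. \<lambda>i\<in>{..<n}. F i (x i)) = prodleb n"
proof (rule lborel_prod.PiM_eqI)
  have m [measurable]: "(\<lambda>x. \<lambda>i\<in>{..<n}. F i (x i)) \<in> measurable (prodleb n) (prodleb n)"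
    using assms(1) by (intro measurable_restrict) (auto intro:
        measurable_compose[OF measurable_component_singleton])
  fix A :: "nat \<Rightarrow> real set" assume A: "\<And>i. i \<in> {..<n} \<Longrightarrow> A i \<in> sets lborel"
  have "emeasure (distr (prodleb n) (prodleb n) (\<lambda>x. \<lambda>i\<in>{..<n}. F i (x i))) (Pi\<^sub>E {..<n} A)
     = emeasure (prodleb n) ((\<lambda>x. \<lambda>i\<in>{..<n}. F i (x i)) -` Pi\<^sub>E {..<n} A \<inter> space (prodleb n))"
    using A by (intro emeasure_distr m sets_PiM_I_finite) auto
  also have "(\<lambda>x. \<lambda>i\<in>{..<n}. F i (x i)) -` Pi\<^sub>E {..<n} A \<inter> space (prodleb n)
      = (\<Pi>\<^sub>E i\<in>{..<n}. F i -` A i)"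
    by (auto simp: space_PiM PiE_iff)
  also have "emeasure (prodleb n) \<dots> = (\<Prod>i\<in>{..<n}. emeasure lborel (F i -` A i))"
    using assms(1) A by (intro lborel_prod.emeasure_PiM) (auto simp: in_borel_measurable_borel)
  also have "\<dots> = (\<Prod>i\<in>{..<n}. emeasure (distr lborel borel (F i)) (A i))"
    using assms(1) A by (intro prod.cong refl) (subst emeasure_distr, auto)
  also have "\<dots> = (\<Prod>i\<in>{..<n}. emeasure lborel (A i))"
    using assms(2) by (intro prod.cong) auto
  finally show "emeasure (distr (prodleb n) (prodleb n) (\<lambda>x. \<lambda>i\<in>{..<n}. F i (x i))) (Pi\<^sub>E {..<n} A)
     = (\<Prod>i\<in>{..<n}. emeasure lborel (A i))" .
qed auto

lemma vsub_measurable1 [measurable]: "(\<lambda>x. vsub n x v) \<in> measurable (prodleb n) (prodleb n)"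
  unfolding vsub_def by (intro measurable_restrict) measurable

lemma vsub_measurable2 [measurable]: "(\<lambda>v. vsub n x v) \<in> measurable (prodleb n) (prodleb n)"
  unfolding vsub_def by (intro measurable_restrict) measurable

lemma vsub_measurable_pair [measurable]:
  "(\<lambda>(x, v). vsub n x v) \<in> measurable (prodleb n \<Otimes>\<^sub>M prodleb n) (prodleb n)"
  unfolding vsub_def split_beta by (intro measurable_restrict) measurable

lemma distr_vsub1: "distr (prodleb n) (prodleb n) (\<lambda>x. vsub n x v) = prodleb n"
proof -
  have "distr lborel borel (\<lambda>t. t - v i) = lborel" for i
  proof -
    have "(+) (- v i) = (\<lambda>t. t - v i)" by auto
    then show ?thesis using lborel_distr_plus[of "- v i"] by simp
  qed
  then show ?thesis unfolding vsub_def
    by (intro distr_prodleb[where F = "\<lambda>i t. t - v i"]) auto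
qed

lemma lborel_distr_reflect: "distr lborel borel (\<lambda>t. c - t) = (lborel :: real measure)"
proof -
  have "distr (distr lborel borel uminus) borel ((+) c) = distr lborel borel ((+) c \<circ> uminus)"
    by (rule distr_distr) auto
  then show ?thesis
    by (simp add: lborel_distr_uminus lborel_distr_plus comp_def)
qed

lemma distr_vsub2: "distr (prodleb n) (prodleb n) (\<lambda>v. vsub n x v) = prodleb n"
  unfolding vsub_def
  by (intro distr_prodleb[where F = "\<lambda>i t. x i - t"]) (auto simp: lborel_distr_reflect)

lemma vsub_Rn [simp]: "vsub n x v \<in> Rn n"
  by (simp add: vsub_def Rn_def)

definition small_shift :: "nat \<Rightarrow> real \<Rightarrow> rvec \<Rightarrow> bool" where
  "small_shift n s v \<longleftrightarrow> (\<forall>i<n. \<bar>v i\<bar> \<le> s)"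

text \<open>Continuity of translations in measure for a single set. It is localised to boxes because
  half-spaces and complements have infinite measure, whereas the step to countable unions relies on
  continuity from above.\<close>

definition shift_cont_set :: "nat \<Rightarrow> rvec set \<Rightarrow> bool" where
  "shift_cont_set n A \<longleftrightarrow> (\<forall>k \<tau>. \<tau> > 0 \<longrightarrow> (\<exists>s>0. \<forall>v. small_shift n s v \<longrightarrow>
     measure (prodleb n) {x\<in>nbox n k. (vsub n x v \<in> A) \<noteq> (x \<in> A)} \<le> \<tau>))"

lemma prodleb_sub_nbox_fmeasurable:
  "A \<subseteq> nbox n k \<Longrightarrow> A \<in> sets (prodleb n) \<Longrightarrow> A \<in> fmeasurable (prodleb n)"
  using nbox_finite[of n k] emeasure_mono[of A "nbox n k" "prodleb n"] by (intro fmeasurableI) auto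

lemma shift_diff_sets:
  assumes "A \<in> sets (prodleb n)"
  shows "{x\<in>nbox n k. (vsub n x v \<in> A) \<noteq> (x \<in> A)} \<in> sets (prodleb n)"
proof -
  note assms[measurable]
  have "{x\<in>space (prodleb n). x \<in> nbox n k \<and> (vsub n x v \<in> A) \<noteq> (x \<in> A)} \<in> sets (prodleb n)"
    by measurable
  also have "{x\<in>space (prodleb n). x \<in> nbox n k \<and> (vsub n x v \<in> A) \<noteq> (x \<in> A)}
    = {x\<in>nbox n k. (vsub n x v \<in> A) \<noteq> (x \<in> A)}"
    by (auto simp: space_prodleb nbox_iff)
  finally show ?thesis .
qed

lemma shift_cont_set_compl:
  assumes "shift_cont_set n A"
  shows "shift_cont_set n (Rn n - A)"
proof -
  have "{x\<in>nbox n k. (vsub n x v \<in> Rn n - A) \<noteq> (x \<in> Rn n - A)}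
     = {x\<in>nbox n k. (vsub n x v \<in> A) \<noteq> (x \<in> A)}" for k v
    by (auto simp: nbox_iff)
  then show ?thesis using assms unfolding shift_cont_set_def by simp
qed

lemma small_shift_mono: "small_shift n s v \<Longrightarrow> s \<le> t \<Longrightarrow> small_shift n t v"
  unfolding small_shift_def by fastforce

lemma ex_uniform_positive:
  fixes P :: "nat \<Rightarrow> real \<Rightarrow> bool"
  assumes "\<And>j. j < N \<Longrightarrow> \<exists>s>0. P j s" and "\<And>j s t. P j s \<Longrightarrow> 0 < t \<Longrightarrow> t \<le> s \<Longrightarrow> P j t"
  shows "\<exists>s>0. \<forall>j<N. P j s"
  using assms(1)
proof (induction N)
  case (Suc N)
  then obtain s t where "s > 0" "\<forall>j<N. P j s" "t > 0" "P N t"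
    by (metis less_Suc_eq)
  then have "\<forall>j<Suc N. P j (min s t)" "min s t > 0"
    by (auto simp: less_Suc_eq intro: assms(2))
  then show ?case by blast
qed (auto intro: exI[of _ 1])

lemma measure_vimage_vsub:
  assumes "A \<in> sets (prodleb n)"
  shows "measure (prodleb n) {x\<in>Rn n. vsub n x v \<in> A} = measure (prodleb n) A"
proof -
  have "measure (prodleb n) A = measure (distr (prodleb n) (prodleb n) (\<lambda>x. vsub n x v)) A"
    by (simp only: distr_vsub1)
  also have "\<dots> = measure (prodleb n) ((\<lambda>x. vsub n x v) -` A \<inter> space (prodleb n))"
    using assms by (intro measure_distr) auto
  also have "(\<lambda>x. vsub n x v) -` A \<inter> space (prodleb n) = {x\<in>Rn n. vsub n x v \<in> A}"
    by (auto simp: space_prodleb)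
  finally show ?thesis by simp
qed

text \<open>Up to a tail of small measure a union consists of finitely many members. These admit a
  common shift size, and translation invariance controls the tail also at the shifted point.\<close>

lemma shift_cont_set_UN:
  fixes A :: "nat \<Rightarrow> rvec set"
  assumes c: "\<And>j. shift_cont_set n (A j)" and A [measurable]: "\<And>j. A j \<in> sets (prodleb n)"
  shows "shift_cont_set n (\<Union>j. A j)"
  unfolding shift_cont_set_def
proof (intro allI impI)
  fix k \<tau> :: real assume "\<tau> > 0"
  \<comment> \<open>The tails live in the box enlarged by \<open>1\<close>, since shifting by at
    most \<open>1\<close> can leave the original box.\<close>
  define T where "T N = nbox n (k + 1) \<inter> ((\<Union>j. A j) - (\<Union>j<N. A j))" for N
  have Tm [measurable]: "T N \<in> sets (prodleb n)" for N unfolding T_def by measurable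
  have "(\<lambda>N. emeasure (prodleb n) (T N)) \<longlonglongrightarrow> emeasure (prodleb n) (\<Inter>N. T N)"
  proof (rule Lim_emeasure_decseq)
    show "decseq T" unfolding decseq_def T_def by fastforce
    show "emeasure (prodleb n) (T i) \<noteq> \<infinity>" for i
      using emeasure_mono[of "T i" "nbox n (k+1)" "prodleb n"] nbox_finite[of n "k+1"]
      by (auto simp: T_def top_unique)
  qed (use Tm in auto)
  also have "(\<Inter>N. T N) = {}" by (auto simp: T_def)
  finally have "eventually (\<lambda>N. emeasure (prodleb n) (T N) < ennreal (\<tau> / 4)) sequentially"
    using \<open>\<tau> > 0\<close> by (intro order_tendstoD(2)) auto
  then obtain N where N: "emeasure (prodleb n) (T N) < ennreal (\<tau> / 4)"
    by (auto simp: eventually_sequentially)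
  then have N: "measure (prodleb n) (T N) \<le> \<tau> / 4"
    using \<open>\<tau> > 0\<close> unfolding measure_def by (intro enn2real_leI) auto
  \<comment> \<open>Half of \<tau> is shared among the finitely many members; the tail and its
    translate receive a quarter each. \<open>Suc N\<close> keeps the quotient meaningful for
    \<open>N = 0\<close>.\<close>
  define P where "P j s \<longleftrightarrow> (\<forall>v. small_shift n s v \<longrightarrow>
     measure (prodleb n) {x\<in>nbox n k. (vsub n x v \<in> A j) \<noteq> (x \<in> A j)} \<le> \<tau> / (2 * real (Suc N)))" for j s
  have "\<exists>s>0. \<forall>j<N. P j s"
  proof (rule ex_uniform_positive)
    show "\<exists>s>0. P j s" for j
      using c[of j] \<open>\<tau> > 0\<close> unfolding P_def shift_cont_set_def by simp
    show "P j t" if "P j s" "0 < t" "t \<le> s" for j s t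
      using that small_shift_mono unfolding P_def by blast
  qed
  then obtain s where s: "s > 0" "\<And>j. j < N \<Longrightarrow> P j s" by auto
  have "measure (prodleb n) {x\<in>nbox n k. (vsub n x v \<in> (\<Union>j. A j)) \<noteq> (x \<in> (\<Union>j. A j))} \<le> \<tau>"
    if v: "small_shift n (min s 1) v" for v
  proof -
    define D where "D j = {x\<in>nbox n k. (vsub n x v \<in> A j) \<noteq> (x \<in> A j)}" for j
    define E where "E = {x\<in>nbox n k. vsub n x v \<in> T N}"
    have Dm: "D j \<in> sets (prodleb n)" for j unfolding D_def by (rule shift_diff_sets) simp
    have "{x\<in>space (prodleb n). x\<in>nbox n k \<and> vsub n x v \<in> T N} \<in> sets (prodleb n)" by measurable
    also have "{x\<in>space (prodleb n). x\<in>nbox n k \<and> vsub n x v \<in> T N} = E"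
      by (auto simp: E_def space_prodleb nbox_iff)
    finally have Em: "E \<in> sets (prodleb n)" .
    have Vm: "{x\<in>Rn n. vsub n x v \<in> T N} \<in> sets (prodleb n)"
      using measurable_sets[OF vsub_measurable1 Tm[of N], of v] by
          (simp add: space_prodleb vimage_def Collect_conj_eq Int_commute)
    have sub: "vsub n x v \<in> nbox n (k+1)" if "x \<in> nbox n k" for x
    proof -
      have "\<bar>x i - v i\<bar> \<le> k + 1" if "i < n" for i
        using \<open>x \<in> nbox n k\<close> v that unfolding nbox_iff small_shift_def by fastforce
      then show ?thesis by (simp add: nbox_iff) (simp add: vsub_def)
    qed
    have "{x\<in>nbox n k. (vsub n x v \<in> (\<Union>j. A j)) \<noteq> (x \<in> (\<Union>j. A j))}
       \<subseteq> (\<Union>j<N. D j) \<union> (E \<union> T N \<inter> nbox n k)"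
      using sub unfolding D_def E_def T_def by (auto simp: nbox_iff) fastforce+
    then have "measure (prodleb n) {x\<in>nbox n k. (vsub n x v \<in> (\<Union>j. A j)) \<noteq> (x \<in> (\<Union>j. A j))}
       \<le> measure (prodleb n) ((\<Union>j<N. D j) \<union> (E \<union> T N \<inter> nbox n k))"
      using Dm Em
      by (intro measure_mono_fmeasurable shift_diff_sets sets.countable_UN
          prodleb_sub_nbox_fmeasurable[of _ n k])
         (auto simp: D_def E_def)
    also have "\<dots> \<le> measure (prodleb n) (\<Union>j<N. D j) + measure (prodleb n) (E \<union> T N \<inter> nbox n k)"
      using Dm Em by (intro measure_Un_le) auto
    also have "measure (prodleb n) (E \<union> T N \<inter> nbox n k) \<le> measure (prodleb n) E + measure (prodleb n)
        (T N \<inter> nbox n k)"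
      using Em by (intro measure_Un_le) auto
    also have "measure (prodleb n) (\<Union>j<N. D j) \<le> (\<Sum>j<N. measure (prodleb n) (D j))"
      using Dm by (intro measure_UNION_le) auto
    also have "\<dots> \<le> (\<Sum>j<N. \<tau> / (2 * real (Suc N)))"
      using s v small_shift_mono[OF v min.cobounded1] unfolding P_def D_def by (intro sum_mono) auto
    also have "\<dots> \<le> \<tau> / 2" using \<open>\<tau> > 0\<close> by (simp add: field_simps)
    also have "measure (prodleb n) E \<le> measure (prodleb n) {x\<in>Rn n. vsub n x v \<in> T N}"
    proof (rule measure_mono_fmeasurable)
      have "emeasure (prodleb n) {x\<in>Rn n. vsub n x v \<in> T N} = emeasure
          (distr (prodleb n) (prodleb n) (\<lambda>x. vsub n x v)) (T N)"
        by (subst emeasure_distr) (auto simp: space_prodleb vimage_def Collect_conj_eq Int_commute)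
      also have "\<dots> = emeasure (prodleb n) (T N)" by (simp only: distr_vsub1)
      also have "\<dots> < \<infinity>"
        using emeasure_mono[of "T N" "nbox n (k+1)" "prodleb n"] nbox_finite[of n "k+1"]
        by (auto simp: T_def)
      finally show "{x\<in>Rn n. vsub n x v \<in> T N} \<in> fmeasurable (prodleb n)"
        using Vm by (auto simp: fmeasurable_def)
      show "E \<subseteq> {x\<in>Rn n. vsub n x v \<in> T N}" unfolding E_def nbox_iff by blast
    qed (rule Em)
    also have "\<dots> = measure (prodleb n) (T N)" by (rule measure_vimage_vsub) simp
    also have "measure (prodleb n) (T N \<inter> nbox n k) \<le> measure (prodleb n) (T N)"
      by (rule measure_mono_fmeasurable) (auto intro: prodleb_sub_nbox_fmeasurable[of _ n "k+1"] simp: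
          T_def)
    finally show ?thesis using N by linarith
  qed
  then show "\<exists>s>0. \<forall>v. small_shift n s v \<longrightarrow>
     measure (prodleb n) {x\<in>nbox n k. (vsub n x v \<in> (\<Union>j. A j)) \<noteq> (x \<in> (\<Union>j. A j))} \<le> \<tau>"
    using s(1) by (intro exI[of _ "min s 1"]) auto
qed

section \<open>Continuity of translations in the mean\<close>

lemma vsub_apply [simp]: "i < n \<Longrightarrow> vsub n x v i = x i - v i"
  by (simp add: vsub_def)

text \<open>A half-space and its translate differ only in a slab of thickness \<open>2 s\<close>
  around the hyperplane, whose part in the box has measure \<open>2 s (2|k|)^(n-1)\<close>.\<close>

lemma shift_cont_set_halfspace:
  assumes "i < n"
  shows "shift_cont_set n {x\<in>Rn n. x i < c}"
  unfolding shift_cont_set_def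
proof (intro allI impI)
  fix k \<tau> :: real assume "\<tau> > 0"
  \<comment> \<open>\<open>k\<close> may be negative, hence the absolute value; the summand
    \<open>1\<close> in the denominator of \<open>s\<close> covers \<open>B = 0\<close>.\<close>
  define B where "B = (2 * \<bar>k\<bar>) ^ (n - 1)"
  define s where "s = \<tau> / (2 * B + 1)"
  have B: "B \<ge> 0" by (simp add: B_def)
  have s: "s > 0" "2 * s * B \<le> \<tau>"
    using \<open>\<tau> > 0\<close> B by (auto simp: s_def field_simps)
  have A: "{x\<in>Rn n. x i < c} \<in> sets (prodleb n)"
  proof -
    have [measurable]: "(\<lambda>x. x i) \<in> borel_measurable (prodleb n)"
      using assms measurable_component_singleton[of i "{..<n}" "\<lambda>_. lborel"] by simp
    have "{x\<in>space (prodleb n). x i < c} \<in> sets (prodleb n)" by measurable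
    then show ?thesis by (simp add: space_prodleb)
  qed
  have "measure (prodleb n) {x\<in>nbox n k. (vsub n x v \<in> {x\<in>Rn n. x i < c}) \<noteq> (x \<in> {x\<in>Rn n. x i < c})} \<le> \<tau>"
    if v: "small_shift n s v" for v
  proof -
    define S where "S = (\<Pi>\<^sub>E j\<in>{..<n}. if j = i then {c-s..c+s} else {-\<bar>k\<bar>..\<bar>k\<bar>})"
    have "emeasure (prodleb n) S = (\<Prod>j\<in>{..<n}. emeasure lborel (if j = i then {c-s..c+s} else {-\<bar>k\<bar>..\<bar>k\<bar>}))"
      unfolding S_def by (intro lborel_prod.emeasure_PiM) auto
    also have "\<dots> = (\<Prod>j\<in>{..<n}. ennreal (if j = i then 2 * s else 2 * \<bar>k\<bar>))"
      using s by (intro prod.cong) auto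
    also have "\<dots> = ennreal (\<Prod>j\<in>{..<n}. if j = i then 2 * s else 2 * \<bar>k\<bar>)"
      using s by (intro prod_ennreal) auto
    also have "(\<Prod>j\<in>{..<n}. if j = i then 2 * s else 2 * \<bar>k\<bar>) = 2 * s * B"
      using assms unfolding B_def by (subst prod.remove[of _ i]) (auto simp: card_Diff_singleton)
    finally have eS: "emeasure (prodleb n) S = ennreal (2 * s * B)" .
    have Sm: "S \<in> sets (prodleb n)" unfolding S_def by (intro sets_PiM_I_finite) auto
    have "{x\<in>nbox n k. (vsub n x v \<in> {x\<in>Rn n. x i < c}) \<noteq> (x \<in> {x\<in>Rn n. x i < c})} \<subseteq> S"
    proof
      fix x assume x: "x \<in> {x\<in>nbox n k. (vsub n x v \<in> {x\<in>Rn n. x i < c}) \<noteq> (x \<in> {x\<in>Rn n. x i < c})}"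
      have "\<bar>v i\<bar> \<le> s" using v assms by (auto simp: small_shift_def)
      moreover have "(x i - v i < c) \<noteq> (x i < c)" using x assms by (simp add: nbox_iff)
      ultimately have "\<bar>x i - c\<bar> \<le> s" by linarith
      then have "x i \<in> {c-s..c+s}" by (simp add: abs_le_iff)
      moreover have "x j \<in> {-\<bar>k\<bar>..\<bar>k\<bar>}" if "j < n" for j
      proof -
        have "\<bar>x j\<bar> \<le> k" using x that by (simp add: nbox_iff)
        then show ?thesis by auto
      qed
      ultimately show "x \<in> S" using x by (auto simp: S_def PiE_iff nbox_def)
    qed
    then have "measure (prodleb n) {x\<in>nbox n k. (vsub n x v \<in> {x\<in>Rn n. x i < c}) \<noteq> (x \<in> {x\<in>Rn n. x i < c})}
       \<le> measure (prodleb n) S"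
      using A Sm eS by (intro measure_mono_fmeasurable shift_diff_sets) (auto simp: fmeasurable_def)
    also have "\<dots> = 2 * s * B" using eS s B by (simp add: measure_def)
    finally show ?thesis using s by simp
  qed
  then show "\<exists>s>0. \<forall>v. small_shift n s v \<longrightarrow>
     measure (prodleb n) {x\<in>nbox n k. (vsub n x v \<in> {x\<in>Rn n. x i < c}) \<noteq> (x \<in> {x\<in>Rn n. x i < c})} \<le> \<tau>"
    using s(1) by auto
qed

lemma shift_cont_set_empty: "shift_cont_set n {}"
  by (auto simp: shift_cont_set_def intro: exI[of _ 1])

text \<open>Half-lines generate the Borel sets of the line, and the sets with continuous
  translations are closed under complements and countable unions.\<close>

lemma shift_cont_set_cylinder:
  assumes "i < n" "A \<in> sets (borel :: real measure)"
  shows "shift_cont_set n {x\<in>Rn n. x i \<in> A}"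
proof -
  have cyl: "{x\<in>Rn n. x i \<in> B} \<in> sets (prodleb n)" if "B \<in> sets borel" for B :: "real set"
  proof -
    note that [measurable]
    have [measurable]: "(\<lambda>x. x i) \<in> borel_measurable (prodleb n)"
      using assms(1) measurable_component_singleton[of i "{..<n}" "\<lambda>_. lborel"] by simp
    have "{x\<in>space (prodleb n). x i \<in> B} \<in> sets (prodleb n)" by measurable
    then show ?thesis by (simp add: space_prodleb)
  qed
  have sb: "sets (borel :: real measure) = sigma_sets UNIV (range lessThan)"
    by (subst borel_Iio) (simp add: sets_measure_of)
  have "A \<in> sigma_sets UNIV (range lessThan)" using assms(2) by (simp add: sb)
  then show ?thesis
  proof (induction rule: sigma_sets.induct)
    case (Basic a)
    then show ?case using shift_cont_set_halfspace[OF assms(1)] by auto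
  next
    case Empty
    then show ?case using shift_cont_set_empty by simp
  next
    case (Compl a)
    have "{x\<in>Rn n. x i \<in> UNIV - a} = Rn n - {x\<in>Rn n. x i \<in> a}" by auto
    then show ?case using shift_cont_set_compl[OF Compl.IH] by simp
  next
    case (Union a)
    have "{x\<in>Rn n. x i \<in> (\<Union>j. a j)} = (\<Union>j. {x\<in>Rn n. x i \<in> a j})" by auto
    moreover have "a j \<in> sets borel" for j using Union.hyps by (simp add: sb)
    ultimately show ?case using shift_cont_set_UN[of n "\<lambda>j. {x\<in>Rn n. x i \<in> a j}"] Union.IH cyl by simp
  qed
qed

text \<open>The same induction once more, now over the product sigma-algebra with the cylinders as
  generators.\<close>

lemma shift_cont_set_all:
  assumes "A \<in> sets (prodleb n)"
  shows "shift_cont_set n A"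
proof -
  define G where "G = {{f \<in> \<Pi>\<^sub>E i\<in>{..<n}. space (lborel :: real measure). f i \<in> A} | i A. i \<in> {..<n} \<and> A
      \<in> sets (lborel :: real measure)}"
  have sM: "sets (prodleb n) = sigma_sets (Rn n) G"
    unfolding sets_PiM_single G_def by (simp add: Rn_def)
  have "A \<in> sigma_sets (Rn n) G" using assms sM by simp
  then show ?thesis
  proof (induction rule: sigma_sets.induct)
    case (Basic a)
    then obtain i B where "a = {f \<in> \<Pi>\<^sub>E i\<in>{..<n}. UNIV. f i \<in> B}" "i < n" "B \<in> sets borel"
      unfolding G_def by auto
    then show ?case using shift_cont_set_cylinder[of i n B] by (simp add: Rn_def)
  next
    case Empty
    then show ?case by (rule shift_cont_set_empty)
  next
    case (Compl a)
    then show ?case by (intro shift_cont_set_compl)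
  next
    case (Union a)
    then show ?case by (intro shift_cont_set_UN) (auto simp: sM)
  qed
qed

section \<open>Continuity of translations for integrable functions and in L^p\<close>

lemma nn_integral_vsub1:
  assumes "f \<in> borel_measurable (prodleb n)"
  shows "(\<integral>\<^sup>+x. f (vsub n x v) \<partial>prodleb n) = (\<integral>\<^sup>+x. f x \<partial>prodleb n)"
proof -
  have "(\<integral>\<^sup>+x. f x \<partial>prodleb n) = (\<integral>\<^sup>+x. f x \<partial>distr (prodleb n) (prodleb n) (\<lambda>x. vsub n x v))"
    by (simp only: distr_vsub1)
  also have "\<dots> = (\<integral>\<^sup>+x. f (vsub n x v) \<partial>prodleb n)"
    using assms by (intro nn_integral_distr) auto
  finally show ?thesis ..
qed

text \<open>The \<open>p\<close>-th power of an \<open>L^p\<close> distance, written as a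
  nonnegative integral so that it makes sense before integrability is known.\<close>

abbreviation Lp_dev :: "nat \<Rightarrow> real \<Rightarrow> nat \<Rightarrow> (rvec \<Rightarrow> real) \<Rightarrow> (rvec \<Rightarrow> real) \<Rightarrow> ennreal" where
  "Lp_dev n k p f g \<equiv> \<integral>\<^sup>+x. indicator (nbox n k) x * ennreal (\<bar>f x - g x\<bar> ^ p) \<partial>prodleb n"

definition shift_cont :: "nat \<Rightarrow> nat \<Rightarrow> (rvec \<Rightarrow> real) \<Rightarrow> bool" where
  "shift_cont n p f \<longleftrightarrow> (\<forall>k \<tau>. \<tau> > 0 \<longrightarrow> (\<exists>s>0. \<forall>v. small_shift n s v \<longrightarrow>
     Lp_dev n k p (\<lambda>x. f (vsub n x v)) f \<le> ennreal \<tau>))"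

lemma shift_cont_add:
  assumes "shift_cont n 1 f" "shift_cont n 1 g"
    and [measurable]: "f \<in> borel_measurable (prodleb n)" "g \<in> borel_measurable (prodleb n)"
  shows "shift_cont n 1 (\<lambda>x. f x + g x)"
  unfolding shift_cont_def
proof (intro allI impI)
  fix k \<tau> :: real assume "\<tau> > 0"
  then have "\<tau> / 2 > 0" by simp
  from assms(1) this obtain s where s: "s > 0" "\<And>v. small_shift n s v \<Longrightarrow>
     Lp_dev n k 1 (\<lambda>x. f (vsub n x v)) f \<le> ennreal (\<tau> / 2)"
    unfolding shift_cont_def by blast
  from assms(2) \<open>\<tau> / 2 > 0\<close> obtain t where t: "t > 0" "\<And>v. small_shift n t v \<Longrightarrow>
     Lp_dev n k 1 (\<lambda>x. g (vsub n x v)) g \<le> ennreal (\<tau> / 2)"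
    unfolding shift_cont_def by blast
  have "Lp_dev n k 1 (\<lambda>x. (f (vsub n x v) + g (vsub n x v))) (\<lambda>x. (f x + g x)) \<le> ennreal \<tau>"
    if v: "small_shift n (min s t) v" for v
  proof -
    have "Lp_dev n k 1 (\<lambda>x. (f (vsub n x v) + g (vsub n x v))) (\<lambda>x. (f x + g x))
      \<le> (\<integral>\<^sup>+x. indicator (nbox n k) x * ennreal (\<bar>f (vsub n x v) - f x\<bar> ^ 1)
           + indicator (nbox n k) x * ennreal (\<bar>g (vsub n x v) - g x\<bar> ^ 1) \<partial>prodleb n)"
      by (intro nn_integral_mono) (auto simp: indicator_def ennreal_plus[symmetric] simp del:
          ennreal_plus intro!: ennreal_leI)
    also have "\<dots> = Lp_dev n k 1 (\<lambda>x. f (vsub n x v)) f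
           + Lp_dev n k 1 (\<lambda>x. g (vsub n x v)) g"
      by (intro nn_integral_add) measurable
    also have "\<dots> \<le> ennreal (\<tau> / 2) + ennreal (\<tau> / 2)"
      using s t small_shift_mono[OF v] by (intro add_mono) auto
    also have "\<dots> = ennreal \<tau>" using \<open>\<tau> > 0\<close> by (simp add: ennreal_plus[symmetric] del: ennreal_plus)
    finally show ?thesis .
  qed
  then show "\<exists>s>0. \<forall>v. small_shift n s v \<longrightarrow>
     Lp_dev n k 1 (\<lambda>x. (f (vsub n x v) + g (vsub n x v))) (\<lambda>x. (f x + g x)) \<le> ennreal \<tau>"
    using s(1) t(1) by (intro exI[of _ "min s t"]) auto
qed

lemma shift_cont_indicator:
  assumes A [measurable]: "A \<in> sets (prodleb n)"
  shows "shift_cont n 1 (\<lambda>x. indicator A x *\<^sub>R c)"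
  unfolding shift_cont_def
proof (intro allI impI)
  fix k \<tau> :: real assume "\<tau> > 0"
  then have "\<tau> / (\<bar>c\<bar> + 1) > 0" by (simp add: add_nonneg_pos)
  with shift_cont_set_all[OF A] obtain s where s: "s > 0" "\<And>v. small_shift n s v \<Longrightarrow>
    measure (prodleb n) {x\<in>nbox n k. (vsub n x v \<in> A) \<noteq> (x \<in> A)} \<le> \<tau> / (\<bar>c\<bar> + 1)"
    unfolding shift_cont_set_def by blast
  have "Lp_dev n k 1 (\<lambda>x. indicator A (vsub n x v) *\<^sub>R c) (\<lambda>x. indicator A x *\<^sub>R c) \<le> ennreal \<tau>"
    if v: "small_shift n s v" for v
  proof -
    let ?D = "{x\<in>nbox n k. (vsub n x v \<in> A) \<noteq> (x \<in> A)}"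
    have Dm: "?D \<in> sets (prodleb n)" by (rule shift_diff_sets) simp
    have Df: "?D \<in> fmeasurable (prodleb n)" by (rule prodleb_sub_nbox_fmeasurable[OF _ Dm, of k]) auto
    have "Lp_dev n k 1 (\<lambda>x. indicator A (vsub n x v) *\<^sub>R c) (\<lambda>x. indicator A x *\<^sub>R c)
      = (\<integral>\<^sup>+x. ennreal \<bar>c\<bar> * indicator ?D x \<partial>prodleb n)"
      by (intro nn_integral_cong) (auto simp: indicator_def)
    also have "\<dots> = ennreal \<bar>c\<bar> * ennreal (measure (prodleb n) ?D)"
      using Dm emeasure_eq_measure2[OF Df] by (simp add: nn_integral_cmult_indicator)
    also have "\<dots> = ennreal (\<bar>c\<bar> * measure (prodleb n) ?D)" by (simp add: ennreal_mult)
    also have "\<dots> \<le> ennreal \<tau>"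
    proof (rule ennreal_leI)
      have "\<bar>c\<bar> * measure (prodleb n) ?D \<le> \<bar>c\<bar> * (\<tau> / (\<bar>c\<bar> + 1))"
        using s(2)[OF v] by (intro mult_left_mono) auto
      also have "\<dots> \<le> \<tau>" using \<open>\<tau> > 0\<close> by (simp add: field_simps)
      finally show "\<bar>c\<bar> * measure (prodleb n) ?D \<le> \<tau>" .
    qed
    finally show ?thesis .
  qed
  then show "\<exists>s>0. \<forall>v. small_shift n s v \<longrightarrow> Lp_dev n k 1 (\<lambda>x. indicator A (vsub n x v) *\<^sub>R c)
      (\<lambda>x. indicator A x *\<^sub>R c) \<le> ennreal \<tau>"
    using s(1) by auto
qed

text \<open>The limit case of the induction is a three-term estimate: \<open>f\<close> is compared
  with an approximant at \<open>x\<close> and at the shifted point, and these two comparison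
  integrals agree by translation invariance.\<close>

lemma shift_cont_integrable:
  assumes "integrable (prodleb n) f"
  shows "shift_cont n 1 f"
  using assms
proof (induction rule: integrable_induct)
  case (base A c)
  then show ?case by (intro shift_cont_indicator)
next
  case (add f g)
  then show ?case by (intro shift_cont_add) auto
next
  case (lim f s)
  have [measurable]: "f \<in> borel_measurable (prodleb n)" "\<And>i. s i \<in> borel_measurable (prodleb n)"
    using lim by auto
  have l0: "(\<lambda>i. \<integral>\<^sup>+x. ennreal (norm (f x - s i x)) \<partial>prodleb n) \<longlonglongrightarrow> 0"
  proof (rule nn_integral_dominated_convergence_norm[where w = "\<lambda>x. 2 * norm (f x)"])
    have "integrable (prodleb n) (\<lambda>x. 2 * norm (f x))" using lim.hyps by auto
    then show "(\<integral>\<^sup>+x. ennreal (2 * norm (f x)) \<partial>prodleb n) < \<infinity>"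
      unfolding integrable_iff_bounded by simp
  qed (use lim.hyps in auto)
  show ?case
    unfolding shift_cont_def
  proof (intro allI impI)
    fix k \<tau> :: real assume "\<tau> > 0"
    have "eventually (\<lambda>i. (\<integral>\<^sup>+x. ennreal (norm (f x - s i x)) \<partial>prodleb n) < ennreal (\<tau>/3)) sequentially"
      using \<open>\<tau> > 0\<close> by (intro order_tendstoD[OF l0]) auto
    then obtain i where i: "(\<integral>\<^sup>+x. ennreal \<bar>f x - s i x\<bar> \<partial>prodleb n) \<le> ennreal (\<tau>/3)"
      by (auto simp: eventually_sequentially intro: less_imp_le)
    obtain \<sigma> where \<sigma>: "\<sigma> > 0" "\<And>v. small_shift n \<sigma> v \<Longrightarrow>
     Lp_dev n k 1 (\<lambda>x. s i (vsub n x v)) (s i) \<le> ennreal (\<tau>/3)"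
      using lim.IH[of i] \<open>\<tau> > 0\<close> unfolding shift_cont_def by (meson divide_pos_pos zero_less_numeral)
    have "Lp_dev n k 1 (\<lambda>x. f (vsub n x v)) f \<le> ennreal \<tau>"
      if v: "small_shift n \<sigma> v" for v
    proof -
      have "Lp_dev n k 1 (\<lambda>x. f (vsub n x v)) f
        \<le> (\<integral>\<^sup>+x. (ennreal \<bar>f (vsub n x v) - s i (vsub n x v)\<bar> +
          indicator (nbox n k) x * ennreal (\<bar>s i (vsub n x v) - s i x\<bar> ^ 1)) + ennreal \<bar>f x - s i x\<bar>
              \<partial>prodleb n)"
        by (intro nn_integral_mono) (auto simp: indicator_def ennreal_plus[symmetric] simp del:
            ennreal_plus intro!: ennreal_leI)
      also have "\<dots> = ((\<integral>\<^sup>+x. ennreal \<bar>f (vsub n x v) - s i (vsub n x v)\<bar> \<partial>prodleb n) +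
          Lp_dev n k 1 (\<lambda>x. s i (vsub n x v)) (s i))
          + (\<integral>\<^sup>+x. ennreal \<bar>f x - s i x\<bar> \<partial>prodleb n)"
        by (subst nn_integral_add; (subst nn_integral_add)?) auto
      also have "(\<integral>\<^sup>+x. ennreal \<bar>f (vsub n x v) - s i (vsub n x v)\<bar> \<partial>prodleb n)
          = (\<integral>\<^sup>+x. ennreal \<bar>f x - s i x\<bar> \<partial>prodleb n)"
        by (rule nn_integral_vsub1) measurable
      also have "((\<integral>\<^sup>+x. ennreal \<bar>f x - s i x\<bar> \<partial>prodleb n) +
          Lp_dev n k 1 (\<lambda>x. s i (vsub n x v)) (s i))
          + (\<integral>\<^sup>+x. ennreal \<bar>f x - s i x\<bar> \<partial>prodleb n) \<le> (ennreal (\<tau>/3) + ennreal (\<tau>/3)) + ennreal (\<tau>/3)"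
        using i \<sigma>(2)[OF v] by (intro add_mono)
      also have "\<dots> = ennreal \<tau>" using \<open>\<tau> > 0\<close> by (simp add: ennreal_plus[symmetric] del: ennreal_plus)
      finally show ?thesis .
    qed
    then show "\<exists>s>0. \<forall>v. small_shift n s v \<longrightarrow>
     Lp_dev n k 1 (\<lambda>x. f (vsub n x v)) f \<le> ennreal \<tau>"
      using \<sigma>(1) by auto
  qed
qed

lemma power_add_superadditive:
  fixes a b :: real
  assumes "a \<ge> 0" "b \<ge> 0" "p \<ge> 1"
  shows "a ^ p + b ^ p \<le> (a + b) ^ p"
  using \<open>p \<ge> 1\<close>
proof (induction p rule: dec_induct)
  case (step p)
  have "a ^ Suc p + b ^ Suc p \<le> (a + b) * (a ^ p + b ^ p)"
    using assms by (simp add: algebra_simps)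
  also have "\<dots> \<le> (a + b) * (a + b) ^ p" using assms step by (intro mult_left_mono) auto
  finally show ?case by simp
qed simp

lemma add_power_le:
  fixes a b :: real
  assumes "a \<ge> 0" "b \<ge> 0"
  shows "(a + b) ^ p \<le> 2 ^ p * (a ^ p + b ^ p)"
proof -
  have "(a + b) ^ p \<le> (2 * max a b) ^ p" using assms by (intro power_mono) auto
  also have "\<dots> = 2 ^ p * max a b ^ p" by (simp add: power_mult_distrib)
  also have "max a b ^ p \<le> a ^ p + b ^ p" using assms by (auto simp: max_def)
  finally show ?thesis by simp
qed

text \<open>The signed power \<open>t \<mapsto> sgn t |t|^p\<close> turns a function in
  \<open>L^p\<close> into an integrable one; this inequality carries continuity of translations back
  from \<open>L^1\<close> to \<open>L^p\<close>, with no density argument in \<open>L^p\<close>. For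
  equal signs superadditivity of powers would give the constant \<open>1\<close>; opposite signs
  cost \<open>2^p\<close>.\<close>

lemma diff_power_le_signed_power:
  fixes a b :: real
  assumes "p \<ge> 1"
  shows "\<bar>a - b\<bar> ^ p \<le> 2 ^ p * \<bar>sgn a * \<bar>a\<bar> ^ p - sgn b * \<bar>b\<bar> ^ p\<bar>"
proof -
  have same: "(a - b) ^ p \<le> 2 ^ p * (a ^ p - b ^ p)" if "a \<ge> b" "b \<ge> 0" for a b :: real
  proof -
    have "(a - b) ^ p + b ^ p \<le> a ^ p" using power_add_superadditive[of "a - b" b p] that assms by simp
    moreover have "1 * (a ^ p - b ^ p) \<le> 2 ^ p * (a ^ p - b ^ p)"
      using that by (intro mult_right_mono) (auto intro: power_mono)
    ultimately show ?thesis by simp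
  qed
  have p0: "(0::real) ^ p = 0" using assms by simp
  consider "a \<ge> b" "b \<ge> 0" | "b \<ge> a" "a \<ge> 0" | "a \<le> b" "b \<le> 0" | "b \<le> a" "a \<le> 0" | "a > 0" "b < 0" | "a
      < 0" "b > 0"
    by linarith
  then show ?thesis
  proof cases
    case 1
    have "b ^ p \<le> a ^ p" using 1 by (intro power_mono) auto
    then show ?thesis using same[of b a] 1 p0 by (cases "b = 0"; cases "a = 0") (auto simp: zero_power)
  next
    case 2
    have "a ^ p \<le> b ^ p" using 2 by (intro power_mono) auto
    then show ?thesis using same[of a b] 2 p0 by (cases "b = 0"; cases "a = 0")
        (auto simp: abs_minus_commute zero_power)
  next
    case 3
    have "(-b) ^ p \<le> (-a) ^ p" using 3 by (intro power_mono) auto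
    then show ?thesis using same[of "-b" "-a"] 3 p0 by (cases "b = 0"; cases "a = 0")
        (auto simp: abs_minus_commute zero_power power_abs)
  next
    case 4
    have "(-a) ^ p \<le> (-b) ^ p" using 4 by (intro power_mono) auto
    then show ?thesis using same[of "-a" "-b"] 4 p0 by (cases "b = 0"; cases "a = 0")
        (auto simp: abs_minus_commute zero_power power_abs)
  next
    case 5
    then show ?thesis using add_power_le[of a "-b" p] by auto
  next
    case 6
    have "0 \<le> (- a) ^ p + b ^ p" using 6 by (intro add_nonneg_nonneg) auto
    moreover have "sgn a * \<bar>a\<bar> ^ p - sgn b * \<bar>b\<bar> ^ p = - ((- a) ^ p + b ^ p)" using 6 by simp
    ultimately have "\<bar>sgn a * \<bar>a\<bar> ^ p - sgn b * \<bar>b\<bar> ^ p\<bar> = (- a) ^ p + b ^ p" by linarith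
    moreover have "\<bar>a - b\<bar> = - a + b" using 6 by simp
    ultimately show ?thesis using add_power_le[of "-a" b p] 6 by simp
  qed
qed

lemma shift_cont_power:
  assumes [measurable]: "f \<in> borel_measurable (prodleb n)" and int: "integrable (prodleb n)
      (\<lambda>x. \<bar>f x\<bar> ^ p)" and p: "p \<ge> 1"
  shows "shift_cont n p f"
  unfolding shift_cont_def
proof (intro allI impI)
  fix k \<tau> :: real assume "\<tau> > 0"
  define g where "g x = sgn (f x) * \<bar>f x\<bar> ^ p" for x
  have [measurable]: "g \<in> borel_measurable (prodleb n)" unfolding g_def by measurable
  have "integrable (prodleb n) g"
    by (rule Bochner_Integration.integrable_bound[OF int]) (auto simp: g_def abs_mult abs_sgn_eq)
  then have "shift_cont n 1 g" by (rule shift_cont_integrable)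
  moreover have "\<tau> / 2 ^ p > 0" using \<open>\<tau> > 0\<close> by simp
  ultimately obtain s where s: "s > 0" "\<And>v. small_shift n s v \<Longrightarrow>
     Lp_dev n k 1 (\<lambda>x. g (vsub n x v)) g \<le> ennreal (\<tau> / 2 ^ p)"
    unfolding shift_cont_def by blast
  have "Lp_dev n k p (\<lambda>x. f (vsub n x v)) f \<le> ennreal \<tau>"
    if v: "small_shift n s v" for v
  proof -
    have "Lp_dev n k p (\<lambda>x. f (vsub n x v)) f
      \<le> (\<integral>\<^sup>+x. ennreal (2 ^ p) * (indicator (nbox n k) x * ennreal (\<bar>g (vsub n x v) - g x\<bar> ^ 1))
          \<partial>prodleb n)"
      using diff_power_le_signed_power[OF p]
      by (intro nn_integral_mono) (auto simp: indicator_def g_def ennreal_mult[symmetric] intro!: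
          ennreal_leI)
    also have "\<dots> = ennreal (2 ^ p) * Lp_dev n k 1 (\<lambda>x. g (vsub n x v)) g"
      by (intro nn_integral_cmult) measurable
    also have "\<dots> \<le> ennreal (2 ^ p) * ennreal (\<tau> / 2 ^ p)"
      by (intro mult_left_mono s(2) v) auto
    also have "\<dots> = ennreal \<tau>" using \<open>\<tau> > 0\<close> by (simp add: ennreal_mult[symmetric])
    finally show ?thesis .
  qed
  then show "\<exists>s>0. \<forall>v. small_shift n s v \<longrightarrow>
     Lp_dev n k p (\<lambda>x. f (vsub n x v)) f \<le> ennreal \<tau>"
    using s(1) by auto
qed

section \<open>Mollification\<close>

text \<open>One profile per coordinate: a partial derivative exchanges one profile for its
  derivative, so derivatives of kernels are again kernels of this form.\<close>

definition kern :: "nat \<Rightarrow> (nat \<Rightarrow> real \<Rightarrow> real) \<Rightarrow> rvec \<Rightarrow> rvec \<Rightarrow> real" where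
  "kern n g x z = (\<Prod>i<n. g i (x i - z i))"

definition conv :: "nat \<Rightarrow> (rvec \<Rightarrow> real) \<Rightarrow> (nat \<Rightarrow> real \<Rightarrow> real) \<Rightarrow> rvec \<Rightarrow> real" where
  "conv n f g x = (LINT z|prodleb n. f z * kern n g x z)"

definition bump_kernel :: "(real \<Rightarrow> real) \<Rightarrow> real \<Rightarrow> bool" where
  "bump_kernel \<psi> \<epsilon> \<longleftrightarrow> \<psi> \<in> borel_measurable borel \<and> (\<forall>t. 0 \<le> \<psi> t) \<and>
     (\<forall>t. \<epsilon> < \<bar>t\<bar> \<longrightarrow> \<psi> t = 0) \<and> (\<exists>B. \<forall>t. \<psi> t \<le> B) \<and> integral\<^sup>L lborel \<psi> = 1"

lemma component_measurable [measurable]: "i < n \<Longrightarrow> (\<lambda>x. x i) \<in> borel_measurable (prodleb n)"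
  using measurable_component_singleton[of i "{..<n}" "\<lambda>_. lborel"] by simp

lemma kern_measurable:
  assumes "\<And>i. i < n \<Longrightarrow> g i \<in> borel_measurable borel"
  shows "kern n g x \<in> borel_measurable (prodleb n)"
  unfolding kern_def
proof (intro borel_measurable_prod)
  fix i assume "i \<in> {..<n}"
  then have "(\<lambda>z. x i - z i) \<in> borel_measurable (prodleb n)" by simp
  then show "(\<lambda>z. g i (x i - z i)) \<in> borel_measurable (prodleb n)"
    using measurable_compose[of _ _ borel "g i" borel] assms \<open>i \<in> {..<n}\<close> by simp
qed

lemma abs_prod_le:
  fixes h :: "nat \<Rightarrow> real"
  assumes "\<And>i. i < n \<Longrightarrow> \<bar>h i\<bar> \<le> B"
  shows "\<bar>\<Prod>i<n. h i\<bar> \<le> B ^ n"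
proof -
  have "\<bar>\<Prod>i<n. h i\<bar> = (\<Prod>i<n. \<bar>h i\<bar>)" by (rule abs_prod)
  also have "\<dots> \<le> (\<Prod>i<n. B)" using assms by (intro prod_mono) auto
  finally show ?thesis by simp
qed

lemma kern_bound:
  assumes "\<And>i t. i < n \<Longrightarrow> \<bar>g i t\<bar> \<le> B"
  shows "\<bar>kern n g x z\<bar> \<le> B ^ n"
  unfolding kern_def using assms by (intro abs_prod_le) auto

lemma integrable_mult_bounded:
  fixes f k :: "'a \<Rightarrow> real"
  assumes "integrable M f" "k \<in> borel_measurable M" "\<And>x. \<bar>k x\<bar> \<le> B"
  shows "integrable M (\<lambda>x. f x * k x)"
proof (rule Bochner_Integration.integrable_bound[of M "\<lambda>x. B * f x"])
  show "AE x in M. norm (f x * k x) \<le> norm (B * f x)"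
  proof (rule AE_I2)
    fix x
    have "\<bar>k x\<bar> \<le> \<bar>B\<bar>" using assms(3)[of x] by linarith
    then have "\<bar>f x\<bar> * \<bar>k x\<bar> \<le> \<bar>f x\<bar> * \<bar>B\<bar>" by (intro mult_left_mono) auto
    then show "norm (f x * k x) \<le> norm (B * f x)"
      by (simp add: abs_mult mult.commute)
  qed
qed (use assms in auto)

lemma conv_integrable:
  assumes "integrable (prodleb n) f" "\<And>i. i < n \<Longrightarrow> g i \<in> borel_measurable borel"
    "\<And>i t. i < n \<Longrightarrow> \<bar>g i t\<bar> \<le> B"
  shows "integrable (prodleb n) (\<lambda>z. f z * kern n g x z)"
  using assms by (intro integrable_mult_bounded[where B = "B ^ n"] kern_measurable kern_bound) auto

lemma kern_vsub: "kern n g x (vsub n x v) = (\<Prod>i<n. g i (v i))"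
  unfolding kern_def by (intro prod.cong) auto

lemma integral_vsub2:
  fixes F :: "rvec \<Rightarrow> real"
  assumes "F \<in> borel_measurable (prodleb n)"
  shows "(LINT z|prodleb n. F z) = (LINT v|prodleb n. F (vsub n x v))"
proof -
  have "(LINT z|prodleb n. F z) = (LINT z|distr (prodleb n) (prodleb n) (\<lambda>v. vsub n x v). F z)"
    by (simp only: distr_vsub2)
  also have "\<dots> = (LINT v|prodleb n. F (vsub n x v))"
    using assms by (intro integral_distr) auto
  finally show ?thesis .
qed

lemma integrable_vsub2:
  fixes F :: "rvec \<Rightarrow> real"
  assumes "integrable (prodleb n) F"
  shows "integrable (prodleb n) (\<lambda>v. F (vsub n x v))"
proof (rule integrable_distr[of "\<lambda>v. vsub n x v" "prodleb n" "prodleb n"])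
  show "integrable (distr (prodleb n) (prodleb n) (vsub n x)) F"
    using assms distr_vsub2[of n x] by simp
qed simp

lemma bump_kernel_prod:
  assumes "bump_kernel \<psi> \<epsilon>"
  shows "integrable (prodleb n) (\<lambda>v. \<Prod>i<n. \<psi> (v i))" "(LINT v|prodleb n. (\<Prod>i<n. \<psi> (v i))) = 1"
proof -
  have "integrable lborel \<psi>"
    using assms not_integrable_integral_eq[of lborel \<psi>] unfolding bump_kernel_def by force
  then show "integrable (prodleb n) (\<lambda>v. \<Prod>i<n. \<psi> (v i))"
    by (intro lborel_prod.product_integrable_prod) auto
  show "(LINT v|prodleb n. (\<Prod>i<n. \<psi> (v i))) = 1"
    using \<open>integrable lborel \<psi>\<close> assms
    by (subst lborel_prod.product_integral_prod) (auto simp: bump_kernel_def)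
qed

lemma power_tangent:
  fixes c t :: real
  assumes "c \<ge> 0" "t \<ge> 0" "p \<ge> 1"
  shows "t ^ p \<ge> c ^ p + real p * c ^ (p - 1) * (t - c)"
  using \<open>p \<ge> 1\<close>
proof (induction p rule: dec_induct)
  case (step p)
  obtain q where q: "p = Suc q" using step by (cases p) auto
  have "t * (c ^ p + real p * c ^ (p - 1) * (t - c)) \<le> t * t ^ p"
    using step assms by (intro mult_left_mono) auto
  moreover have "t * (c ^ p + real p * c ^ (p - 1) * (t - c)) -
      (c ^ Suc p + real (Suc p) * c ^ (Suc p - 1) * (t - c))
     = real p * c ^ (p - 1) * (t - c)\<^sup>2"
    unfolding q by (simp add: algebra_simps power2_eq_square)
  moreover have "0 \<le> real p * c ^ (p - 1) * (t - c)\<^sup>2" using assms by simp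
  ultimately show ?case by simp
qed simp

text \<open>The tangent line inequality for \<open>t^p\<close> at
  \<open>c = |\<integral> k g|\<close> is integrated against the probability density
  \<open>k\<close>; the linear term is nonnegative because
  \<open>c \<le> \<integral> k |g|\<close>.\<close>

lemma power_jensen:
  fixes k g :: "'a \<Rightarrow> real"
  assumes k: "integrable M k" "\<And>x. 0 \<le> k x" "integral\<^sup>L M k = 1"
    and [measurable]: "g \<in> borel_measurable M" and p: "p \<ge> 1"
  shows "ennreal (\<bar>LINT x|M. k x * g x\<bar> ^ p) \<le> (\<integral>\<^sup>+x. ennreal (k x * \<bar>g x\<bar> ^ p) \<partial>M)"
proof (cases "integrable M (\<lambda>x. k x * g x) \<and> (\<integral>\<^sup>+x. ennreal (k x * \<bar>g x\<bar> ^ p) \<partial>M) < \<infinity>")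
  case False
  \<comment> \<open>A non-integrable \<open>k g\<close> has integral \<open>0\<close> by convention;
    in the remaining case the right-hand side is infinite.\<close>
  have "\<bar>LINT x|M. k x * g x\<bar> ^ p = 0" if "\<not> integrable M (\<lambda>x. k x * g x)"
    using not_integrable_integral_eq[OF that] p by (simp add: zero_power)
  moreover have "(\<integral>\<^sup>+x. ennreal (k x * \<bar>g x\<bar> ^ p) \<partial>M) = \<infinity>" if "integrable M (\<lambda>x. k x * g x)"
    using False that by (simp add: less_top[symmetric])
  ultimately show ?thesis by (cases "integrable M (\<lambda>x. k x * g x)") (auto simp: zero_power)
next
  case True
  have [measurable]: "k \<in> borel_measurable M" using k by auto
  have i1: "integrable M (\<lambda>x. k x * \<bar>g x\<bar>)"
    using integrable_norm[OF conjunct1[OF True]] k(2) by (simp add: abs_mult)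
  have i2: "integrable M (\<lambda>x. k x * \<bar>g x\<bar> ^ p)"
    using True k(2) by (intro integrableI_nonneg) auto
  define c where "c = \<bar>LINT x|M. k x * g x\<bar>"
  have c0: "c \<ge> 0" by (simp add: c_def)
  have c1: "c \<le> (LINT x|M. k x * \<bar>g x\<bar>)"
    using integral_norm_bound[of M "\<lambda>x. k x * g x"] k(2) by (simp add: c_def abs_mult)
  have "c ^ p \<le> c ^ p + real p * c ^ (p - 1) * ((LINT x|M. k x * \<bar>g x\<bar>) - c)"
    using c0 c1 by simp
  also have "\<dots> = (LINT x|M. c ^ p * k x + real p * c ^ (p - 1) * (k x * \<bar>g x\<bar> - c * k x))"
    using i1 k by simp
  also have "\<dots> \<le> (LINT x|M. k x * \<bar>g x\<bar> ^ p)"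
  proof (rule integral_mono)
    show "integrable M (\<lambda>x. c ^ p * k x + real p * c ^ (p - 1) * (k x * \<bar>g x\<bar> - c * k x))"
      using i1 k by auto
    fix x
    have "c ^ p * k x + real p * c ^ (p - 1) * (k x * \<bar>g x\<bar> - c * k x)
       = k x * (c ^ p + real p * c ^ (p - 1) * (\<bar>g x\<bar> - c))" by (simp add: algebra_simps)
    also have "\<dots> \<le> k x * \<bar>g x\<bar> ^ p"
      using c0 p k(2) by (intro mult_left_mono power_tangent) auto
    finally show "c ^ p * k x + real p * c ^ (p - 1) * (k x * \<bar>g x\<bar> - c * k x) \<le> k x * \<bar>g x\<bar> ^ p" .
  qed (rule i2)
  finally have "ennreal (c ^ p) \<le> ennreal (LINT x|M. k x * \<bar>g x\<bar> ^ p)" by (rule ennreal_leI)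
  also have "\<dots> = (\<integral>\<^sup>+x. ennreal (k x * \<bar>g x\<bar> ^ p) \<partial>M)"
    using i2 k(2) by (intro nn_integral_eq_integral[symmetric]) auto
  finally show ?thesis by (simp add: c_def)
qed

text \<open>After reflecting the variable of integration, the unit mass of the kernel moves the
  constant under the integral. With \<open>c\<close> a value at \<open>x\<close>, the mollification
  error becomes an average of differences.\<close>

lemma conv_diff:
  assumes f: "integrable (prodleb n) f" and \<psi>: "bump_kernel \<psi> \<epsilon>"
  shows "integrable (prodleb n) (\<lambda>v. (\<Prod>i<n. \<psi> (v i)) * (f (vsub n x v) - c))"
    "conv n f (\<lambda>_. \<psi>) x - c = (LINT v|prodleb n. (\<Prod>i<n. \<psi> (v i)) * (f (vsub n x v) - c))"
proof -
  obtain B where B: "\<And>t. \<psi> t \<le> B" and p0: "\<And>t. 0 \<le> \<psi> t" and [measurable]: "\<psi> \<in> borel_measurable borel"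
    using \<psi> unfolding bump_kernel_def by blast
  have [measurable]: "f \<in> borel_measurable (prodleb n)" using f by auto
  have int: "integrable (prodleb n) (\<lambda>z. f z * kern n (\<lambda>_. \<psi>) x z)"
    using B p0 by (intro conv_integrable[where B = B] f) auto
  have i1: "integrable (prodleb n) (\<lambda>v. f (vsub n x v) * (\<Prod>i<n. \<psi> (v i)))"
    using integrable_vsub2[OF int, of x] by (simp add: kern_vsub)
  have e: "conv n f (\<lambda>_. \<psi>) x = (LINT v|prodleb n. f (vsub n x v) * (\<Prod>i<n. \<psi> (v i)))"
    unfolding conv_def using integral_vsub2[of "\<lambda>z. f z * kern n (\<lambda>_. \<psi>) x z" n x] int by
        (auto simp: kern_vsub)
  have i2: "integrable (prodleb n) (\<lambda>v. f (vsub n x v) * (\<Prod>i<n. \<psi> (v i)) - c * (\<Prod>i<n. \<psi> (v i)))"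
    using i1 bump_kernel_prod(1)[OF \<psi>] by (intro Bochner_Integration.integrable_diff
        integrable_mult_right) auto
  have eq: "(\<lambda>v. f (vsub n x v) * (\<Prod>i<n. \<psi> (v i)) - c * (\<Prod>i<n. \<psi> (v i)))
     = (\<lambda>v. (\<Prod>i<n. \<psi> (v i)) * (f (vsub n x v) - c))"
    by (auto simp: algebra_simps)
  show "integrable (prodleb n) (\<lambda>v. (\<Prod>i<n. \<psi> (v i)) * (f (vsub n x v) - c))"
    using i2 unfolding eq .
  have "(LINT v|prodleb n. f (vsub n x v) * (\<Prod>i<n. \<psi> (v i)) - c * (\<Prod>i<n. \<psi> (v i))) = conv n f (\<lambda>_. \<psi>) x - c"
    using i1 bump_kernel_prod[OF \<psi>, of n] e by (subst Bochner_Integration.integral_diff) auto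
  then show "conv n f (\<lambda>_. \<psi>) x - c = (LINT v|prodleb n. (\<Prod>i<n. \<psi> (v i)) * (f (vsub n x v) - c))"
    unfolding eq by simp
qed

lemma bump_prod_zero:
  assumes "bump_kernel \<psi> \<epsilon>" "\<not> small_shift n \<epsilon> v"
  shows "(\<Prod>i<n. \<psi> (v i)) = 0"
proof -
  obtain i where "i < n" "\<epsilon> < \<bar>v i\<bar>" using assms(2) by (auto simp: small_shift_def not_le)
  then show ?thesis using assms(1) by (auto simp: bump_kernel_def)
qed

text \<open>The hypothesis is only an almost everywhere one, because the convolved function will be
  a Borel version of a continuous function rather than that function itself.\<close>

lemma conv_close:
  assumes f: "integrable (prodleb n) f" and \<psi>: "bump_kernel \<psi> \<epsilon>"
    and c: "AE v in prodleb n. small_shift n \<epsilon> v \<longrightarrow> \<bar>f (vsub n x v) - c\<bar> \<le> \<tau>"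
  shows "\<bar>conv n f (\<lambda>_. \<psi>) x - c\<bar> \<le> \<tau>"
proof -
  have pp: "0 \<le> (\<Prod>i<n. \<psi> (v i))" for v using \<psi> by (intro prod_nonneg) (auto simp: bump_kernel_def)
  have "\<bar>conv n f (\<lambda>_. \<psi>) x - c\<bar> \<le> (LINT v|prodleb n. \<bar>(\<Prod>i<n. \<psi> (v i)) * (f (vsub n x v) - c)\<bar>)"
    unfolding conv_diff(2)[OF f \<psi>] by (rule integral_abs_bound)
  also have "\<dots> \<le> (LINT v|prodleb n. (\<Prod>i<n. \<psi> (v i)) * \<tau>)"
  proof (rule integral_mono_AE)
    show "integrable (prodleb n) (\<lambda>v. \<bar>(\<Prod>i<n. \<psi> (v i)) * (f (vsub n x v) - c)\<bar>)"
      using conv_diff(1)[OF f \<psi>] by (rule integrable_abs)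
    show "integrable (prodleb n) (\<lambda>v. (\<Prod>i<n. \<psi> (v i)) * \<tau>)"
      using bump_kernel_prod[OF \<psi>] by auto
    show "AE v in prodleb n. \<bar>(\<Prod>i<n. \<psi> (v i)) * (f (vsub n x v) - c)\<bar> \<le> (\<Prod>i<n. \<psi> (v i)) * \<tau>"
      using c
    proof eventually_elim
      case (elim v)
      show ?case
      proof (cases "small_shift n \<epsilon> v")
        case True
        then show ?thesis using elim pp[of v] by (simp add: abs_mult mult_left_mono)
      qed (simp add: bump_prod_zero[OF \<psi>])
    qed
  qed
  also have "\<dots> = \<tau>" using bump_kernel_prod[OF \<psi>, of n] by simp
  finally show ?thesis .
qed

lemma conv_measurable:
  assumes [measurable]: "f \<in> borel_measurable (prodleb n)"
    and g: "\<And>i. i < n \<Longrightarrow> g i \<in> borel_measurable borel"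
  shows "conv n f g \<in> borel_measurable (prodleb n)"
proof -
  interpret sigma_finite_measure "prodleb n" by (rule sigma_finite_prodleb)
  have [measurable]: "(\<lambda>w. kern n g (fst w) (snd w)) \<in> borel_measurable (prodleb n \<Otimes>\<^sub>M prodleb n)"
    unfolding kern_def
  proof (intro borel_measurable_prod)
    fix i assume i: "i \<in> {..<n}"
    then have "(\<lambda>w. fst w i - snd w i) \<in> borel_measurable (prodleb n \<Otimes>\<^sub>M prodleb n)"
      using measurable_compose[OF measurable_fst component_measurable]
          measurable_compose[OF measurable_snd component_measurable]
      by (intro borel_measurable_diff) simp_all
    then show "(\<lambda>w. g i (fst w i - snd w i)) \<in> borel_measurable (prodleb n \<Otimes>\<^sub>M prodleb n)"
      using measurable_compose[of _ _ borel "g i" borel] g i by simp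
  qed
  have "(\<lambda>(x, z). f z * kern n g x z) \<in> borel_measurable (prodleb n \<Otimes>\<^sub>M prodleb n)"
    unfolding split_beta' by measurable
  then show ?thesis unfolding conv_def by (intro borel_measurable_lebesgue_integral)
qed

text \<open>Jensen moves the \<open>p\<close>-th power inside the average over shifts, Fubini
  exchanges the integrals, and each shift then contributes at most \<tau>. The threshold
  \<open>s\<close> is valid for all kernels of small support, so that one kernel can later serve
  several functions at once.\<close>

lemma conv_Lp_close:
  assumes f: "integrable (prodleb n) f" and fp: "integrable (prodleb n) (\<lambda>x. \<bar>f x\<bar> ^ p)"
    and p: "p \<ge> 1" and "\<tau> > 0"
  shows "\<exists>s>0. \<forall>\<psi> \<epsilon>. bump_kernel \<psi> \<epsilon> \<longrightarrow> \<epsilon> \<le> s \<longrightarrow>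
     Lp_dev n k p (conv n f (\<lambda>_. \<psi>)) f \<le> ennreal \<tau>"
proof -
  have [measurable]: "f \<in> borel_measurable (prodleb n)" using f by auto
  interpret S: sigma_finite_measure "prodleb n" by (rule sigma_finite_prodleb)
  interpret P: pair_sigma_finite "prodleb n" "prodleb n" ..
  obtain s where s: "s > 0" "\<And>v. small_shift n s v \<Longrightarrow>
     Lp_dev n k p (\<lambda>x. f (vsub n x v)) f \<le> ennreal \<tau>"
    using shift_cont_power[OF \<open>f \<in> _\<close> fp p] \<open>\<tau> > 0\<close> unfolding shift_cont_def by blast
  have "Lp_dev n k p (conv n f (\<lambda>_. \<psi>)) f \<le> ennreal \<tau>"
    if \<psi>: "bump_kernel \<psi> \<epsilon>" and "\<epsilon> \<le> s" for \<psi> \<epsilon>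
  proof -
    define K where "K v = (\<Prod>i<n. \<psi> (v i))" for v
    have K0: "0 \<le> K v" for v using \<psi> unfolding K_def by (intro prod_nonneg) (auto simp: bump_kernel_def)
    have Ki: "integrable (prodleb n) K" "integral\<^sup>L (prodleb n) K = 1"
      using bump_kernel_prod[OF \<psi>] by (auto simp: K_def[abs_def])
    then have [measurable]: "K \<in> borel_measurable (prodleb n)" by auto
    have "Lp_dev n k p (conv n f (\<lambda>_. \<psi>)) f
      \<le> (\<integral>\<^sup>+x. indicator (nbox n k) x * (\<integral>\<^sup>+v. ennreal (K v * \<bar>f (vsub n x v) - f x\<bar> ^ p) \<partial>prodleb n)
          \<partial>prodleb n)"
    proof (intro nn_integral_mono mult_left_mono)
      fix x
      show "ennreal (\<bar>conv n f (\<lambda>_. \<psi>) x - f x\<bar> ^ p) \<le> (\<integral>\<^sup>+v. ennreal (K v * \<bar>f (vsub n x v) - f x\<bar> ^ p)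
          \<partial>prodleb n)"
        unfolding conv_diff(2)[OF f \<psi>] K_def[symmetric] using Ki K0 p by (intro power_jensen) auto
    qed auto
    also have "\<dots> = (\<integral>\<^sup>+x. (\<integral>\<^sup>+v. indicator (nbox n k) x * ennreal (K v * \<bar>f (vsub n x v) - f x\<bar> ^ p)
        \<partial>prodleb n) \<partial>prodleb n)"
      by (intro nn_integral_cong nn_integral_cmult[symmetric]) measurable
    also have "\<dots> = (\<integral>\<^sup>+v. (\<integral>\<^sup>+x. indicator (nbox n k) x * ennreal (K v * \<bar>f (vsub n x v) - f x\<bar> ^ p)
        \<partial>prodleb n) \<partial>prodleb n)"
    proof (rule P.Fubini'[symmetric])
      have "(\<lambda>w. f (vsub n (fst w) (snd w))) \<in> borel_measurable (prodleb n \<Otimes>\<^sub>M prodleb n)"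
        using measurable_compose[OF vsub_measurable_pair \<open>f \<in> _\<close>] by (simp add: split_beta')
      then show "(\<lambda>(x, v). indicator (nbox n k) x * ennreal (K v * \<bar>f (vsub n x v) - f x\<bar> ^ p))
         \<in> borel_measurable (prodleb n \<Otimes>\<^sub>M prodleb n)"
        unfolding split_beta' by measurable
    qed
    also have "\<dots> \<le> (\<integral>\<^sup>+v. ennreal (K v) * ennreal \<tau> \<partial>prodleb n)"
    proof (rule nn_integral_mono)
      fix v
      have "(\<integral>\<^sup>+x. indicator (nbox n k) x * ennreal (K v * \<bar>f (vsub n x v) - f x\<bar> ^ p) \<partial>prodleb n)
         = (\<integral>\<^sup>+x. ennreal (K v) * (indicator (nbox n k) x * ennreal (\<bar>f (vsub n x v) - f x\<bar> ^ p))
             \<partial>prodleb n)"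
        using K0 by (intro nn_integral_cong) (auto simp: ennreal_mult mult_ac)
      also have "\<dots> = ennreal (K v) * Lp_dev n k p (\<lambda>x. f (vsub n x v)) f"
        by (intro nn_integral_cmult) measurable
      also have "\<dots> \<le> ennreal (K v) * ennreal \<tau>"
      proof (cases "small_shift n \<epsilon> v")
        case True
        then have "small_shift n s v" using \<open>\<epsilon> \<le> s\<close> by (rule small_shift_mono)
        then show ?thesis by (intro mult_left_mono s(2)) auto
      next
        case False
        then have "K v = 0" unfolding K_def by (rule bump_prod_zero[OF \<psi>])
        then show ?thesis by simp
      qed
      finally show "(\<integral>\<^sup>+x. indicator (nbox n k) x * ennreal (K v * \<bar>f (vsub n x v) - f x\<bar> ^ p) \<partial>prodleb n)
        \<le> ennreal (K v) * ennreal \<tau>" .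
    qed
    also have "\<dots> = ennreal \<tau> * (\<integral>\<^sup>+v. ennreal (K v) \<partial>prodleb n)"
      by (subst nn_integral_multc) (auto simp: mult.commute)
    also have "(\<integral>\<^sup>+v. ennreal (K v) \<partial>prodleb n) = 1"
      using Ki K0 by (subst nn_integral_eq_integral) auto
    finally show ?thesis by simp
  qed
  then show ?thesis using s(1) by blast
qed

section \<open>Differentiating mollified functions along lines\<close>

lemma kern_line_deriv:
  assumes "\<And>i t. i < n \<Longrightarrow> (g i has_real_derivative g' i t) (at t)"
  shows "((\<lambda>t. kern n g (\<lambda>i. x i + t * v i) z) has_real_derivative
     (\<Sum>j<n. v j * kern n (g(j := g' j)) (\<lambda>i. x i + s * v i) z)) (at s)"
proof -
  have d: "((\<lambda>t. g i (x i + t * v i - z i)) has_real_derivative v i * g' i (x i + s * v i - z i)) (at s)"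
    if "i \<in> {..<n}" for i
  proof -
    have "((\<lambda>t. x i + t * v i - z i) has_real_derivative v i) (at s)"
      by (auto intro!: derivative_eq_intros)
    from DERIV_chain2[OF assms this] that show ?thesis by (simp add: mult.commute)
  qed
  have "((\<lambda>t. \<Prod>i<n. g i (x i + t * v i - z i)) has_real_derivative
    (\<Sum>j<n. (v j * g' j (x j + s * v j - z j)) * (\<Prod>i\<in>{..<n}-{j}. g i (x i + s * v i - z i)))) (at s)"
    using d by (rule has_field_derivative_prod)
  also have "(\<Sum>j<n. (v j * g' j (x j + s * v j - z j)) * (\<Prod>i\<in>{..<n}-{j}. g i (x i + s * v i - z i)))
     = (\<Sum>j<n. v j * kern n (g(j := g' j)) (\<lambda>i. x i + s * v i) z)"
  proof (rule sum.cong[OF refl])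
    fix j assume j: "j \<in> {..<n}"
    have "kern n (g(j := g' j)) (\<lambda>i. x i + s * v i) z
       = (g(j := g' j)) j (x j + s * v j - z j) * (\<Prod>i\<in>{..<n}-{j}. (g(j := g' j)) i (x i + s * v i - z i))"
      unfolding kern_def using j by (intro prod.remove) auto
    also have "(\<Prod>i\<in>{..<n}-{j}. (g(j := g' j)) i (x i + s * v i - z i)) =
        (\<Prod>i\<in>{..<n}-{j}. g i (x i + s * v i - z i))"
      by (intro prod.cong) auto
    finally show "(v j * g' j (x j + s * v j - z j)) * (\<Prod>i\<in>{..<n}-{j}. g i (x i + s * v i - z i))
       = v j * kern n (g(j := g' j)) (\<lambda>i. x i + s * v i) z"
      by (simp only: fun_upd_same mult.assoc)
  qed
  finally show ?thesis unfolding kern_def .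
qed

lemma real_MVT_bound:
  fixes f :: "real \<Rightarrow> real"
  assumes "\<And>t. (f has_real_derivative f' t) (at t)" "\<And>t. \<bar>f' t\<bar> \<le> C"
  shows "\<bar>f a - f b\<bar> \<le> C * \<bar>a - b\<bar>"
  using field_differentiable_bound[of UNIV f f' C a b] assms by auto

text \<open>A common bound \<open>B\<close> for profiles and derivatives makes the mixed kernels
  \<open>g(j := g' j)\<close> obey the same estimates as the original one.\<close>

locale C1_family =
  fixes n :: nat and g g' :: "nat \<Rightarrow> real \<Rightarrow> real" and B :: real
  assumes deriv: "\<And>i t. i < n \<Longrightarrow> (g i has_real_derivative g' i t) (at t)"
    and bound: "\<And>i t. i < n \<Longrightarrow> \<bar>g i t\<bar> \<le> B" and bound': "\<And>i t. i < n \<Longrightarrow> \<bar>g' i t\<bar> \<le> B"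
    and meas': "\<And>i. i < n \<Longrightarrow> g' i \<in> borel_measurable borel"
begin

lemma meas: "i < n \<Longrightarrow> g i \<in> borel_measurable borel"
  by (intro borel_measurable_continuous_onI continuous_at_imp_continuous_on ballI)
     (auto intro: DERIV_isCont deriv)

lemma meas_upd: "i < n \<Longrightarrow> j < n \<Longrightarrow> (g(j := g' j)) i \<in> borel_measurable borel"
  using meas meas' by auto

lemma bound_upd: "i < n \<Longrightarrow> j < n \<Longrightarrow> \<bar>(g(j := g' j)) i t\<bar> \<le> B"
  using bound bound' by auto

lemma line_deriv_bound:
  "\<bar>\<Sum>j<n. v j * kern n (g(j := g' j)) y z\<bar> \<le> (\<Sum>j<n. \<bar>v j\<bar>) * B ^ n"
proof -
  have "\<bar>\<Sum>j<n. v j * kern n (g(j := g' j)) y z\<bar> \<le> (\<Sum>j<n. \<bar>v j * kern n (g(j := g' j)) y z\<bar>)"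
    by (rule sum_abs)
  also have "\<dots> \<le> (\<Sum>j<n. \<bar>v j\<bar> * B ^ n)"
    unfolding abs_mult using bound_upd by (intro sum_mono mult_left_mono kern_bound) auto
  finally show ?thesis by (simp add: sum_distrib_right)
qed

text \<open>The kernel is Lipschitz along the line uniformly in \<open>z\<close>, so its difference
  quotients are bounded and a multiple of \<open>|f|\<close> dominates the integrand. Derivatives
  along lines take the place of the total derivative throughout, since touching from below is tested
  line by line.\<close>

lemma conv_line_deriv:
  assumes f: "integrable (prodleb n) f"
  shows "((\<lambda>t. conv n f g (\<lambda>i. x i + t * v i)) has_real_derivative
     (\<Sum>j<n. v j * conv n f (g(j := g' j)) (\<lambda>i. x i + s * v i))) (at s)"
proof -
  define P where "P t = (\<lambda>i. x i + t * v i)" for t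
  define C where "C = (\<Sum>j<n. \<bar>v j\<bar>) * B ^ n"
  define D where "D z = (\<Sum>j<n. v j * kern n (g(j := g' j)) (P s) z)" for z
  have [measurable]: "f \<in> borel_measurable (prodleb n)" using f by auto
  have [measurable]: "kern n g y \<in> borel_measurable (prodleb n)" for y by (intro kern_measurable meas)
  have [measurable]: "kern n (g(j := g' j)) y \<in> borel_measurable (prodleb n)" if "j < n" for y j
    using that by (intro kern_measurable meas_upd)
  have [measurable]: "D \<in> borel_measurable (prodleb n)" unfolding D_def by measurable
  have ic: "integrable (prodleb n) (\<lambda>z. f z * kern n g y z)" for y
    using f meas bound by (rule conv_integrable)
  have ic': "integrable (prodleb n) (\<lambda>z. f z * kern n (g(j := g' j)) y z)" if "j < n" for y j
    using f meas_upd bound_upd that by (intro conv_integrable[where B = B]) auto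
  have lip: "\<bar>kern n g (P t) z - kern n g (P s) z\<bar> \<le> C * \<bar>t - s\<bar>" for t z
    unfolding P_def C_def
    by (rule real_MVT_bound[where f' = "\<lambda>s. \<Sum>j<n. v j * kern n (g(j := g' j)) (\<lambda>i. x i + s * v i) z"])
       (auto intro: kern_line_deriv deriv line_deriv_bound)
  \<comment> \<open>Dominated convergence concerns sequences, so the limit is tested along sequences
    that avoid \<open>s\<close>.\<close>
  have lim: "(\<lambda>k. LINT z|prodleb n. f z * ((kern n g (P (X k)) z - kern n g (P s) z) / (X k - s)))
     \<longlonglongrightarrow> (LINT z|prodleb n. f z * D z)"
    if X: "\<And>k. X k \<noteq> s" "X \<longlonglongrightarrow> s" for X
  proof (rule integral_dominated_convergence[where w = "\<lambda>z. C * \<bar>f z\<bar>"])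
    show "integrable (prodleb n) (\<lambda>z. C * \<bar>f z\<bar>)" using f by auto
    show "AE z in prodleb n. norm (f z * ((kern n g (P (X k)) z - kern n g (P s) z) / (X k - s))) \<le> C *
        \<bar>f z\<bar>" for k
    proof (rule AE_I2)
      fix z
      have "\<bar>kern n g (P (X k)) z - kern n g (P s) z\<bar> / \<bar>X k - s\<bar> \<le> C"
        using lip[of "X k" z] X(1)[of k] by (simp add: divide_le_eq)
      then have "\<bar>f z\<bar> * (\<bar>kern n g (P (X k)) z - kern n g (P s) z\<bar> / \<bar>X k - s\<bar>) \<le> \<bar>f z\<bar> * C"
        by (rule mult_left_mono) simp
      then show "norm (f z * ((kern n g (P (X k)) z - kern n g (P s) z) / (X k - s))) \<le> C * \<bar>f z\<bar>"
        by (simp add: abs_mult abs_divide mult.commute)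
    qed
    show "AE z in prodleb n. (\<lambda>k. f z * ((kern n g (P (X k)) z - kern n g (P s) z) / (X k - s))) \<longlonglongrightarrow> f z *
        D z"
    proof (rule AE_I2)
      fix z
      have "((\<lambda>t. (kern n g (P t) z - kern n g (P s) z) / (t - s)) \<longlongrightarrow> D z) (at s)"
        using kern_line_deriv[OF deriv, where x = x and v = v and z = z and s = s] unfolding
            has_field_derivative_iff P_def D_def by auto
      then have "(\<lambda>k. (kern n g (P (X k)) z - kern n g (P s) z) / (X k - s)) \<longlonglongrightarrow> D z"
        using X unfolding tendsto_at_iff_sequentially by (auto simp: comp_def)
      then show "(\<lambda>k. f z * ((kern n g (P (X k)) z - kern n g (P s) z) / (X k - s))) \<longlonglongrightarrow> f z * D z"
        by (rule tendsto_mult_left)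
    qed
  qed measurable
  have fD: "(LINT z|prodleb n. f z * D z) = (\<Sum>j<n. v j * conv n f (g(j := g' j)) (P s))"
  proof -
    have "(LINT z|prodleb n. f z * D z) = (LINT z|prodleb n.
        (\<Sum>j<n. v j * (f z * kern n (g(j := g' j)) (P s) z)))"
      unfolding D_def sum_distrib_left by (intro Bochner_Integration.integral_cong sum.cong) auto
    also have "\<dots> = (\<Sum>j<n. LINT z|prodleb n. v j * (f z * kern n (g(j := g' j)) (P s) z))"
      using ic' by (intro Bochner_Integration.integral_sum) auto
    finally show ?thesis unfolding conv_def by simp
  qed
  have quot: "(conv n f g (P t) - conv n f g (P s)) / (t - s)
      = (LINT z|prodleb n. f z * ((kern n g (P t) z - kern n g (P s) z) / (t - s)))" for t
  proof -
    have "(LINT z|prodleb n. f z * ((kern n g (P t) z - kern n g (P s) z) / (t - s)))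
       = (LINT z|prodleb n. (f z * kern n g (P t) z - f z * kern n g (P s) z) / (t - s))"
      by (intro Bochner_Integration.integral_cong) (auto simp: algebra_simps)
    also have "\<dots> = (conv n f g (P t) - conv n f g (P s)) / (t - s)"
      using ic by (simp add: conv_def)
    finally show ?thesis ..
  qed
  show ?thesis
    unfolding has_field_derivative_iff P_def[symmetric] tendsto_at_iff_sequentially comp_def quot
    using lim unfolding fD by auto
qed

lemma conv_bound:
  assumes f: "integrable (prodleb n) f"
    and h: "\<And>i. i < n \<Longrightarrow> h i \<in> borel_measurable borel" "\<And>i t. i < n \<Longrightarrow> \<bar>h i t\<bar> \<le> B"
  shows "\<bar>conv n f h y\<bar> \<le> B ^ n * (LINT z|prodleb n. \<bar>f z\<bar>)"
proof -
  have i: "integrable (prodleb n) (\<lambda>z. f z * kern n h y z)" using f h by (rule conv_integrable)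
  have "\<bar>conv n f h y\<bar> \<le> (LINT z|prodleb n. \<bar>f z * kern n h y z\<bar>)"
    unfolding conv_def by (rule integral_abs_bound)
  also have "\<dots> \<le> (LINT z|prodleb n. B ^ n * \<bar>f z\<bar>)"
  proof (rule integral_mono)
    show "\<bar>f z * kern n h y z\<bar> \<le> B ^ n * \<bar>f z\<bar>" for z
      using mult_left_mono[OF kern_bound[of n h B y z], of "\<bar>f z\<bar>"] h
      by (simp add: abs_mult mult.commute)
  qed (use i f in auto)
  finally show ?thesis by simp
qed

text \<open>Source of the global Lipschitz constants of the mollified function, gradient and
  Hessian. They blow up with the kernel, and only their finiteness will matter.\<close>

lemma conv_lipschitz:
  assumes f: "integrable (prodleb n) f"
  shows "\<bar>conv n f g x - conv n f g y\<bar> \<le> B ^ n * (LINT z|prodleb n. \<bar>f z\<bar>) * (\<Sum>j<n. \<bar>x j - y j\<bar>)"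
proof -
  define C where "C = B ^ n * (LINT z|prodleb n. \<bar>f z\<bar>)"
  define v where "v i = x i - y i" for i
  have "\<bar>conv n f g (\<lambda>i. y i + 1 * v i) - conv n f g (\<lambda>i. y i + 0 * v i)\<bar> \<le> (C * (\<Sum>j<n. \<bar>v j\<bar>)) * \<bar>1 - 0\<bar>"
  proof (rule real_MVT_bound)
    fix s
    show "((\<lambda>t. conv n f g (\<lambda>i. y i + t * v i)) has_real_derivative
      (\<Sum>j<n. v j * conv n f (g(j := g' j)) (\<lambda>i. y i + s * v i))) (at s)"
      using f by (rule conv_line_deriv)
    have "\<bar>\<Sum>j<n. v j * conv n f (g(j := g' j)) (\<lambda>i. y i + s * v i)\<bar>
       \<le> (\<Sum>j<n. \<bar>v j * conv n f (g(j := g' j)) (\<lambda>i. y i + s * v i)\<bar>)" by (rule sum_abs)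
    also have "\<dots> \<le> (\<Sum>j<n. \<bar>v j\<bar> * C)"
      unfolding abs_mult C_def using meas_upd bound_upd f
      by (intro sum_mono mult_left_mono conv_bound) auto
    finally show "\<bar>\<Sum>j<n. v j * conv n f (g(j := g' j)) (\<lambda>i. y i + s * v i)\<bar> \<le> C * (\<Sum>j<n. \<bar>v j\<bar>)"
      by (simp add: sum_distrib_left mult.commute)
  qed
  then show ?thesis by (simp add: v_def C_def)
qed

end

section \<open>Smooth kernels and weak derivatives\<close>

text \<open>A coinductive form of infinite differentiability: exhibiting a family closed under
  differentiation avoids formulas for higher derivatives.\<close>

definition smooth_real :: "(real \<Rightarrow> real) \<Rightarrow> bool" where
  "smooth_real f \<longleftrightarrow> (\<exists>S. f \<in> S \<and> (\<forall>g\<in>S. \<exists>g'\<in>S. \<forall>x. (g has_real_derivative g' x) (at x)))"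

lemma smooth_real_deriv:
  assumes "smooth_real f"
  shows "smooth_real (deriv f)" "(f has_real_derivative deriv f x) (at x)"
proof -
  obtain S g where S: "f \<in> S" "\<forall>g\<in>S. \<exists>g'\<in>S. \<forall>x. (g has_real_derivative g' x) (at x)" "g \<in> S"
    "\<And>x. (f has_real_derivative g x) (at x)"
    using assms unfolding smooth_real_def by blast
  then have "deriv f = g" by (intro ext DERIV_imp_deriv)
  with S show "smooth_real (deriv f)" "(f has_real_derivative deriv f x) (at x)" unfolding
      smooth_real_def by auto
qed

lemma smooth_real_coinduct:
  assumes "f \<in> S" "\<And>g. g \<in> S \<Longrightarrow> \<exists>g'\<in>S. \<forall>x. (g has_real_derivative g' x) (at x)"
  shows "smooth_real f"
  using assms unfolding smooth_real_def by blast

text \<open>The linear span. By linearity, closure under differentiation has to be checked on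
  generators only, which is what the Leibniz rule and the chain rule provide.\<close>

inductive_set fspan :: "(real \<Rightarrow> real) set \<Rightarrow> (real \<Rightarrow> real) set" for G where
  base: "g \<in> G \<Longrightarrow> g \<in> fspan G"
| add: "f \<in> fspan G \<Longrightarrow> g \<in> fspan G \<Longrightarrow> (\<lambda>x. f x + g x) \<in> fspan G"
| scale: "f \<in> fspan G \<Longrightarrow> (\<lambda>x. c * f x) \<in> fspan G"

lemma smooth_real_fspan:
  assumes G: "\<And>g. g \<in> G \<Longrightarrow> \<exists>g'\<in>fspan G. \<forall>x. (g has_real_derivative g' x) (at x)"
    and f: "f \<in> fspan G"
  shows "smooth_real f"
proof (rule smooth_real_coinduct[OF f])
  fix g assume "g \<in> fspan G"
  then show "\<exists>g'\<in>fspan G. \<forall>x. (g has_real_derivative g' x) (at x)"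
  proof induction
    case (add f g)
    then obtain f' g' where "f' \<in> fspan G" "g' \<in> fspan G"
      "\<And>x. (f has_real_derivative f' x) (at x)" "\<And>x. (g has_real_derivative g' x) (at x)" by blast
    then show ?case by (intro bexI[of _ "\<lambda>x. f' x + g' x"]) (auto intro: fspan.intros DERIV_add)
  next
    case (scale f c)
    then obtain f' where "f' \<in> fspan G" "\<And>x. (f has_real_derivative f' x) (at x)" by blast
    then show ?case by (intro bexI[of _ "\<lambda>x. c * f' x"]) (auto intro: fspan.intros DERIV_cmult)
  qed (rule G)
qed

lemma smooth_real_scale: "smooth_real f \<Longrightarrow> smooth_real (\<lambda>x. c * f x)"
proof (rule smooth_real_fspan[of "Collect smooth_real"])
  fix g assume "g \<in> Collect smooth_real"
  then show "\<exists>g'\<in>fspan (Collect smooth_real). \<forall>x. (g has_real_derivative g' x) (at x)"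
    using smooth_real_deriv by (intro bexI[of _ "deriv g"]) (auto intro: fspan.base)
qed (auto intro: fspan.intros)

lemma smooth_real_mult:
  assumes "smooth_real f" "smooth_real g"
  shows "smooth_real (\<lambda>x. f x * g x)"
proof (rule smooth_real_fspan[of "{\<lambda>x. f x * g x | f g. smooth_real f \<and> smooth_real g}"])
  let ?G = "{\<lambda>x. f x * g x | f g. smooth_real f \<and> smooth_real g}"
  fix h assume "h \<in> ?G"
  then obtain f g where h: "h = (\<lambda>x. f x * g x)" "smooth_real f" "smooth_real g" by blast
  have "(\<lambda>x. deriv f x * g x) \<in> ?G" "(\<lambda>x. f x * deriv g x) \<in> ?G"
    using h smooth_real_deriv(1) by blast+
  then have "(\<lambda>x. deriv f x * g x + f x * deriv g x) \<in> fspan ?G"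
    by (intro fspan.add[of "\<lambda>x. deriv f x * g x"] fspan.base)
  moreover have "(h has_real_derivative deriv f x * g x + f x * deriv g x) (at x)" for x
    unfolding h(1) using DERIV_mult[OF smooth_real_deriv(2)[OF h(2)] smooth_real_deriv(2)[OF h(3)]] by
        (simp add: ac_simps)
  ultimately show "\<exists>g'\<in>fspan ?G. \<forall>x. (h has_real_derivative g' x) (at x)"
    by (intro bexI[of _ "\<lambda>x. deriv f x * g x + f x * deriv g x"]) auto
next
  show "(\<lambda>x. f x * g x) \<in> fspan {\<lambda>x. f x * g x | f g. smooth_real f \<and> smooth_real g}"
    using assms by (intro fspan.base) blast
qed

lemma smooth_real_affine:
  assumes "smooth_real f"
  shows "smooth_real (\<lambda>x. f (c + d * x))"
proof (rule smooth_real_fspan[of "{\<lambda>x. f (c + d * x) | f. smooth_real f}"])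
  let ?G = "{\<lambda>x. f (c + d * x) | f. smooth_real f}"
  fix h assume "h \<in> ?G"
  then obtain f where h: "h = (\<lambda>x. f (c + d * x))" "smooth_real f" by blast
  have "(\<lambda>x. deriv f (c + d * x)) \<in> ?G" using h smooth_real_deriv(1) by blast
  then have "(\<lambda>x. d * deriv f (c + d * x)) \<in> fspan ?G"
    by (intro fspan.scale[of "\<lambda>x. deriv f (c + d * x)"] fspan.base)
  moreover have "(h has_real_derivative d * deriv f (c + d * x)) (at x)" for x
  proof -
    have "((\<lambda>x. c + d * x) has_real_derivative d) (at x)" by (auto intro!: derivative_eq_intros)
    from DERIV_chain2[OF smooth_real_deriv(2)[OF h(2)] this] show ?thesis unfolding h(1) by
        (simp add: mult.commute)
  qed
  ultimately show "\<exists>g'\<in>fspan ?G. \<forall>x. (h has_real_derivative g' x) (at x)"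
    by (intro bexI[of _ "\<lambda>x. d * deriv f (c + d * x)"]) auto
next
  show "(\<lambda>x. f (c + d * x)) \<in> fspan {\<lambda>x. f (c + d * x) | f. smooth_real f}"
    using assms by (intro fspan.base) blast
qed

section \<open>A smooth bump on the line\<close>

lemma DERIV_transform_nhds:
  assumes "(f has_real_derivative D) (at x)" "eventually (\<lambda>y. f y = g y) (nhds x)"
  shows "(g has_real_derivative D) (at x)"
  using assms(1) DERIV_cong_ev[OF refl assms(2) refl] by simp

text \<open>Differentiating \<open>exp (-1/x)\<close> produces powers of \<open>1/x\<close>; with
  these included, the span of the whole family is closed under differentiation.\<close>

definition flat :: "nat \<Rightarrow> real \<Rightarrow> real" where
  "flat k x = (if x > 0 then (1 / x) ^ k * exp (- (1 / x)) else 0)"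

lemma flat_tendsto_0: "((\<lambda>x. flat k x) \<longlongrightarrow> 0) (at_right 0)"
proof -
  have "((\<lambda>x. (inverse x) ^ k / exp (inverse x)) \<longlongrightarrow> (0::real)) (at_right 0)"
    by (rule filterlim_compose[OF tendsto_power_div_exp_0 filterlim_inverse_at_top_right])
  moreover have "eventually (\<lambda>x. (inverse x) ^ k / exp (inverse x) = flat k x) (at_right 0)"
    by (auto simp: eventually_at_right_field flat_def exp_minus inverse_eq_divide intro!: exI[of _ 1])
  ultimately show ?thesis by (rule Lim_transform_eventually)
qed

text \<open>The delicate point is \<open>0\<close>: there the right difference quotient of
  \<open>flat k\<close> is \<open>flat (Suc k)\<close>, which tends to \<open>0\<close> because the
  exponential beats every power.\<close>

lemma flat_deriv:
  "(flat k has_real_derivative (- real k) * flat (Suc k) x + flat (Suc (Suc k)) x) (at x)"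
proof -
  consider "x > 0" | "x < 0" | "x = 0" by linarith
  then show ?thesis
  proof cases
    case 1
    have "((\<lambda>x. (1 / x) ^ k * exp (- (1 / x))) has_real_derivative
       (real k * ((1 / x) ^ (k - 1)) * (- 1 / x\<^sup>2)) * exp (- (1 / x)) + (1 / x) ^ k *
           (exp (- (1 / x)) * (1 / x\<^sup>2))) (at x)"
      (is "(?f has_real_derivative ?D) _")
      using 1 by (auto intro!: derivative_eq_intros simp: power2_eq_square)
    moreover have "(real k * ((1 / x) ^ (k - 1)) * (- 1 / x\<^sup>2)) * exp (- (1 / x)) + (1 / x) ^ k *
        (exp (- (1 / x)) * (1 / x\<^sup>2))
       = (- real k) * flat (Suc k) x + flat (Suc (Suc k)) x"
      using 1 by (cases k) (auto simp: flat_def power2_eq_square field_simps)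
    moreover have "eventually (\<lambda>y. ?f y = flat k y) (nhds x)"
      using eventually_nhds_in_open[of "{0<..}" x] 1 by (auto elim!: eventually_mono simp: flat_def)
    ultimately show ?thesis using DERIV_transform_nhds[of ?f ?D x "flat k"] by simp
  next
    case 2
    have "((\<lambda>x. 0::real) has_real_derivative 0) (at x)" by simp
    moreover have "eventually (\<lambda>y. 0 = flat k y) (nhds x)"
      using eventually_nhds_in_open[of "{..<0}" x] 2 by (auto elim!: eventually_mono simp: flat_def)
    ultimately have "(flat k has_real_derivative 0) (at x)" by (rule DERIV_transform_nhds)
    then show ?thesis using 2 by (simp add: flat_def)
  next
    case 3
    have "((\<lambda>h. flat k h / h) \<longlongrightarrow> 0) (at_right 0)"
    proof (rule Lim_transform_eventually[OF flat_tendsto_0[of "Suc k"]])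
      show "eventually (\<lambda>h. flat (Suc k) h = flat k h / h) (at_right 0)"
        by (auto simp: eventually_at_right_field flat_def intro!: exI[of _ 1])
    qed
    moreover have "((\<lambda>h. flat k h / h) \<longlongrightarrow> 0) (at_left 0)"
    proof (rule Lim_transform_eventually[of "\<lambda>_. 0"])
      show "eventually (\<lambda>h. 0 = flat k h / h) (at_left 0)"
        by (auto simp: eventually_at_left_field flat_def intro!: exI[of _ "-1"])
    qed simp
    ultimately have "((\<lambda>h. flat k h / h) \<longlongrightarrow> 0) (at 0)"
      by (simp add: filterlim_at_split)
    then have "(flat k has_real_derivative 0) (at 0)"
      unfolding DERIV_def by (simp add: flat_def)
    then show ?thesis using 3 by (simp add: flat_def)
  qed
qed

lemma smooth_real_flat: "smooth_real (flat k)"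
proof (rule smooth_real_fspan[of "range flat"])
  fix g assume "g \<in> range flat"
  then obtain k where g: "g = flat k" by blast
  have "(\<lambda>x. (- real k) * flat (Suc k) x + flat (Suc (Suc k)) x) \<in> fspan (range flat)"
    by (intro fspan.add[of "\<lambda>x. (- real k) * flat (Suc k) x" _ "flat (Suc (Suc k))"]
        fspan.scale[of "flat (Suc k)"] fspan.base) auto
  then show "\<exists>g'\<in>fspan (range flat). \<forall>x. (g has_real_derivative g' x) (at x)"
    unfolding g by (rule bexI[rotated]) (intro allI flat_deriv)
qed (auto intro: fspan.base)

lemma smooth_real_continuous: "smooth_real f \<Longrightarrow> continuous_on A f"
  by (intro continuous_at_imp_continuous_on ballI DERIV_isCont[OF smooth_real_deriv(2)])

lemma smooth_real_measurable: "smooth_real f \<Longrightarrow> f \<in> borel_measurable borel"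
  by (intro borel_measurable_continuous_onI smooth_real_continuous)

lemma smooth_real_zero_outside_deriv:
  assumes "smooth_real f" "\<And>t. e < \<bar>t\<bar> \<Longrightarrow> f t = 0" "e < \<bar>t\<bar>"
  shows "deriv f t = 0"
proof -
  have "open {t::real. e < \<bar>t\<bar>}" by (intro open_Collect_less continuous_intros)
  then have "eventually (\<lambda>y. y \<in> {t. e < \<bar>t\<bar>}) (nhds t)" using assms(3) by
      (intro eventually_nhds_in_open) auto
  then have "eventually (\<lambda>y. 0 = f y) (nhds t)" by eventually_elim (simp add: assms(2))
  from DERIV_transform_nhds[OF DERIV_const this] have "(f has_real_derivative 0) (at t)" .
  then show ?thesis by (rule DERIV_imp_deriv)
qed

lemma smooth_real_bounded:
  assumes "smooth_real f" "\<And>t. e < \<bar>t\<bar> \<Longrightarrow> f t = 0"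
  shows "\<exists>B. \<forall>t. \<bar>f t\<bar> \<le> B"
proof -
  have "compact (f ` {-\<bar>e\<bar>..\<bar>e\<bar>})" using assms(1) by (intro compact_continuous_image
      smooth_real_continuous) auto
  then obtain B where "\<forall>y\<in>f ` {-\<bar>e\<bar>..\<bar>e\<bar>}. norm y \<le> B" by (meson bounded_iff compact_imp_bounded)
  then have "\<bar>f t\<bar> \<le> max B 0" for t
  proof (cases "e < \<bar>t\<bar>")
    case False
    then have "t \<in> {-\<bar>e\<bar>..\<bar>e\<bar>}" by auto
    then have "norm (f t) \<le> B" using \<open>\<forall>y\<in>_. _\<close> by blast
    then show ?thesis by simp
  qed (simp add: assms(2))
  then show ?thesis by blast
qed

lemma ex_smooth_bump:
  assumes "\<epsilon> > 0"
  shows "\<exists>\<psi>. smooth_real \<psi> \<and> bump_kernel \<psi> \<epsilon>"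
proof -
  \<comment> \<open>Each factor vanishes beyond one end of the interval from
    \<open>-\<epsilon>\<close> to \<epsilon>, and both are positive inside.\<close>
  define \<beta> where "\<beta> t = flat 0 (1 + (1/\<epsilon>) * t) * flat 0 (1 + (- 1/\<epsilon>) * t)" for t
  have smooth_real\<beta>: "smooth_real \<beta>" unfolding \<beta>_def by (intro smooth_real_mult smooth_real_affine
      smooth_real_flat)
  have nn: "0 \<le> \<beta> t" for t by (simp add: \<beta>_def flat_def)
  have z: "\<beta> t = 0" if "\<epsilon> < \<bar>t\<bar>" for t
    using that assms by (auto simp: \<beta>_def flat_def field_simps abs_if split: if_splits)
  have pos: "\<beta> t > 0" if "\<bar>t\<bar> < \<epsilon>" for t
    using that assms by (auto simp: \<beta>_def flat_def field_simps abs_less_iff)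
  obtain B where B: "\<And>t. \<bar>\<beta> t\<bar> \<le> B" using smooth_real_bounded[OF smooth_real\<beta> z] by blast
  have [measurable]: "\<beta> \<in> borel_measurable borel" using smooth_real\<beta> by (rule smooth_real_measurable)
  have int: "integrable lborel \<beta>"
  proof (rule Bochner_Integration.integrable_bound[of lborel "\<lambda>t. B * indicator {-\<epsilon>..\<epsilon>} t"])
    show "integrable lborel (\<lambda>t. B * indicator {-\<epsilon>..\<epsilon>} t)"
      using assms by (intro integrable_mult_right integrable_real_indicator) auto
    show "AE t in lborel. norm (\<beta> t) \<le> norm (B * indicator {-\<epsilon>..\<epsilon>} t)"
    proof (rule AE_I2)
      fix t
      show "norm (\<beta> t) \<le> norm (B * indicator {-\<epsilon>..\<epsilon>} t)"
        using B[of t] z[of t] by (cases "\<epsilon> < \<bar>t\<bar>") (auto simp: indicator_def abs_le_iff not_less)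
    qed
  qed simp
  have "integral\<^sup>L lborel \<beta> \<noteq> 0"
  proof
    assume "integral\<^sup>L lborel \<beta> = 0"
    then have "AE t in lborel. \<beta> t = 0" using integral_nonneg_eq_0_iff_AE[OF int] nn by auto
    then have "AE t in lborel. t \<notin> {-\<epsilon><..<\<epsilon>}" 
    proof eventually_elim
      case (elim t)
      then show ?case using pos[of t] by (auto simp: abs_less_iff)
    qed
    then have "emeasure lborel {-\<epsilon><..<\<epsilon>} = 0"
    proof -
      have "{t\<in>space lborel. \<not> t \<notin> {-\<epsilon><..<\<epsilon>}} = {-\<epsilon><..<\<epsilon>}" by auto
      from AE_iff_measurable[OF _ this] \<open>AE t in lborel. t \<notin> _\<close> show ?thesis
        by (simp del: greaterThanLessThan_iff)
    qed
    then show False using assms by simp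
  qed
  then have I: "integral\<^sup>L lborel \<beta> > 0" using Bochner_Integration.integral_nonneg[of lborel \<beta>] nn by
      (simp add: less_le)
  define \<psi> where "\<psi> t = (1 / integral\<^sup>L lborel \<beta>) * \<beta> t" for t
  have "smooth_real \<psi>" unfolding \<psi>_def by (intro smooth_real_scale smooth_real\<beta>)
  moreover have "bump_kernel \<psi> \<epsilon>"
    unfolding bump_kernel_def
  proof (intro conjI allI impI)
    show "\<psi> \<in> borel_measurable borel" unfolding \<psi>_def by measurable
    show "\<exists>B. \<forall>t. \<psi> t \<le> B"
      using B I by (intro exI[of _ "(1 / integral\<^sup>L lborel \<beta>) * B"] allI)
          (auto simp: \<psi>_def field_simps abs_le_iff)
    show "integral\<^sup>L lborel \<psi> = 1" unfolding \<psi>_def using I int by simp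
  qed (use nn I z in \<open>auto simp: \<psi>_def\<close>)
  ultimately show ?thesis by blast
qed

section \<open>Product kernels as test functions for weak derivatives\<close>

lemma pderiv_at_prod:
  assumes "i < n" "\<And>k. k < n \<Longrightarrow> smooth_real (h k)"
  shows "((\<lambda>t. \<Prod>k<n. h k ((x(i := t)) k)) has_real_derivative (\<Prod>k<n. (h(i := deriv (h i))) k (x k)))
      (at (x i))"
    and "pderiv_at i (\<lambda>z. \<Prod>k<n. h k (z k)) = (\<lambda>z. \<Prod>k<n. (h(i := deriv (h i))) k (z k))"
proof -
  have d: "((\<lambda>t. \<Prod>k<n. h k ((x(i := t)) k)) has_real_derivative (\<Prod>k<n. (h(i := deriv (h i))) k (x k)))
      (at (x i))" for x
  proof -
    have *: "(\<Prod>k<n. u k) = u i * (\<Prod>k\<in>{..<n}-{i}. u k)" for u :: "nat \<Rightarrow> real"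
      using assms(1) by (intro prod.remove) auto
    have "((\<lambda>t. h i t * (\<Prod>k\<in>{..<n}-{i}. h k (x k))) has_real_derivative deriv (h i) (x i) *
        (\<Prod>k\<in>{..<n}-{i}. h k (x k))) (at (x i))"
      using smooth_real_deriv(2)[OF assms(2)[OF assms(1)]] by (rule DERIV_cmult_right)
    moreover have "(\<Prod>k\<in>{..<n}-{i}. (h(i := deriv (h i))) k (x k)) = (\<Prod>k\<in>{..<n}-{i}. h k (x k))"
      by (intro prod.cong) auto
    moreover have "(\<Prod>k\<in>{..<n}-{i}. h k ((x(i := t)) k)) = (\<Prod>k\<in>{..<n}-{i}. h k (x k))" for t
      by (intro prod.cong) auto
    ultimately show ?thesis by (simp add: *)
  qed
  show "((\<lambda>t. \<Prod>k<n. h k ((x(i := t)) k)) has_real_derivative (\<Prod>k<n. (h(i := deriv (h i))) k (x k)))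
      (at (x i))"
    by (rule d)
  show "pderiv_at i (\<lambda>z. \<Prod>k<n. h k (z k)) = (\<lambda>z. \<Prod>k<n. (h(i := deriv (h i))) k (z k))"
    unfolding pderiv_at_def using DERIV_imp_deriv[OF d] by blast
qed

text \<open>Products of smooth one-variable functions form a class that no partial derivative
  leaves, so induction over the list of derivatives stays inside it.\<close>

lemma smooth_prod:
  assumes "\<And>k. k < n \<Longrightarrow> smooth_real (h k)"
  shows "smooth n (\<lambda>z. \<Prod>k<n. h k (z k))"
  unfolding smooth_def
proof (intro allI impI)
  fix js :: "nat list" assume js: "set js \<subseteq> {..<n}"
  have "\<exists>h'. (\<forall>k<n. smooth_real (h' k)) \<and> foldr pderiv_at js (\<lambda>z. \<Prod>k<n. h k (z k)) = (\<lambda>z. \<Prod>k<n. h' k (z k))"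
    using js
  proof (induction js)
    case Nil
    then show ?case using assms by auto
  next
    case (Cons j js)
    then obtain h' where h': "\<forall>k<n. smooth_real (h' k)" "foldr pderiv_at js (\<lambda>z. \<Prod>k<n. h k (z k)) =
        (\<lambda>z. \<Prod>k<n. h' k (z k))"
      by auto
    then have "foldr pderiv_at (j # js) (\<lambda>z. \<Prod>k<n. h k (z k)) = (\<lambda>z. \<Prod>k<n. (h'(j := deriv (h' j))) k (z k))"
      using pderiv_at_prod(2)[of j n h'] Cons.prems by simp
    moreover have "\<forall>k<n. smooth_real ((h'(j := deriv (h' j))) k)"
      using h' Cons.prems smooth_real_deriv(1) by auto
    ultimately show ?case by blast
  qed
  then obtain h' where h': "\<And>k. k < n \<Longrightarrow> smooth_real (h' k)" and e: "foldr pderiv_at js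
      (\<lambda>z. \<Prod>k<n. h k (z k)) = (\<lambda>z. \<Prod>k<n. h' k (z k))"
    by blast
  show "continuous_on (Rn n) (foldr pderiv_at js (\<lambda>z. \<Prod>k<n. h k (z k))) \<and>
       (\<forall>i<n. \<forall>x\<in>Rn n. (\<lambda>t. foldr pderiv_at js (\<lambda>z. \<Prod>k<n. h k (z k)) (x(i := t))) differentiable at (x i))"
    unfolding e
  proof (intro conjI allI impI ballI)
    show "continuous_on (Rn n) (\<lambda>z. \<Prod>k<n. h' k (z k))"
    proof (intro continuous_on_prod)
      fix k assume "k \<in> {..<n}"
      then show "continuous_on (Rn n) (\<lambda>z. h' k (z k))"
        using h' by (intro continuous_on_compose2[OF smooth_real_continuous[of "h' k" UNIV]]
             continuous_on_subset[OF continuous_on_product_coordinates]) auto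
    qed
    show "(\<lambda>t. \<Prod>k<n. h' k ((x(i := t)) k)) differentiable at (x i)" if "i < n" for i x
      using pderiv_at_prod(1)[OF that, of h' x] h' unfolding real_differentiable_def by blast
  qed
qed

text \<open>Extensional functions are frozen at \<open>undefined\<close> beyond \<open>n\<close>, so
  the box is a full product of compact factors and Tychonoff applies.\<close>

lemma compact_PiE_Icc: "compact (\<Pi>\<^sub>E i\<in>{..<n}. {a i..b i :: real})"
proof -
  have "(\<Pi>\<^sub>E i\<in>{..<n}. {a i..b i}) = PiE UNIV (\<lambda>i. if i < n then {a i..b i} else {undefined})"
    by (auto simp: PiE_iff extensional_def split: if_splits)
  moreover have "compactin (product_topology (\<lambda>_. euclidean) UNIV)
      (PiE UNIV (\<lambda>i. if i < n then {a i..b i} else {undefined :: real}))"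
    unfolding compactin_PiE by auto
  ultimately show ?thesis by (simp add: euclidean_product_topology)
qed

text \<open>As a function of \<open>z\<close>, the kernel is a test function once the box around
  \<open>x\<close> lies in \<open>U\<close>. Differentiating in \<open>z\<close> instead of
  \<open>x\<close> changes the sign, which cancels the sign in the definition of the weak
  derivative. The profiles are general so that an already differentiated kernel is covered as well.
  \<open>f0\<close> and \<open>D0\<close> are Borel versions extended by zero.\<close>

lemma weak_pderiv_conv:
  assumes w: "weak_pderiv n U i f Df" and i: "i < n"
    and [measurable]: "f0 \<in> borel_measurable (prodleb n)" "D0 \<in> borel_measurable (prodleb n)"
    and f0: "AE z in prodleb n. f0 z = indicator U z * f z" and D0: "AE z in prodleb n. D0 z = indicator
        U z * Df z"
    and fm: "set_borel_measurable (leb n) U f" and Dm: "set_borel_measurable (leb n) U Df"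
    and g: "\<And>k. k < n \<Longrightarrow> smooth_real (g k)" and supp: "\<And>k t. k < n \<Longrightarrow> \<epsilon> < \<bar>t\<bar> \<Longrightarrow> g k t = 0"
    and x: "(\<Pi>\<^sub>E k\<in>{..<n}. {x k - \<epsilon>..x k + \<epsilon>}) \<subseteq> U"
  shows "conv n f0 (g(i := deriv (g i))) x = conv n D0 g x"
proof -
  define h where "h k t = g k (x k + (- 1) * t)" for k t
  have smh: "smooth_real (h k)" if "k < n" for k unfolding h_def[abs_def] using g[OF that] by
      (rule smooth_real_affine)
  have kh: "(\<lambda>z. \<Prod>k<n. h k (z k)) = kern n g x" by (auto simp: kern_def h_def)
  have dh: "deriv (h i) t = - deriv (g i) (x i - t)" for t
    unfolding h_def
  proof (rule DERIV_imp_deriv)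
    have "((\<lambda>t. x i + (- 1) * t) has_real_derivative - 1) (at t)" by (auto intro!: derivative_eq_intros)
    from DERIV_chain2[OF smooth_real_deriv(2)[OF g[OF i]] this]
    show "((\<lambda>t. g i (x i + - 1 * t)) has_real_derivative - deriv (g i) (x i - t)) (at t)" by simp
  qed
  have "pderiv_at i (kern n g x) z = - kern n (g(i := deriv (g i))) x z" for z
  proof -
    have "pderiv_at i (kern n g x) z = (\<Prod>k<n. (h(i := deriv (h i))) k (z k))"
      unfolding kh[symmetric] by (simp only: pderiv_at_prod(2)[OF i smh])
    also have "\<dots> = deriv (h i) (z i) * (\<Prod>k\<in>{..<n}-{i}. h k (z k))"
      using i by (subst prod.remove[of _ i]) (auto intro!: prod.cong)
    also have "(\<Prod>k\<in>{..<n}-{i}. h k (z k)) = (\<Prod>k\<in>{..<n}-{i}. (g(i := deriv (g i))) k (x k - z k))"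
      by (intro prod.cong) (auto simp: h_def)
    also have "deriv (h i) (z i) * \<dots> = - kern n (g(i := deriv (g i))) x z"
      unfolding kern_def dh using i by (subst prod.remove[of "{..<n}" i]) auto
    finally show ?thesis .
  qed
  note pd = this
  have "test_function n U (kern n g x)"
    unfolding test_function_def
  proof (intro conjI exI[of _ "\<Pi>\<^sub>E k\<in>{..<n}. {x k - \<epsilon>..x k + \<epsilon>}"] ballI)
    show "smooth n (kern n g x)" unfolding kh[symmetric] using smh by (rule smooth_prod)
    fix z assume z: "z \<in> Rn n - (\<Pi>\<^sub>E k\<in>{..<n}. {x k - \<epsilon>..x k + \<epsilon>})"
    then obtain k where "k < n" "z k \<notin> {x k - \<epsilon>..x k + \<epsilon>}" by (auto simp: Rn_def PiE_iff)
    then have "\<epsilon> < \<bar>x k - z k\<bar>" by auto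
    then show "kern n g x z = 0" using \<open>k < n\<close> supp unfolding kern_def by auto
  qed (use x in \<open>auto intro: compact_PiE_Icc\<close>)
  then have W: "(LINT z:U|leb n. f z * pderiv_at i (kern n g x) z) = -
      (LINT z:U|leb n. Df z * kern n g x z)"
    using w unfolding weak_pderiv_def by blast
  \<comment> \<open>Transfer from the completed measure on \<open>U\<close> to Borel versions on the
    whole space.\<close>
  have conv_eq: "(LINT z:U|leb n. F z * q z) = (LINT z|prodleb n. F0 z * q z)"
    if [measurable]: "F0 \<in> borel_measurable (prodleb n)" and F: "AE z in prodleb n. F0 z = indicator U z
        * F z"
      and Fm: "set_borel_measurable (leb n) U F" and [measurable]: "q \<in> borel_measurable (prodleb n)"
    for F F0 q :: "rvec \<Rightarrow> real"
  proof -
    have q': "q \<in> borel_measurable (leb n)" unfolding leb_def by (rule measurable_completion) simp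
    have F0': "F0 \<in> borel_measurable (leb n)" unfolding leb_def by (rule measurable_completion) simp
    have "(LINT z:U|leb n. F z * q z) = (LINT z|leb n. F0 z * q z)"
      unfolding set_lebesgue_integral_def
    proof (rule integral_cong_AE)
      have "(\<lambda>z. (indicator U z *\<^sub>R F z) * q z) \<in> borel_measurable (leb n)"
        using Fm q' unfolding set_borel_measurable_def by (rule borel_measurable_times)
      then show "(\<lambda>z. indicator U z *\<^sub>R (F z * q z)) \<in> borel_measurable (leb n)" by (simp add: mult.assoc)
      show "(\<lambda>z. F0 z * q z) \<in> borel_measurable (leb n)" using F0' q' by (rule borel_measurable_times)
      show "AE z in leb n. indicator U z *\<^sub>R (F z * q z) = F0 z * q z"
        unfolding leb_def AE_completion_iff using F by eventually_elim simp
    qed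
    also have "\<dots> = (LINT z|prodleb n. F0 z * q z)"
      unfolding leb_def by (rule integral_completion) measurable
    finally show ?thesis .
  qed
  have km: "kern n g x \<in> borel_measurable (prodleb n)" using g smooth_real_measurable by
      (intro kern_measurable) auto
  have km': "kern n (g(i := deriv (g i))) x \<in> borel_measurable (prodleb n)"
    using g i smooth_real_measurable smooth_real_deriv(1) by (intro kern_measurable) auto
  have "(LINT z:U|leb n. f z * pderiv_at i (kern n g x) z) =
      (LINT z|prodleb n. f0 z * (- kern n (g(i := deriv (g i))) x z))"
    unfolding pd using f0 fm km' by (intro conv_eq) auto
  moreover have "(LINT z:U|leb n. Df z * kern n g x z) = (LINT z|prodleb n. D0 z * kern n g x z)"
    using D0 Dm km by (intro conv_eq) auto
  ultimately show ?thesis using W unfolding conv_def by simp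
qed

section \<open>Approximation of Sobolev functions\<close>

lemma enorm_nonneg [simp]: "0 \<le> enorm n x"
  by (simp add: enorm_def)

lemma enorm_sq: "(enorm n x)\<^sup>2 = (\<Sum>i<n. (x i)\<^sup>2)"
  by (simp add: enorm_def L2_set_def sum_nonneg)

lemma component_le_enorm: "i < n \<Longrightarrow> \<bar>x i\<bar> \<le> enorm n x"
  using member_le_L2_set[of "{..<n}" i "\<lambda>i. \<bar>x i\<bar>"] by (simp add: enorm_def L2_set_def)

lemma enorm_le_sum: "enorm n x \<le> (\<Sum>i<n. \<bar>x i\<bar>)"
  unfolding enorm_def by (rule L2_set_le_sum_abs)

lemma enorm_measurable: "enorm n \<in> borel_measurable (prodleb n)"
  unfolding enorm_def[abs_def] L2_set_def by measurable

lemma nball_sets [measurable, simp]: "nball n R \<in> sets (prodleb n)"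
proof -
  have "{x\<in>space (prodleb n). enorm n x < R} \<in> sets (prodleb n)"
    using enorm_measurable by measurable
  then show ?thesis by (simp add: nball_def space_prodleb)
qed

lemma nball_subset_nbox: "nball n R \<subseteq> nbox n R"
proof
  fix x assume "x \<in> nball n R"
  then have "x \<in> Rn n" "enorm n x < R" by (auto simp: nball_def)
  then show "x \<in> nbox n R" using component_le_enorm[of _ n x] by (force simp: nbox_iff)
qed

lemma nball_finite: "emeasure (prodleb n) (nball n R) < \<infinity>"
  using emeasure_mono[OF nball_subset_nbox[of n R] nbox_sets] nbox_finite[of n R] by auto

text \<open>A function measurable for the completion agrees almost everywhere with a Borel one.
  Since the ball has finite measure, \<open>|t| \<le> 1 + |t|^p\<close> yields integrability of the
  function itself, as convolution requires.\<close>

lemma in_Lp_ex_borel: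
  assumes "in_Lp n p (nball n R) f" "p \<ge> 1"
  shows "\<exists>f0. f0 \<in> borel_measurable (prodleb n) \<and> (AE z in prodleb n. f0 z = indicator (nball n R) z * f
      z) \<and>
    integrable (prodleb n) f0 \<and> integrable (prodleb n) (\<lambda>z. \<bar>f0 z\<bar> ^ p)"
proof -
  let ?U = "nball n R"
  have "(\<lambda>z. indicator ?U z *\<^sub>R f z) \<in> borel_measurable (completion (prodleb n))"
    using assms(1) unfolding in_Lp_def set_borel_measurable_def leb_def by blast
  from completion_ex_borel_measurable_real[OF this] obtain f0
    where f0 [measurable]: "f0 \<in> borel_measurable (prodleb n)" and ae: "AE z in prodleb n. indicator ?U
        z *\<^sub>R f z = f0 z"
    by blast
  have "integrable (completion (prodleb n)) (\<lambda>z. indicator ?U z *\<^sub>R \<bar>f z\<bar> ^ p)"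
    using assms(1) unfolding in_Lp_def set_integrable_def leb_def by blast
  moreover have m0: "(\<lambda>z. \<bar>f0 z\<bar> ^ p) \<in> borel_measurable (completion (prodleb n))"
    by (rule measurable_completion) measurable
  moreover have "AE z in completion (prodleb n). indicator ?U z *\<^sub>R \<bar>f z\<bar> ^ p = \<bar>f0 z\<bar> ^ p"
    unfolding AE_completion_iff using ae
  proof eventually_elim
    case (elim z)
    show ?case unfolding elim[symmetric] using assms(2) by (cases "z \<in> ?U") (auto simp: zero_power)
  qed
  ultimately have "integrable (completion (prodleb n)) (\<lambda>z. \<bar>f0 z\<bar> ^ p)"
    by (rule integrable_cong_AE_imp)
  then have ip: "integrable (prodleb n) (\<lambda>z. \<bar>f0 z\<bar> ^ p)"
    by (subst (asm) integrable_completion) measurable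
  have "integrable (prodleb n) (\<lambda>z. indicator ?U z + \<bar>f0 z\<bar> ^ p)"
    using ip nball_finite[of n R] by (intro Bochner_Integration.integrable_add
        integrable_real_indicator) auto
  then have "integrable (prodleb n) f0"
  proof (rule Bochner_Integration.integrable_bound)
    show "AE z in prodleb n. norm (f0 z) \<le> norm (indicator ?U z + \<bar>f0 z\<bar> ^ p)"
      using ae
    proof eventually_elim
      case (elim z)
      show ?case
      proof (cases "z \<in> ?U")
        case True
        show ?thesis
        proof (cases "\<bar>f0 z\<bar> \<le> 1")
          case False
          then have "\<bar>f0 z\<bar> ^ 1 \<le> \<bar>f0 z\<bar> ^ p" using assms(2) by (intro power_increasing) auto
          then show ?thesis using True by simp
        next
          case True
          moreover have "0 \<le> \<bar>f0 z\<bar> ^ p" by simp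
          ultimately have "\<bar>f0 z\<bar> \<le> 1 + \<bar>f0 z\<bar> ^ p" by linarith
          then show ?thesis using \<open>z \<in> ?U\<close> by simp
        qed
      next
        case False
        then show ?thesis using elim by simp
      qed
    qed
  qed simp
  moreover have "AE z in prodleb n. f0 z = indicator ?U z * f z"
    using ae by eventually_elim simp
  ultimately show ?thesis using f0 ip by blast
qed

text \<open>The metric on functions is a series with weights \<open>2^(-k)\<close> of total mass
  \<open>2\<close>, and points of the ball agree beyond \<open>n\<close>. A difference of
  \<open>d / 4\<close> per coordinate therefore keeps the distance at most
  \<open>d / 2\<close>.\<close>

lemma uniformly_continuous_ncball:
  fixes u :: "rvec \<Rightarrow> real"
  assumes "continuous_on (ncball n R) u" "\<tau> > 0"
  shows "\<exists>\<delta>>0. \<forall>x\<in>ncball n R. \<forall>y\<in>ncball n R. (\<forall>i<n. \<bar>x i - y i\<bar> \<le> \<delta>) \<longrightarrow> \<bar>u x - u y\<bar> \<le> \<tau>"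
proof -
  have "compact (ncball n R)"
  proof (rule compact_Int_closed[of "\<Pi>\<^sub>E i\<in>{..<n}. {-R..R}" "{x. enorm n x \<le> R}", THEN
      back_subst[of compact]])
    show "compact (\<Pi>\<^sub>E i\<in>{..<n}. {-R..R})" by (rule compact_PiE_Icc)
    show "closed {x. enorm n x \<le> R}"
      unfolding enorm_def L2_set_def by (intro closed_Collect_le continuous_intros) auto
    show "(\<Pi>\<^sub>E i\<in>{..<n}. {-R..R}) \<inter> {x. enorm n x \<le> R} = ncball n R"
      using component_le_enorm[of _ n]
      by (auto simp: ncball_def nbox_def[symmetric] nbox_iff) (meson order_trans)
  qed
  then have "uniformly_continuous_on (ncball n R) u"
    using assms(1) by (rule compact_uniformly_continuous[rotated])
  then obtain d where d: "d > 0" "\<And>x y. x \<in> ncball n R \<Longrightarrow> y \<in> ncball n R \<Longrightarrow> dist x y < d \<Longrightarrow> dist (u x)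
      (u y) < \<tau>"
    using assms(2) unfolding uniformly_continuous_on_def by metis
  have "dist x y < d" if x: "x \<in> ncball n R" "y \<in> ncball n R" "\<forall>i<n. \<bar>x i - y i\<bar> \<le> d / 4" for x y
  proof -
    have b: "dist (x i) (y i) \<le> d / 4" for i
      using that d(1) by (cases "i < n") (auto simp: dist_real_def ncball_def Rn_def PiE_iff
          extensional_def)
    have s: "summable (\<lambda>k. (1/2::real) ^ k * (d / 4))" by (intro summable_mult2 summable_geometric) auto
    have "dist x y \<le> (\<Sum>k. (1/2::real) ^ k * (d / 4))"
      unfolding dist_fun_def
    proof (rule suminf_le)
      show le: "(1/2) ^ k * min (dist (x (from_nat k)) (y (from_nat k))) 1 \<le> (1/2) ^ k * (d / 4)" for k
        using b[of "from_nat k"] by (intro mult_left_mono) auto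
      show "summable (\<lambda>k. (1/2) ^ k * min (dist (x (from_nat k)) (y (from_nat k))) 1)"
        by (rule summable_comparison_test'[OF s]) (use le in auto)
    qed (rule s)
    also have "\<dots> = (\<Sum>k. (1/2::real) ^ k) * (d / 4)"
      by (rule suminf_mult2[symmetric]) (intro summable_geometric, simp)
    also have "\<dots> = d / 2" using suminf_geometric[of "1/2::real"] by simp
    finally show ?thesis using d(1) by simp
  qed
  then show ?thesis using d by (intro exI[of _ "d / 4"]) (auto simp: dist_real_def less_imp_le)
qed

text \<open>All that the touching argument uses of a mollification. Derivatives are claimed only
  over the box of half-side \<open>r\<close>, where the kernel stays inside the domain; the
  Lipschitz constant is merely finite and may depend on \<tau>. Line points \<open>x + t v\<close>
  need not be extensional, since by the Lipschitz bound only the first \<open>n\<close> coordinates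
  count.\<close>

locale C2_approx =
  fixes n :: nat and r \<tau> :: real and u :: "rvec \<Rightarrow> real" and d :: "nat \<Rightarrow> rvec \<Rightarrow> real"
    and H :: "nat \<Rightarrow> nat \<Rightarrow> rvec \<Rightarrow> real" and w :: "rvec \<Rightarrow> real"
    and w1 :: "nat \<Rightarrow> rvec \<Rightarrow> real" and w2 :: "nat \<Rightarrow> nat \<Rightarrow> rvec \<Rightarrow> real"
  assumes line_deriv: "\<And>x v s. (\<And>i. i < n \<Longrightarrow> \<bar>x i + s * v i\<bar> \<le> r) \<Longrightarrow>
      ((\<lambda>t. w (\<lambda>i. x i + t * v i)) has_real_derivative (\<Sum>j<n. v j * w1 j (\<lambda>i. x i + s * v i))) (at s)"
    and grad_line_deriv: "\<And>k x v s. k < n \<Longrightarrow> (\<And>i. i < n \<Longrightarrow> \<bar>x i + s * v i\<bar> \<le> r) \<Longrightarrow>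
      ((\<lambda>t. w1 k (\<lambda>i. x i + t * v i)) has_real_derivative (\<Sum>j<n. v j * w2 k j (\<lambda>i. x i + s * v i))) (at s)"
    and hess_sym: "\<And>x i j. i < n \<Longrightarrow> j < n \<Longrightarrow> (\<And>i. i < n \<Longrightarrow> \<bar>x i\<bar> \<le> r) \<Longrightarrow> w2 i j x = w2 j i x"
    and lipschitz: "\<exists>K\<ge>0. \<forall>x y. \<bar>w x - w y\<bar> \<le> K * (\<Sum>i<n. \<bar>x i - y i\<bar>) \<and>
       (\<forall>i<n. \<bar>w1 i x - w1 i y\<bar> \<le> K * (\<Sum>i<n. \<bar>x i - y i\<bar>) \<and>
          (\<forall>j<n. \<bar>w2 i j x - w2 i j y\<bar> \<le> K * (\<Sum>i<n. \<bar>x i - y i\<bar>)))"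
    and close: "\<And>x. x \<in> nbox n r \<Longrightarrow> \<bar>w x - u x\<bar> \<le> \<tau>"
    and grad_meas: "\<And>i. i < n \<Longrightarrow> w1 i \<in> borel_measurable (prodleb n)"
    and grad_dev: "\<And>i. i < n \<Longrightarrow> Lp_dev n r n (w1 i) (d i) \<le> ennreal \<tau>"
    and hess_meas: "\<And>i j. i < n \<Longrightarrow> j < n \<Longrightarrow> w2 i j \<in> borel_measurable (prodleb n)"
    and hess_dev: "\<And>i j. i < n \<Longrightarrow> j < n \<Longrightarrow> Lp_dev n r n (w2 i j) (H i j) \<le> ennreal \<tau>"

lemma AE_vsub2:
  assumes "AE z in prodleb n. P z"
  shows "AE v in prodleb n. P (vsub n x v)"
proof (rule AE_distrD[where M' = "prodleb n"])
  show "AE z in distr (prodleb n) (prodleb n) (vsub n x). P z" using assms by (simp only: distr_vsub2)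
qed simp

lemma sobolev_C2_approx:
  assumes n: "n \<ge> 1" and sob: "sobolev2 n n (nball n R) u Du D2u" and cont: "continuous_on (ncball n R) u"
    and r: "nbox n (r + 1) \<subseteq> nball n R" and "\<tau> > 0"
    and u0: "u0 \<in> borel_measurable (prodleb n)" "AE z in prodleb n. u0 z = indicator (nball n R) z * u z"
      "integrable (prodleb n) u0"
    and d: "\<And>i. i < n \<Longrightarrow> d i \<in> borel_measurable (prodleb n)"
      "\<And>i. i < n \<Longrightarrow> AE z in prodleb n. d i z = indicator (nball n R) z * Du i z"
      "\<And>i. i < n \<Longrightarrow> integrable (prodleb n) (d i)" "\<And>i. i < n \<Longrightarrow> integrable (prodleb n) (\<lambda>z. \<bar>d i z\<bar> ^ n)"
    and H: "\<And>i j. i < n \<Longrightarrow> j < n \<Longrightarrow> H i j \<in> borel_measurable (prodleb n)"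
      "\<And>i j. i < n \<Longrightarrow> j < n \<Longrightarrow> AE z in prodleb n. H i j z = indicator (nball n R) z * D2u i j z"
      "\<And>i j. i < n \<Longrightarrow> j < n \<Longrightarrow> integrable (prodleb n) (H i j)"
      "\<And>i j. i < n \<Longrightarrow> j < n \<Longrightarrow> integrable (prodleb n) (\<lambda>z. \<bar>H i j z\<bar> ^ n)"
  shows "\<exists>w w1 w2. C2_approx n r \<tau> u d H w w1 w2"
proof -
  let ?U = "nball n R"
  obtain \<delta> where \<delta>: "\<delta> > 0" "\<And>x y. x \<in> ncball n R \<Longrightarrow> y \<in> ncball n R \<Longrightarrow> (\<forall>i<n. \<bar>x i - y i\<bar> \<le> \<delta>) \<Longrightarrow> \<bar>u x - u
      y\<bar> \<le> \<tau>"
    using uniformly_continuous_ncball[OF cont \<open>\<tau> > 0\<close>] by blast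
  define Q where "Q f s \<longleftrightarrow> (\<forall>\<psi> \<epsilon>. bump_kernel \<psi> \<epsilon> \<longrightarrow> \<epsilon> \<le> s \<longrightarrow>
     Lp_dev n r n (conv n f (\<lambda>_. \<psi>)) f \<le> ennreal \<tau>)"
    for f :: "rvec \<Rightarrow> real" and s :: real
  have Qmono: "Q f t" if "Q f s" "t \<le> s" for f s t
    using that unfolding Q_def by (meson order_trans)
  have "\<exists>s>0. \<forall>i<n. Q (d i) s"
  proof (rule ex_uniform_positive)
    show "\<exists>s>0. Q (d i) s" if "i < n" for i
      unfolding Q_def by (rule conv_Lp_close[OF d(3,4)[OF that] n \<open>\<tau> > 0\<close>])
  qed (rule Qmono)
  then obtain s1 where s1: "s1 > 0" "\<And>i. i < n \<Longrightarrow> Q (d i) s1" by blast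
  have "\<exists>s>0. \<forall>i<n. \<forall>j<n. Q (H i j) s"
  proof (rule ex_uniform_positive)
    fix i assume i: "i < n"
    show "\<exists>s>0. \<forall>j<n. Q (H i j) s"
    proof (rule ex_uniform_positive)
      show "\<exists>s>0. Q (H i j) s" if "j < n" for j
        unfolding Q_def by (rule conv_Lp_close[OF H(3,4)[OF i that] n \<open>\<tau> > 0\<close>])
    qed (rule Qmono)
  qed (use Qmono in blast)
  then obtain s2 where s2: "s2 > 0" "\<And>i j. i < n \<Longrightarrow> j < n \<Longrightarrow> Q (H i j) s2" by blast
  \<comment> \<open>A single kernel has to serve the gradient, the Hessian and uniform closeness to
    \<open>u\<close>, and has to fit into the margin \<open>1\<close> between the boxes of half-side
    \<open>r\<close> and \<open>r + 1\<close>.\<close>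
  define \<epsilon> where "\<epsilon> = min (min s1 s2) (min \<delta> 1)"
  have \<epsilon>: "\<epsilon> > 0" "\<epsilon> \<le> s1" "\<epsilon> \<le> s2" "\<epsilon> \<le> \<delta>" "\<epsilon> \<le> 1" using s1 s2 \<delta> by (auto simp: \<epsilon>_def)
  obtain \<psi> where \<psi>: "smooth_real \<psi>" "bump_kernel \<psi> \<epsilon>" using ex_smooth_bump[OF \<epsilon>(1)] by blast
  have \<psi>0: "\<psi> t = 0" if "\<epsilon> < \<bar>t\<bar>" for t using \<psi>(2) that by (auto simp: bump_kernel_def)
  define \<psi>' where "\<psi>' = deriv \<psi>"
  have \<psi>': "smooth_real \<psi>'" "\<And>t. \<epsilon> < \<bar>t\<bar> \<Longrightarrow> \<psi>' t = 0" "\<And>t. (\<psi> has_real_derivative \<psi>' t) (at t)"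
    using smooth_real_deriv[OF \<psi>(1)] smooth_real_zero_outside_deriv[OF \<psi>(1) \<psi>0] by (auto simp: \<psi>'_def)
  obtain B1 B2 where "\<And>t. \<bar>\<psi> t\<bar> \<le> B1" "\<And>t. \<bar>\<psi>' t\<bar> \<le> B2"
    using smooth_real_bounded[OF \<psi>(1) \<psi>0] smooth_real_bounded[OF \<psi>'(1,2)] by blast
  then have B: "\<bar>\<psi> t\<bar> \<le> max B1 B2" "\<bar>\<psi>' t\<bar> \<le> max B1 B2" for t by (auto intro: le_max_iff_disj[THEN iffD2])
  interpret C1_family n "\<lambda>_. \<psi>" "\<lambda>_. \<psi>'" "max B1 B2"
    using \<psi>' B smooth_real_measurable by unfold_locales auto
  have B0: "max B1 B2 \<ge> 0" using B(1)[of 0] by linarith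
  define w where "w = conv n u0 (\<lambda>_. \<psi>)"
  define w1 where "w1 i = conv n (d i) (\<lambda>_. \<psi>)" for i
  define w2 where "w2 i j = conv n (H i j) (\<lambda>_. \<psi>)" for i j
  have box: "(\<Pi>\<^sub>E k\<in>{..<n}. {x k - \<epsilon>..x k + \<epsilon>}) \<subseteq> ?U" if x: "\<forall>i<n. \<bar>x i\<bar> \<le> r" for x
  proof -
    have "(\<Pi>\<^sub>E k\<in>{..<n}. {x k - \<epsilon>..x k + \<epsilon>}) \<subseteq> nbox n (r + 1)"
      unfolding nbox_def
    proof (rule PiE_mono)
      fix k assume "k \<in> {..<n}"
      then have "\<bar>x k\<bar> \<le> r" using x by simp
      then show "{x k - \<epsilon>..x k + \<epsilon>} \<subseteq> {-(r+1)..r+1}" using \<epsilon>(5) by auto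
    qed
    then show ?thesis using r by blast
  qed
  have sobu: "set_borel_measurable (leb n) ?U u" "\<And>i. i < n \<Longrightarrow> set_borel_measurable (leb n) ?U (Du i)"
    "\<And>i j. i < n \<Longrightarrow> j < n \<Longrightarrow> set_borel_measurable (leb n) ?U (D2u i j)"
    "\<And>i. i < n \<Longrightarrow> weak_pderiv n ?U i u (Du i)" "\<And>i j. i < n \<Longrightarrow> j < n \<Longrightarrow> weak_pderiv n ?U j (Du i) (D2u i j)"
    using sob unfolding sobolev2_def in_Lp_def by blast+
  have W1: "conv n u0 ((\<lambda>_. \<psi>)(j := \<psi>')) x = w1 j x" if "j < n" "\<forall>i<n. \<bar>x i\<bar> \<le> r" for j x
    unfolding w1_def \<psi>'_def
    using weak_pderiv_conv[OF sobu(4)[OF that(1)] that(1) u0(1) d(1)[OF that(1)] u0(2) d(2)[OF that(1)]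
        sobu(1)
        sobu(2)[OF that(1)], where g = "\<lambda>_. \<psi>" and \<epsilon> = \<epsilon> and x = x] box[OF that(2)] \<psi> \<psi>0 by blast
  have W2: "conv n (d i) ((\<lambda>_. \<psi>)(j := \<psi>')) x = w2 i j x" if "i < n" "j < n" "\<forall>i<n. \<bar>x i\<bar> \<le> r" for i j x
    unfolding w2_def \<psi>'_def
    using weak_pderiv_conv[OF sobu(5)[OF that(1,2)] that(2) d(1)[OF that(1)] H(1)[OF that(1,2)]
        d(2)[OF that(1)] H(2)[OF that(1,2)] sobu(2)[OF that(1)]
        sobu(3)[OF that(1,2)], where g = "\<lambda>_. \<psi>" and \<epsilon> = \<epsilon> and x = x] box[OF that(3)] \<psi> \<psi>0 by blast
  \<comment> \<open>Symmetry of the weak Hessian is not among the data. After mollification it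
    follows by moving both derivatives onto the kernel acting on \<open>u0\<close>, where the two
    updates of profiles commute.\<close>
  have W2': "w2 i j x = conv n u0 ((\<lambda>_. \<psi>)(j := \<psi>', i := \<psi>')) x" if "i < n" "j < n" "i \<noteq> j" "\<forall>i<n. \<bar>x i\<bar>
      \<le> r" for i j x
  proof -
    have "conv n u0 (((\<lambda>_. \<psi>)(j := \<psi>'))(i := deriv (((\<lambda>_. \<psi>)(j := \<psi>')) i))) x = conv n (d i)
        ((\<lambda>_. \<psi>)(j := \<psi>')) x"
    proof (rule weak_pderiv_conv[OF sobu(4)[OF that(1)] that(1) u0(1) d(1)[OF that(1)] u0(2)
        d(2)[OF that(1)] sobu(1)
        sobu(2)[OF that(1)]])
      show "(\<Pi>\<^sub>E k\<in>{..<n}. {x k - \<epsilon>..x k + \<epsilon>}) \<subseteq> ?U" using that(4) by (rule box)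
    qed (use \<psi> \<psi>0 \<psi>' in auto)
    then show ?thesis using W2[OF that(1,2,4)] that(3) by (simp add: \<psi>'_def)
  qed
  have sym: "w2 i j x = w2 j i x" if "i < n" "j < n" "\<forall>i<n. \<bar>x i\<bar> \<le> r" for i j x
    using W2'[of i j x] W2'[of j i x] that fun_upd_twist[of i j "\<lambda>_. \<psi>" \<psi>' \<psi>'] by (cases "i = j") auto
  have D1: "((\<lambda>t. w (\<lambda>i. x i + t * v i)) has_real_derivative (\<Sum>j<n. v j * w1 j (\<lambda>i. x i + s * v i))) (at s)"
    if "\<forall>i<n. \<bar>x i + s * v i\<bar> \<le> r" for x v s
  proof -
    have "(\<Sum>j<n. v j * w1 j (\<lambda>i. x i + s * v i)) = (\<Sum>j<n. v j * conv n u0 ((\<lambda>_. \<psi>)(j := \<psi>'))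
        (\<lambda>i. x i + s * v i))"
      using W1 that by (intro sum.cong) auto
    then show ?thesis unfolding w_def using conv_line_deriv[OF u0(3), of x v s] by simp
  qed
  have D2: "((\<lambda>t. w1 k (\<lambda>i. x i + t * v i)) has_real_derivative
      (\<Sum>j<n. v j * w2 k j (\<lambda>i. x i + s * v i))) (at s)"
    if "\<forall>i<n. \<bar>x i + s * v i\<bar> \<le> r" "k < n" for x v s k
  proof -
    have "(\<Sum>j<n. v j * w2 k j (\<lambda>i. x i + s * v i)) = (\<Sum>j<n. v j * conv n (d k) ((\<lambda>_. \<psi>)(j := \<psi>'))
        (\<lambda>i. x i + s * v i))"
      using W2 that by (intro sum.cong) auto
    then show ?thesis unfolding w1_def using conv_line_deriv[OF d(3)[OF that(2)], of x v s] by simp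
  qed
  define K where "K = (max B1 B2) ^ n * ((LINT z|prodleb n. \<bar>u0 z\<bar>) + (\<Sum>i<n. LINT z|prodleb n. \<bar>d i z\<bar>)
      + (\<Sum>i<n. \<Sum>j<n. LINT z|prodleb n. \<bar>H i j z\<bar>))"
  have lip: "\<bar>conv n f (\<lambda>_. \<psi>) x - conv n f (\<lambda>_. \<psi>) y\<bar> \<le> K * (\<Sum>i<n. \<bar>x i - y i\<bar>)"
    if "integrable (prodleb n) f" "(max B1 B2) ^ n * (LINT z|prodleb n. \<bar>f z\<bar>) \<le> K" for f x y
    using conv_lipschitz[OF that(1), of x y] mult_right_mono[OF that(2), of "\<Sum>i<n. \<bar>x i - y i\<bar>"] by
        (simp add: sum_nonneg)
  have nn: "0 \<le> (LINT z|prodleb n. \<bar>f z\<bar>)" for f :: "rvec \<Rightarrow> real" by simp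
  have nn1: "0 \<le> (\<Sum>i<n. LINT z|prodleb n. \<bar>d i z\<bar>)" "0 \<le> (\<Sum>i<n. \<Sum>j<n. LINT z|prodleb n. \<bar>H i j z\<bar>)"
    by (intro sum_nonneg nn)+
  have K1: "(LINT z|prodleb n. \<bar>d i z\<bar>) \<le> (\<Sum>i<n. LINT z|prodleb n. \<bar>d i z\<bar>)" if "i < n" for i
    using that nn by (intro member_le_sum) auto
  have K2: "(LINT z|prodleb n. \<bar>H i j z\<bar>) \<le> (\<Sum>i<n. \<Sum>j<n. LINT z|prodleb n. \<bar>H i j z\<bar>)" if "i < n" "j <
      n" for i j
  proof -
    have "(LINT z|prodleb n. \<bar>H i j z\<bar>) \<le> (\<Sum>j<n. LINT z|prodleb n. \<bar>H i j z\<bar>)"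
      using that nn by (intro member_le_sum) auto
    also have "\<dots> \<le> (\<Sum>i<n. \<Sum>j<n. LINT z|prodleb n. \<bar>H i j z\<bar>)"
      using that nn by (intro member_le_sum[of i "{..<n}" "\<lambda>i. \<Sum>j<n. LINT z|prodleb n. \<bar>H i j z\<bar>"]
          sum_nonneg) auto
    finally show ?thesis .
  qed
  have K0: "K \<ge> 0" unfolding K_def using B0 nn1 nn[of u0] by
      (intro mult_nonneg_nonneg add_nonneg_nonneg) auto
  have KI: "(max B1 B2) ^ n * c \<le> K" if "c \<le> (LINT z|prodleb n. \<bar>u0 z\<bar>) + (\<Sum>i<n. LINT z|prodleb n. \<bar>d i z\<bar>)
      + (\<Sum>i<n. \<Sum>j<n. LINT z|prodleb n. \<bar>H i j z\<bar>)" for c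
    unfolding K_def using B0 that by (intro mult_left_mono) auto
  have L0: "\<bar>w x - w y\<bar> \<le> K * (\<Sum>i<n. \<bar>x i - y i\<bar>)" for x y
    unfolding w_def by (intro lip u0(3) KI) (use nn1 in linarith)
  have L1: "\<bar>w1 i x - w1 i y\<bar> \<le> K * (\<Sum>i<n. \<bar>x i - y i\<bar>)" if "i < n" for i x y
    unfolding w1_def by (intro lip d(3) that KI) (use nn1 nn[of u0] K1[OF that] in linarith)
  have L2: "\<bar>w2 i j x - w2 i j y\<bar> \<le> K * (\<Sum>i<n. \<bar>x i - y i\<bar>)" if "i < n" "j < n" for i j x y
    unfolding w2_def by (intro lip H(3) that KI) (use nn1 nn[of u0] K2[OF that] in linarith)
  have close: "\<bar>w x - u x\<bar> \<le> \<tau>" if x: "x \<in> nbox n r" for x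
    unfolding w_def
  proof (rule conv_close[OF u0(3) \<psi>(2)])
    show "AE v in prodleb n. small_shift n \<epsilon> v \<longrightarrow> \<bar>u0 (vsub n x v) - u x\<bar> \<le> \<tau>"
      using AE_vsub2[OF u0(2), of x]
    proof eventually_elim
      case (elim v)
      show ?case
      proof
        assume v: "small_shift n \<epsilon> v"
        have "vsub n x v \<in> (\<Pi>\<^sub>E k\<in>{..<n}. {x k - \<epsilon>..x k + \<epsilon>})"
          using v by (auto simp: vsub_def small_shift_def abs_le_iff)
        then have "vsub n x v \<in> ?U" using box[of x] x by (auto simp: nbox_iff)
        moreover have "x \<in> ?U"
        proof -
          have "x \<in> nbox n (r + 1)" using x by (force simp: nbox_iff)
          then show ?thesis using r by blast
        qed
        moreover have "\<forall>i<n. \<bar>vsub n x v i - x i\<bar> \<le> \<delta>"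
          using v \<epsilon>(4) by (auto simp: small_shift_def)
        ultimately show "\<bar>u0 (vsub n x v) - u x\<bar> \<le> \<tau>"
          using elim \<delta>(2)[of "vsub n x v" x] by (simp add: ncball_def nball_def)
      qed
    qed
  qed
  have "C2_approx n r \<tau> u d H w w1 w2"
  proof
    show "\<exists>K\<ge>0. \<forall>x y. \<bar>w x - w y\<bar> \<le> K * (\<Sum>i<n. \<bar>x i - y i\<bar>) \<and>
       (\<forall>i<n. \<bar>w1 i x - w1 i y\<bar> \<le> K * (\<Sum>i<n. \<bar>x i - y i\<bar>) \<and>
          (\<forall>j<n. \<bar>w2 i j x - w2 i j y\<bar> \<le> K * (\<Sum>i<n. \<bar>x i - y i\<bar>)))"
      using L0 L1 L2 K0 by (intro exI[of _ K]) auto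
    show "w1 i \<in> borel_measurable (prodleb n)" if "i < n" for i
      unfolding w1_def using d(1)[OF that] smooth_real_measurable[OF \<psi>(1)] by (intro conv_measurable)
    show "w2 i j \<in> borel_measurable (prodleb n)" if "i < n" "j < n" for i j
      unfolding w2_def using H(1)[OF that] smooth_real_measurable[OF \<psi>(1)] by (intro conv_measurable)
    show "Lp_dev n r n (w1 i) (d i) \<le> ennreal \<tau>" if "i < n" for i
      using s1(2)[OF that] \<psi>(2) \<epsilon>(2) unfolding Q_def w1_def by blast
    show "Lp_dev n r n (w2 i j) (H i j) \<le> ennreal \<tau>" if "i < n" "j < n" for i j
      using s2(2)[OF that] \<psi>(2) \<epsilon>(3) unfolding Q_def w2_def by blast
  qed (use D1 D2 sym close in auto)
  then show ?thesis by blast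
qed

section \<open>Cusps touching from below\<close>

definition quad :: "nat \<Rightarrow> (nat \<Rightarrow> nat \<Rightarrow> real) \<Rightarrow> (nat \<Rightarrow> real) \<Rightarrow> real" where
  "quad n N \<xi> = (\<Sum>i<n. \<Sum>j<n. N i j * \<xi> i * \<xi> j)"

lemma quad_delta:
  assumes "i < n" "j < n" "i \<noteq> j"
  shows "quad n N (\<lambda>k. if k = i then s else if k = j then t else 0)
    = s\<^sup>2 * N i i + t\<^sup>2 * N j j + s * t * (N i j + N j i)"
proof -
  let ?\<xi> = "\<lambda>k. if k = i then s else if k = j then t else 0"
  have S: "(\<Sum>k<n. f k * ?\<xi> k) = f i * s + f j * t" for f :: "nat \<Rightarrow> real"
  proof -
    have "(\<Sum>k<n. f k * ?\<xi> k) = (\<Sum>k\<in>{i, j}. f k * ?\<xi> k)"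
      using assms by (intro sum.mono_neutral_right) auto
    then show ?thesis using assms(3) by simp
  qed
  have "quad n N ?\<xi> = (\<Sum>k<n. (\<Sum>l<n. N k l * ?\<xi> l) * ?\<xi> k)"
    unfolding quad_def sum_distrib_right by (intro sum.cong) (auto simp: mult_ac)
  also have "\<dots> = (N i i * s + N i j * t) * s + (N j i * s + N j j * t) * t"
    unfolding S ..
  finally show ?thesis by (simp add: algebra_simps power2_eq_square)
qed

lemma quad_unit: "i < n \<Longrightarrow> quad n N (\<lambda>k. if k = i then s else 0) = s\<^sup>2 * N i i"
proof -
  assume i: "i < n"
  have S: "(\<Sum>k<n. f k * (if k = i then s else 0)) = f i * s" for f :: "nat \<Rightarrow> real"
    using i by (subst sum.remove[of _ i]) auto
  have "quad n N (\<lambda>k. if k = i then s else 0) = (\<Sum>k<n. (\<Sum>l<n. N k l * (if l = i then s else 0)) *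
      (if k = i then s else 0))"
    unfolding quad_def sum_distrib_right by (intro sum.cong) (auto simp: mult_ac)
  also have "\<dots> = N i i * s * s" unfolding S ..
  finally show ?thesis by (simp add: power2_eq_square)
qed

lemma psd_diag:
  assumes "\<And>\<xi>. 0 \<le> quad n N \<xi>" "i < n"
  shows "0 \<le> N i i"
  using assms(1)[of "\<lambda>k. if k = i then 1 else 0"] quad_unit[OF assms(2)] by simp

text \<open>Test the form on \<open>e_i + e_j\<close> and on \<open>e_i - e_j\<close>.\<close>

lemma psd_entry:
  assumes psd: "\<And>\<xi>. 0 \<le> quad n N \<xi>" and sym: "N i j = N j i" and "i < n" "j < n"
  shows "2 * \<bar>N i j\<bar> \<le> N i i + N j j"
proof (cases "i = j")
  case True
  then show ?thesis using psd_diag[OF psd \<open>i < n\<close>] by simp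
next
  case False
  from psd[of "\<lambda>k. if k = i then 1 else if k = j then 1 else 0"]
      psd[of "\<lambda>k. if k = i then 1 else if k = j then -1 else 0"]
  show ?thesis unfolding quad_delta[OF assms(3,4) False] sym by (simp add: abs_le_iff)
qed

lemma psd_entry_le_trace:
  assumes psd: "\<And>\<xi>. 0 \<le> quad n N \<xi>" and sym: "N i j = N j i" and "i < n" "j < n"
  shows "\<bar>N i j\<bar> \<le> (\<Sum>k<n. N k k)"
proof -
  have "N k k \<le> (\<Sum>k<n. N k k)" if "k < n" for k
    using that psd_diag[OF psd] by (intro member_le_sum) auto
  from this[OF assms(3)] this[OF assms(4)] psd_entry[where N = N, OF assms] show ?thesis by linarith
qed

text \<open>Symmetric Gaussian elimination: subtracting the rank-one form of the last row reduces the order.\<close>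

lemma psd_trace_prod_nonneg:
  assumes "\<And>\<xi>. 0 \<le> quad n A \<xi>" "\<And>\<xi>. 0 \<le> quad n N \<xi>" "\<And>i j. i < n \<Longrightarrow> j < n \<Longrightarrow> N i j = N j i"
  shows "0 \<le> (\<Sum>i<n. \<Sum>j<n. A i j * N i j)"
  using assms
proof (induction n arbitrary: N)
  case (Suc n)
  note A = Suc.prems(1) and psd = Suc.prems(2) and sym = Suc.prems(3)
  have An: "0 \<le> quad n A \<xi>" for \<xi>
    using A[of "\<xi>(n := 0)"] unfolding quad_def by simp
  have nn: "0 \<le> N n n" using psd by (rule psd_diag) simp
  show ?case
  proof (cases "N n n = 0")
    case True
    \<comment> \<open>With a vanishing pivot the form is affine in the last coordinate and
      nonnegative for all its values, which forces the mixed entries to be zero.\<close>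
    have z: "N n j = 0" if "j < n" for j
    proof -
      have "0 \<le> N j j + t * (2 * N n j)" for t
        using psd[of "\<lambda>k. if k = n then t else if k = j then 1 else 0"] that sym[of n j]
        by (subst (asm) quad_delta) (auto simp: True)
      from this[of "- (N j j + 1) / (2 * N n j)"] show ?thesis
        by (cases "N n j = 0") (auto simp: field_simps)
    qed
    have "0 \<le> (\<Sum>i<n. \<Sum>j<n. A i j * N i j)"
    proof (rule Suc.IH[OF An])
      show "0 \<le> quad n N \<xi>" for \<xi> using psd[of "\<xi>(n := 0)"] unfolding quad_def by simp
    qed (use sym in auto)
    then show ?thesis using z True sym by simp
  next
    case False
    define P where "P i j = N i j - N i n * N n j / N n n" for i j
    have P0: "P i n = 0" "P n i = 0" for i using False by (auto simp: P_def)
    have "0 \<le> (\<Sum>i<n. \<Sum>j<n. A i j * P i j)"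
    proof (rule Suc.IH[OF An])
      fix \<xi> :: "nat \<Rightarrow> real"
      define c where "c = (\<Sum>j<n. N n j * \<xi> j)"
      have c': "(\<Sum>j<n. N j n * \<xi> j) = c" unfolding c_def using sym by (intro sum.cong) auto
      \<comment> \<open>The last coordinate completes the square, so the full form at \<eta> equals
        the form of the Schur complement \<open>P\<close> at \<xi>.\<close>
      define \<eta> where "\<eta> = \<xi>(n := - c / N n n)"
      have "quad (Suc n) N \<eta> = quad n N \<xi> + (\<Sum>i<n. N i n * \<xi> i * (- c / N n n))
          + ((\<Sum>j<n. N n j * (- c / N n n) * \<xi> j) + N n n * (- c / N n n) * (- c / N n n))"
        unfolding quad_def \<eta>_def by (simp add: sum.distrib sum_subtractf sum_negf)
      also have "(\<Sum>i<n. N i n * \<xi> i * (- c / N n n)) = c * (- c / N n n)"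
        by (simp only: sum_distrib_right[symmetric] c')
      also have "(\<Sum>j<n. N n j * (- c / N n n) * \<xi> j) = c * (- c / N n n)"
      proof -
        have "(\<Sum>j<n. N n j * (- c / N n n) * \<xi> j) = (\<Sum>j<n. N n j * \<xi> j * (- c / N n n))"
          by (intro sum.cong) auto
        then show ?thesis by (simp only: sum_distrib_right[symmetric] c_def[symmetric])
      qed
      finally have e1: "quad (Suc n) N \<eta> = quad n N \<xi> - c * c / N n n"
        using False by (simp add: field_simps)
      have "quad n P \<xi> = quad n N \<xi> - (\<Sum>i<n. \<Sum>j<n. (N i n * \<xi> i) * (N n j * \<xi> j) / N n n)"
        unfolding quad_def P_def by (simp add: algebra_simps sum_subtractf)
      also have "(\<Sum>i<n. \<Sum>j<n. (N i n * \<xi> i) * (N n j * \<xi> j) / N n n) = c * c / N n n"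
        unfolding sum_divide_distrib[symmetric] sum_product[symmetric] c' c_def[symmetric] ..
      finally show "0 \<le> quad n P \<xi>" using e1 psd[of \<eta>] by simp
    next
      fix i j assume "i < n" "j < n"
      then show "P i j = P j i" unfolding P_def using sym[of i j] sym[of i n] sym[of n j] by simp
    qed
    moreover have "(\<Sum>i<Suc n. \<Sum>j<Suc n. A i j * P i j) = (\<Sum>i<n. \<Sum>j<n. A i j * P i j)"
      by (simp add: P0)
    moreover have "(\<Sum>i<Suc n. \<Sum>j<Suc n. A i j * N i j)
       = (\<Sum>i<Suc n. \<Sum>j<Suc n. A i j * P i j) + quad (Suc n) A (\<lambda>i. N n i) / N n n"
    proof -
      have "A i j * N i j = A i j * P i j + (A i j * N n i * N n j) / N n n" if "i < Suc n" "j < Suc n"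
          for i j
        using sym[of i n] that by (simp add: P_def field_simps)
      then have "(\<Sum>i<Suc n. \<Sum>j<Suc n. A i j * N i j) = (\<Sum>i<Suc n. \<Sum>j<Suc n. A i j * P i j +
          (A i j * N n i * N n j) / N n n)"
        by (intro sum.cong) auto
      then show ?thesis unfolding quad_def by (simp only: sum.distrib sum_divide_distrib)
    qed
    ultimately show ?thesis using A[of "\<lambda>i. N n i"] nn by simp
  qed
qed simp

text \<open>Nonnegativity of the trace of a product of semidefinite matrices, applied to
  \<open>a - lam I\<close> and \<open>N\<close>.\<close>

lemma elliptic_trace_bound:
  assumes ell: "\<And>\<xi>. lam * (\<Sum>i<n. (\<xi> i)\<^sup>2) \<le> quad n a \<xi>"
    and N: "\<And>\<xi>. 0 \<le> quad n N \<xi>" "\<And>i j. i < n \<Longrightarrow> j < n \<Longrightarrow> N i j = N j i"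
  shows "lam * (\<Sum>k<n. N k k) \<le> (\<Sum>i<n. \<Sum>j<n. a i j * N i j)"
proof -
  have q: "quad n (\<lambda>i j. a i j - (if i = j then lam else 0)) \<xi> = quad n a \<xi> - lam * (\<Sum>i<n. (\<xi> i)\<^sup>2)" for \<xi>
  proof -
    have "(a i j - (if i = j then lam else 0)) * \<xi> i * \<xi> j = a i j * \<xi> i * \<xi> j -
        (if i = j then lam * (\<xi> i)\<^sup>2 else 0)" for i j
      by (simp add: algebra_simps power2_eq_square)
    then show ?thesis unfolding quad_def by (simp add: sum_subtractf sum_distrib_left)
  qed
  have "0 \<le> (\<Sum>i<n. \<Sum>j<n. (a i j - (if i = j then lam else 0)) * N i j)"
    using ell N by (intro psd_trace_prod_nonneg) (auto simp: q)
  also have "\<dots> = (\<Sum>i<n. \<Sum>j<n. a i j * N i j) - lam * (\<Sum>k<n. N k k)"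
  proof -
    have "(a i j - (if i = j then lam else 0)) * N i j = a i j * N i j -
        (if i = j then lam * N i i else 0)" for i j
      by (simp add: algebra_simps)
    then show ?thesis by (simp add: sum_subtractf sum_distrib_left)
  qed
  finally show ?thesis by simp
qed

lemma elliptic_entry_bound:
  assumes ell: "\<And>\<xi>. 0 \<le> quad n a \<xi>" "\<And>\<xi>. quad n a \<xi> \<le> Lam * (\<Sum>i<n. (\<xi> i)\<^sup>2)"
    and sym: "a i j = a j i" and ij: "i < n" "j < n"
  shows "\<bar>a i j\<bar> \<le> Lam"
proof -
  have "a k k \<le> Lam" if "k < n" for k
  proof -
    have "(\<Sum>i<n. (if i = k then 1 else 0)\<^sup>2) = (1::real)"
      using that by (subst sum.remove[of _ k]) auto
    then show ?thesis using ell(2)[of "\<lambda>i. if i = k then 1 else 0"] quad_unit[OF that, of a 1] by simp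
  qed
  from this[OF ij(1)] this[OF ij(2)] psd_entry[where N = a, OF ell(1) sym ij] show ?thesis by linarith
qed

text \<open>Adding the paraboloid gives a function \<open>h\<close> with a minimum at
  \<open>0\<close>. As \<open>g'\<close> is differentiable at \<open>0\<close> only, a negative
  second derivative is refuted by the sign of \<open>h'\<close> to the right of \<open>0\<close> and
  the mean value theorem.\<close>

lemma touching_below_1d:
  fixes g g' :: "real \<Rightarrow> real"
  assumes e: "e > 0" and g: "\<And>t. \<bar>t\<bar> < e \<Longrightarrow> (g has_real_derivative g' t) (at t)"
    and g': "(g' has_real_derivative D) (at 0)"
    and le: "\<And>t. \<bar>t\<bar> < e \<Longrightarrow> g 0 - p * t - q * t\<^sup>2 \<le> g t"
  shows "g' 0 = - p" "- (2 * q) \<le> D"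
proof -
  define h where "h t = g t + p * t + q * t\<^sup>2" for t
  define h' where "h' t = g' t + p + 2 * q * t" for t
  have h: "(h has_real_derivative h' t) (at t)" if "\<bar>t\<bar> < e" for t
    unfolding h_def[abs_def] h'_def by (auto intro!: derivative_eq_intros g that)
  have h': "(h' has_real_derivative D + 2 * q) (at 0)"
    unfolding h'_def[abs_def] by (auto intro!: derivative_eq_intros g')
  have min: "h 0 \<le> h t" if "\<bar>t\<bar> < e" for t using le[OF that] by (simp add: h_def)
  have "h' 0 = 0" using h[of 0] e min by (intro DERIV_local_min[of h _ 0 e]) auto
  then show "g' 0 = - p" by (simp add: h'_def)
  show "- (2 * q) \<le> D"
  proof (rule ccontr)
    assume "\<not> - (2 * q) \<le> D"
    then have "D + 2 * q < 0" by simp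
    from DERIV_neg_dec_right[OF h' this] obtain d where d: "d > 0" "\<And>t. 0 < t \<Longrightarrow> t < d \<Longrightarrow> h' t < 0"
      using \<open>h' 0 = 0\<close> by auto
    define s where "s = min d e / 2"
    have s: "0 < s" "s < d" "s < e" using d(1) e by (auto simp: s_def)
    obtain z where "0 < z" "z < s" "h s - h 0 = (s - 0) * h' z"
      using MVT2[of 0 s h h'] s h by force
    then have "h s < h 0" using d(2)[of z] s by (smt (verit) mult_pos_neg)
    then show False using min[of s] s by simp
  qed
qed

section \<open>Geometry of the cusp\<close>

lemma enorm_triangle: "enorm n (\<lambda>i. x i + y i) \<le> enorm n x + enorm n y"
  unfolding enorm_def by (rule L2_set_triangle_ineq)

lemma enorm_scale: "c \<ge> 0 \<Longrightarrow> enorm n (\<lambda>i. c * x i) = c * enorm n x"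
  unfolding enorm_def by (rule L2_set_right_distrib[symmetric])

lemma enorm_scale_abs: "enorm n (\<lambda>i. c * x i) = \<bar>c\<bar> * enorm n x"
  by (simp add: enorm_def L2_set_def power_mult_distrib sum_distrib_left[symmetric] real_sqrt_mult)

lemma enorm_diff_commute: "enorm n (\<lambda>i. x i - y i) = enorm n (\<lambda>i. y i - x i)"
  by (simp add: enorm_def L2_set_def power2_commute)

lemma enorm_cong: "(\<And>i. i < n \<Longrightarrow> x i = y i) \<Longrightarrow> enorm n x = enorm n y"
  unfolding enorm_def by (intro L2_set_cong) auto

lemma enorm_reverse_triangle: "\<bar>enorm n x - enorm n y\<bar> \<le> enorm n (\<lambda>i. x i - y i)"
  using enorm_triangle[of n "\<lambda>i. x i - y i" y] enorm_triangle[of n "\<lambda>i. y i - x i" x]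
      enorm_diff_commute[of n x y] by simp

lemma abs_inner_le_enorm: "\<bar>\<Sum>i<n. x i * y i\<bar> \<le> enorm n x * enorm n y"
proof -
  have "\<bar>\<Sum>i<n. x i * y i\<bar> \<le> (\<Sum>i<n. \<bar>x i\<bar> * \<bar>y i\<bar>)"
    using sum_abs[of "\<lambda>i. x i * y i" "{..<n}"] by (simp add: abs_mult)
  also have "\<dots> \<le> enorm n x * enorm n y" unfolding enorm_def by (rule L2_set_mult_ineq)
  finally show ?thesis .
qed

text \<open>\<open>|z|^(1/2)\<close> is the concave function \<open>s^(1/4)\<close> of \<open>s = |z|^2\<close>, so it lies below the paraboloid
  obtained from the tangent in \<open>s\<close>.\<close>

lemma sqrt_enorm_tangent:
  assumes A: "A = sqrt (enorm n z)" "A > 0"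
  shows "sqrt (enorm n (\<lambda>i. z i + v i)) \<le> A + (2 * (\<Sum>i<n. z i * v i) + (\<Sum>i<n. (v i)\<^sup>2)) / (4 * A ^ 3)"
proof -
  define B where "B = sqrt (enorm n (\<lambda>i. z i + v i))"
  have "A ^ 4 = (enorm n z)\<^sup>2" "B ^ 4 = (enorm n (\<lambda>i. z i + v i))\<^sup>2"
    unfolding A B_def by (simp_all add: numeral_eq_Suc power2_eq_square)
  then have "B ^ 4 - A ^ 4 = 2 * (\<Sum>i<n. z i * v i) + (\<Sum>i<n. (v i)\<^sup>2)"
    by (simp add: enorm_sq power2_sum sum.distrib sum_distrib_left mult_ac)
  \<comment> \<open>The product is the gap between \<open>t^4\<close> and its tangent at
    \<open>A\<close>, evaluated at \<open>B\<close>.\<close>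
  moreover have "0 \<le> (B - A)\<^sup>2 * (B\<^sup>2 + 2 * (A * B) + 3 * A\<^sup>2)"
    using A by (intro mult_nonneg_nonneg add_nonneg_nonneg) (auto simp: B_def)
  then have "4 * A ^ 3 * (B - A) \<le> B ^ 4 - A ^ 4"
    by (simp add: power2_eq_square numeral_eq_Suc algebra_simps)
  ultimately have "B - A \<le> (2 * (\<Sum>i<n. z i * v i) + (\<Sum>i<n. (v i)\<^sup>2)) / (4 * A ^ 3)"
    using A by (simp add: pos_le_divide_eq mult.commute)
  then show ?thesis unfolding B_def by simp
qed

text \<open>The gradient \<open>p = C / (2 A^3) z\<close> has length \<open>C / (2 A)\<close>; so
  \<open>|p|\<close> determines \<open>A\<close>, and \<open>z = (2 / C) A^3 p\<close>. If
  \<open>D\<close> is at most half of \<open>|p1|\<close>, then \<open>A2 \<le> 2 A1\<close>, and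
  the inverse is Lipschitz at that point with a constant of order \<open>A1^3 / C\<close>. The
  factor is \<open>16 = 2 (1 + 7)\<close>, where \<open>7 = 1 + 2 + 4\<close> bounds
  \<open>A1^2 + A1 A2 + A2^2\<close> in units of \<open>A1^2\<close>.\<close>

lemma cusp_gradient_inverse_lipschitz:
  assumes C: "C > 0" and A1: "A1 > 0" "A1\<^sup>2 = enorm n z1" and A2: "A2 > 0" "A2\<^sup>2 = enorm n z2"
    and D: "D = enorm n (\<lambda>i. C / (2 * A1 ^ 3) * z1 i - C / (2 * A2 ^ 3) * z2 i)"
    and small: "D \<le> C / (4 * A1)"
  shows "enorm n (\<lambda>i. z1 i - z2 i) \<le> 16 / C * A1 ^ 3 * D"
proof -
  define p1 where "p1 i = C / (2 * A1 ^ 3) * z1 i" for i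
  define p2 where "p2 i = C / (2 * A2 ^ 3) * z2 i" for i
  have n1: "enorm n p1 = C / (2 * A1)" "enorm n p2 = C / (2 * A2)"
  proof -
    have "enorm n p1 = C / (2 * A1 ^ 3) * enorm n z1"
      unfolding p1_def using C A1 by (intro enorm_scale) simp
    moreover have "enorm n p2 = C / (2 * A2 ^ 3) * enorm n z2"
      unfolding p2_def using C A2 by (intro enorm_scale) simp
    ultimately show "enorm n p1 = C / (2 * A1)" "enorm n p2 = C / (2 * A2)"
      unfolding A1(2)[symmetric] A2(2)[symmetric] using A1 A2 by
          (simp_all add: power2_eq_square power3_eq_cube)
  qed
  have D': "D = enorm n (\<lambda>i. p1 i - p2 i)" unfolding D p1_def p2_def ..
  then have D0: "D \<ge> 0" by simp
  have rt: "\<bar>C / (2 * A1) - C / (2 * A2)\<bar> \<le> D"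
    using enorm_reverse_triangle[of n p1 p2] unfolding n1 D' .
  have "C / (4 * A1) \<le> C / (2 * A2)"
  proof -
    have "C / (2 * A1) = C / (4 * A1) + C / (4 * A1)" using A1 by (simp add: field_simps)
    then show ?thesis using rt small by linarith
  qed
  then have A21: "A2 \<le> 2 * A1" using C A1 A2 by (simp add: field_simps)
  have "\<bar>C / (2 * A1) - C / (2 * A2)\<bar> = C * \<bar>A2 - A1\<bar> / (2 * A1 * A2)"
  proof -
    have "C / (2 * A1) - C / (2 * A2) = C * (A2 - A1) / (2 * A1 * A2)" using A1 A2 by
        (simp add: field_simps)
    then show ?thesis using C A1 A2 by (simp add: abs_mult abs_divide)
  qed
  then have dA: "C * \<bar>A2 - A1\<bar> \<le> D * (2 * A1 * A2)"
    using rt A1 A2 by (simp add: divide_le_eq)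
  have "\<bar>A1 ^ 3 - A2 ^ 3\<bar> = \<bar>A2 - A1\<bar> * (A1\<^sup>2 + A1 * A2 + A2\<^sup>2)"
  proof -
    have "A1 ^ 3 - A2 ^ 3 = (A1 - A2) * (A1\<^sup>2 + A1 * A2 + A2\<^sup>2)"
      by (simp add: power2_eq_square power3_eq_cube algebra_simps)
    then show ?thesis using A1 A2 by (simp add: abs_mult abs_minus_commute)
  qed
  also have "\<dots> \<le> \<bar>A2 - A1\<bar> * (7 * A1\<^sup>2)"
  proof -
    have "A1 * A2 \<le> A1 * (2 * A1)" "A2\<^sup>2 \<le> (2 * A1)\<^sup>2"
      using A21 A1(1) A2(1) by (intro mult_left_mono power_mono; simp)+
    then have "A1\<^sup>2 + A1 * A2 + A2\<^sup>2 \<le> 7 * A1\<^sup>2" by (simp add: power2_eq_square)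
    then show ?thesis by (intro mult_left_mono) auto
  qed
  finally have cube: "\<bar>A1 ^ 3 - A2 ^ 3\<bar> \<le> \<bar>A2 - A1\<bar> * (7 * A1\<^sup>2)" .
  have "C * \<bar>A1 ^ 3 - A2 ^ 3\<bar> \<le> (C * \<bar>A2 - A1\<bar>) * (7 * A1\<^sup>2)"
    using cube C by (simp add: mult.assoc)
  also have "\<dots> \<le> (D * (2 * A1 * A2)) * (7 * A1\<^sup>2)"
    using dA by (intro mult_right_mono) auto
  finally have cube2: "C * \<bar>A1 ^ 3 - A2 ^ 3\<bar> / (2 * A2) \<le> 7 * A1 ^ 3 * D"
    using A2 by (simp add: divide_le_eq power2_eq_square power3_eq_cube mult_ac)
  have "enorm n (\<lambda>i. z1 i - z2 i) = enorm n (\<lambda>i. 2 / C * (A1 ^ 3 * (p1 i - p2 i) + (A1 ^ 3 - A2 ^ 3) *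
      p2 i))"
  proof (rule enorm_cong)
    fix i
    have "z1 i = 2 / C * (A1 ^ 3 * p1 i)" "z2 i = 2 / C * (A2 ^ 3 * p2 i)"
      using C A1 A2 by (auto simp: p1_def p2_def)
    then show "z1 i - z2 i = 2 / C * (A1 ^ 3 * (p1 i - p2 i) + (A1 ^ 3 - A2 ^ 3) * p2 i)"
      by (simp add: algebra_simps)
  qed
  also have "\<dots> = 2 / C * enorm n (\<lambda>i. A1 ^ 3 * (p1 i - p2 i) + (A1 ^ 3 - A2 ^ 3) * p2 i)"
    using C by (intro enorm_scale) auto
  also have "enorm n (\<lambda>i. A1 ^ 3 * (p1 i - p2 i) + (A1 ^ 3 - A2 ^ 3) * p2 i)
     \<le> enorm n (\<lambda>i. A1 ^ 3 * (p1 i - p2 i)) + enorm n (\<lambda>i. (A1 ^ 3 - A2 ^ 3) * p2 i)"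
    by (rule enorm_triangle)
  also have "enorm n (\<lambda>i. A1 ^ 3 * (p1 i - p2 i)) = A1 ^ 3 * D"
    unfolding D' using A1 by (intro enorm_scale) auto
  also have "enorm n (\<lambda>i. (A1 ^ 3 - A2 ^ 3) * p2 i) = \<bar>A1 ^ 3 - A2 ^ 3\<bar> * (C / (2 * A2))"
    unfolding n1(2)[symmetric]
    by (rule enorm_scale_abs)
  also have "\<bar>A1 ^ 3 - A2 ^ 3\<bar> * (C / (2 * A2)) \<le> 7 * A1 ^ 3 * D"
    using cube2 by (simp add: mult.commute)
  finally show ?thesis using C by (simp add: field_simps)
qed

definition cusp_contact :: "nat \<Rightarrow> real \<Rightarrow> real \<Rightarrow> (rvec \<Rightarrow> real) \<Rightarrow> rvec \<Rightarrow> rvec \<Rightarrow> bool" where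
  "cusp_contact n R C w y x \<longleftrightarrow> x \<in> nbox n R \<and>
     (\<forall>z\<in>nbox n R. w x + C * sqrt (edist n x y) \<le> w z + C * sqrt (edist n z y))"

text \<open>Up to a constant, the graph of \<open>w\<close> lies above the cusp and hence above the
  paraboloid that lies below the cusp and is tangent to it at \<open>x\<close>. The one-variable
  conditions on all lines through \<open>x\<close> yield the gradient and the Hessian bound.\<close>

lemma cusp_contact_derivatives:
  assumes ap: "C2_approx n r \<tau> u d H w w1 w2" and R: "R < r"
    and con: "cusp_contact n R C w y x" and int: "\<And>i. i < n \<Longrightarrow> \<bar>x i\<bar> < R"
    and A: "A = sqrt (edist n x y)" "A > 0" and C: "C > 0"
  shows "\<And>j. j < n \<Longrightarrow> w1 j x = - (C / (2 * A ^ 3) * (x j - y j))"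
    and "\<And>\<xi>. 0 \<le> quad n (\<lambda>i j. w2 i j x + (if i = j then C / (2 * A ^ 3) else 0)) \<xi>"
proof -
  obtain K where K: "\<And>x y. \<bar>w x - w y\<bar> \<le> K * (\<Sum>i<n. \<bar>x i - y i\<bar>)"
    using C2_approx.lipschitz[OF ap] by auto
  \<comment> \<open>The Lipschitz bound shows that \<open>w\<close> sees only the first
    \<open>n\<close> coordinates, so a line point can be replaced by its extensional restriction, a
    point of the box.\<close>
  have wcong: "w a = w b" if "\<And>i. i < n \<Longrightarrow> a i = b i" for a b
    using K[of a b] that by simp
  have key: "(\<Sum>j<n. v j * w1 j x) = - (C / (2 * A ^ 3) * (\<Sum>i<n. (x i - y i) * v i)) \<and>
      - (C / (2 * A ^ 3) * (\<Sum>i<n. (v i)\<^sup>2)) \<le> (\<Sum>k<n. v k * (\<Sum>j<n. v j * w2 k j x))" for v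
  proof -
    have "\<exists>e>0. \<forall>i<n. \<forall>t. \<bar>t\<bar> < e \<longrightarrow> \<bar>x i + t * v i\<bar> < R"
    proof (rule ex_uniform_positive)
      fix i assume i: "i < n"
      have "\<bar>x i + t * v i\<bar> < R" if "\<bar>t\<bar> < (R - \<bar>x i\<bar>) / (\<bar>v i\<bar> + 1)" for t
      proof -
        have "\<bar>t\<bar> * (\<bar>v i\<bar> + 1) < R - \<bar>x i\<bar>" using that by (simp add: pos_less_divide_eq)
        moreover have "\<bar>t * v i\<bar> \<le> \<bar>t\<bar> * (\<bar>v i\<bar> + 1)" by (simp add: abs_mult algebra_simps)
        ultimately show ?thesis by linarith
      qed
      then show "\<exists>e>0. \<forall>t. \<bar>t\<bar> < e \<longrightarrow> \<bar>x i + t * v i\<bar> < R"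
        using int[OF i] by (intro exI[of _ "(R - \<bar>x i\<bar>) / (\<bar>v i\<bar> + 1)"]) auto
    qed auto
    then obtain e where e: "e > 0" "\<And>i t. i < n \<Longrightarrow> \<bar>t\<bar> < e \<Longrightarrow> \<bar>x i + t * v i\<bar> < R" by blast
    define P where "P t = (\<lambda>i. x i + t * v i)" for t
    have P0: "P 0 = x" by (simp add: P_def)
    define g where "g t = w (P t)" for t
    define g' where "g' t = (\<Sum>j<n. v j * w1 j (P t))" for t
    define Z where "Z = (\<Sum>i<n. (x i - y i) * v i)"
    define V where "V = (\<Sum>i<n. (v i)\<^sup>2)"
    have d1: "(g has_real_derivative g' t) (at t)" if "\<bar>t\<bar> < e" for t
    proof -
      have "\<bar>x i + t * v i\<bar> \<le> r" if "i < n" for i using e(2)[OF that \<open>\<bar>t\<bar> < e\<close>] R by simp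
      from C2_approx.line_deriv[OF ap this] show ?thesis unfolding g_def[abs_def] g'_def P_def .
    qed
    have r0: "\<bar>x i + 0 * v i\<bar> \<le> r" if "i < n" for i using int[OF that] R by simp
    have d2: "(g' has_real_derivative (\<Sum>k<n. v k * (\<Sum>j<n. v j * w2 k j (P 0)))) (at 0)"
      unfolding g'_def[abs_def]
    proof (rule DERIV_sum)
      fix k assume "k \<in> {..<n}"
      then have "((\<lambda>t. w1 k (P t)) has_real_derivative (\<Sum>j<n. v j * w2 k j (P 0))) (at 0)"
        unfolding P_def by (intro C2_approx.grad_line_deriv[OF ap] r0) auto
      then show "((\<lambda>t. v k * w1 k (P t)) has_real_derivative v k * (\<Sum>j<n. v j * w2 k j (P 0))) (at 0)"
        by (rule DERIV_cmult)
    qed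
    have le: "g 0 - (C / (2 * A ^ 3) * Z) * t - (C / (4 * A ^ 3) * V) * t\<^sup>2 \<le> g t" if t: "\<bar>t\<bar> < e" for t
    proof -
      define z where "z = (\<lambda>i\<in>{..<n}. x i + t * v i)"
      have z: "z \<in> nbox n R" using e(2)[OF _ t] by (auto simp: z_def nbox_iff Rn_def less_imp_le)
      have gz: "g t = w z" unfolding g_def by (rule wcong) (simp add: z_def P_def)
      have "sqrt (edist n z y) = sqrt (enorm n (\<lambda>i. (x i - y i) + t * v i))"
        unfolding edist_def by (intro arg_cong[of _ _ sqrt] enorm_cong) (auto simp: z_def)
      also have "\<dots> \<le> A + (2 * (\<Sum>i<n. (x i - y i) * (t * v i)) + (\<Sum>i<n. (t * v i)\<^sup>2)) / (4 * A ^ 3)"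
        using A by (intro sqrt_enorm_tangent) (auto simp: edist_def)
      also have "(\<Sum>i<n. (x i - y i) * (t * v i)) = t * Z" unfolding Z_def by
          (simp add: sum_distrib_left mult_ac)
      also have "(\<Sum>i<n. (t * v i)\<^sup>2) = t\<^sup>2 * V" unfolding V_def by
          (simp add: sum_distrib_left power_mult_distrib)
      finally have "C * sqrt (edist n z y) \<le> C * (A + (2 * (t * Z) + t\<^sup>2 * V) / (4 * A ^ 3))"
        using C by (intro mult_left_mono) auto
      also have "\<dots> = C * A + (C / (2 * A ^ 3) * Z) * t + (C / (4 * A ^ 3) * V) * t\<^sup>2"
        using A by (simp add: field_simps)
      finally have "C * sqrt (edist n z y) \<le> C * A + (C / (2 * A ^ 3) * Z) * t + (C / (4 * A ^ 3) * V) *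
          t\<^sup>2" .
      moreover have "w x + C * A \<le> w z + C * sqrt (edist n z y)"
        using con z unfolding cusp_contact_def A by blast
      moreover have "g 0 = w x" by (simp add: g_def P0)
      ultimately show ?thesis using gz by linarith
    qed
    from touching_below_1d[OF e(1) d1 d2 le] show ?thesis
      unfolding g'_def P0 Z_def V_def by (simp add: mult.commute)
  qed
  show "w1 j x = - (C / (2 * A ^ 3) * (x j - y j))" if "j < n" for j
  proof -
    have S: "(\<Sum>k<n. f k * (if k = j then 1 else 0)) = f j" for f :: "nat \<Rightarrow> real"
      using that by (subst sum.remove[of _ j]) auto
    have S': "(\<Sum>k<n. (if k = j then 1 else 0) * f k) = f j" for f :: "nat \<Rightarrow> real"
      using S[of f] by (simp add: mult.commute)
    show ?thesis using conjunct1[OF key[of "\<lambda>k. if k = j then 1 else 0"]] unfolding S S' .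
  qed
  show "0 \<le> quad n (\<lambda>i j. w2 i j x + (if i = j then C / (2 * A ^ 3) else 0)) \<xi>" for \<xi>
  proof -
    have "quad n (\<lambda>i j. w2 i j x + (if i = j then C / (2 * A ^ 3) else 0)) \<xi>
      = (\<Sum>k<n. \<xi> k * (\<Sum>j<n. \<xi> j * w2 k j x)) + C / (2 * A ^ 3) * (\<Sum>i<n. (\<xi> i)\<^sup>2)"
    proof -
      have "(w2 i j x + (if i = j then C / (2 * A ^ 3) else 0)) * \<xi> i * \<xi> j
         = \<xi> i * (\<xi> j * w2 i j x) + (if i = j then C / (2 * A ^ 3) * (\<xi> i)\<^sup>2 else 0)" for i j
        by (simp add: algebra_simps power2_eq_square)
      then show ?thesis unfolding quad_def by (simp add: sum.distrib sum_distrib_left)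
    qed
    then show ?thesis using conjunct2[OF key[of \<xi>]] by simp
  qed
qed

section \<open>Covering the vertices\<close>

lemma enorm_le_box:
  assumes "\<And>i. i < n \<Longrightarrow> \<bar>x i\<bar> \<le> b" "b \<ge> 0"
  shows "enorm n x \<le> sqrt (real n) * b"
proof -
  have "(enorm n x)\<^sup>2 \<le> (\<Sum>i<n. b\<^sup>2)"
    unfolding enorm_sq
  proof (rule sum_mono)
    fix i assume "i \<in> {..<n}"
    then have "\<bar>x i\<bar> \<le> \<bar>b\<bar>" using assms(1)[of i] assms(2) by simp
    then show "(x i)\<^sup>2 \<le> b\<^sup>2" by (rule iffD1[OF abs_le_square_iff])
  qed
  also have "\<dots> = (sqrt (real n) * b)\<^sup>2" by (simp add: power_mult_distrib)
  finally show ?thesis by (rule power2_le_imp_le) (use assms(2) in auto)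
qed

lemma sum_power_le:
  fixes f :: "nat \<Rightarrow> real"
  assumes "\<And>i. i < n \<Longrightarrow> f i \<ge> 0" and "p \<ge> 1"
  shows "(\<Sum>i<n. f i) ^ p \<le> real n ^ p * (\<Sum>i<n. f i ^ p)"
proof (cases "n = 0")
  case False
  then have ne: "f ` {..<n} \<noteq> {}" by auto
  define m where "m = Max (f ` {..<n})"
  obtain k where k: "k < n" "f k = m" using Max_in[OF _ ne] unfolding m_def by auto
  have "(\<Sum>i<n. f i) \<le> (\<Sum>i<n. m)" unfolding m_def by (intro sum_mono) auto
  then have "(\<Sum>i<n. f i) ^ p \<le> (real n * m) ^ p" using assms by (intro power_mono sum_nonneg) auto
  also have "\<dots> = real n ^ p * f k ^ p" by (simp add: power_mult_distrib k)
  also have "f k ^ p \<le> (\<Sum>i<n. f i ^ p)" using k assms by (intro member_le_sum) auto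
  finally show ?thesis by (simp add: mult_left_mono)
next
  case True
  then show ?thesis using assms(2) by (cases p) auto
qed

text \<open>\<open>T\<close> is the trace of the semidefinite matrix
  \<open>w2 + C / (2 A^3) I\<close>: semidefiniteness bounds all its entries by \<open>T\<close>,
  and the equation will bound \<open>T\<close>. The scale \<open>h\<close> is one on which Hessian
  entries vary by at most \<open>1\<close>.\<close>

locale cusp_contact_point =
  fixes n :: nat and r \<tau> R C :: real and u w :: "rvec \<Rightarrow> real" and d w1 :: "nat \<Rightarrow> rvec \<Rightarrow> real"
    and H w2 :: "nat \<Rightarrow> nat \<Rightarrow> rvec \<Rightarrow> real" and y x :: rvec and A T h :: real
  assumes ap: "C2_approx n r \<tau> u d H w w1 w2" and R: "R < r" and C: "C > 0"
    and con: "cusp_contact n R C w y x" and int: "\<And>i. i < n \<Longrightarrow> \<bar>x i\<bar> < R"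
    and A: "A = sqrt (edist n x y)" "A > 0"
    and T: "T = (\<Sum>k<n. w2 k k x + C / (2 * A ^ 3))"
    and h: "h > 0"
    and osc: "\<And>z i j. (\<And>i. i < n \<Longrightarrow> \<bar>z i - x i\<bar> \<le> h) \<Longrightarrow> i < n \<Longrightarrow> j < n \<Longrightarrow> \<bar>w2 i j z - w2 i j x\<bar> \<le> 1"
begin

abbreviation "N i j \<equiv> w2 i j x + (if i = j then C / (2 * A ^ 3) else 0)"

lemma grad: "j < n \<Longrightarrow> w1 j x = - (C / (2 * A ^ 3) * (x j - y j))"
  by (rule cusp_contact_derivatives(1)[OF ap R con int A C])

lemma psd: "0 \<le> quad n N \<xi>"
  by (rule cusp_contact_derivatives(2)[OF ap R con int A C])

lemma box: "i < n \<Longrightarrow> \<bar>x i\<bar> \<le> r"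
  using int[of i] R by simp

lemma sym: "i < n \<Longrightarrow> j < n \<Longrightarrow> N i j = N j i"
  using C2_approx.hess_sym[OF ap _ _ box, of i j] by auto

lemma trace: "(\<Sum>k<n. N k k) = T"
  by (simp add: T)

lemma T_nonneg: "0 \<le> T"
  unfolding trace[symmetric] by (intro sum_nonneg psd_diag[where N = N, OF psd]) auto

lemma hess_bound: "i < n \<Longrightarrow> j < n \<Longrightarrow> \<bar>w2 i j x\<bar> \<le> T + C / (2 * A ^ 3)"
proof -
  assume ij: "i < n" "j < n"
  have "0 \<le> C / (2 * A ^ 3)" using C A(2) by simp
  with psd_entry_le_trace[where N = N, OF psd sym[OF ij] ij] show ?thesis
    unfolding trace by (cases "i = j") simp_all
qed

lemma A_sq: "A\<^sup>2 = enorm n (\<lambda>i. x i - y i)"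
  using A by (simp add: edist_def)

lemma enorm_grad: "enorm n (\<lambda>i. w1 i x) = C / (2 * A)"
proof -
  have "enorm n (\<lambda>i. w1 i x) = enorm n (\<lambda>i. - (C / (2 * A ^ 3)) * (x i - y i))"
    by (rule enorm_cong) (simp add: grad)
  also have "\<dots> = C / (2 * A ^ 3) * A\<^sup>2"
    unfolding enorm_scale_abs A_sq using C A by simp
  finally show ?thesis using A by (simp add: power2_eq_square power3_eq_cube)
qed

text \<open>Along the segment between the contact points each gradient component moves by at most
  \<open>n h \<Theta>\<close>, and inverting the cusp gradient multiplies this by a factor of order
  \<open>A^3 / C\<close>. As \<open>A^3\<close> times the Hessian size of the cusp is
  \<open>C / 2\<close>, the result contains \<open>A\<close> only through \<open>A^3 T\<close> and
  \<open>A^3\<close>, which stay bounded near the vertex.\<close>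

lemma vertices_close:
  assumes con2: "cusp_contact n R C w y' x'" and int2: "\<And>i. i < n \<Longrightarrow> \<bar>x' i\<bar> < R"
    and A2: "A' = sqrt (edist n x' y')" "A' > 0"
    and close: "\<And>i. i < n \<Longrightarrow> \<bar>x' i - x i\<bar> \<le> h"
    and gradclose: "enorm n (\<lambda>i. w1 i x' - w1 i x) \<le> C / (4 * A)" and i: "i < n"
  shows "\<bar>y i - y' i\<bar> \<le> h * (1 + 16 / C * (real n)\<^sup>2 * (A ^ 3 * T + C / 2 + A ^ 3))"
proof -
  define c where "c = C / (2 * A ^ 3)"
  define \<Theta> where "\<Theta> = T + c + 1"
  define D where "D = enorm n (\<lambda>i. w1 i x' - w1 i x)"
  have c0: "c \<ge> 0" using C A by (simp add: c_def)
  have step: "\<bar>w1 k x' - w1 k x\<bar> \<le> real n * (h * \<Theta>)" if k: "k < n" for k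
  proof -
    define v where "v i = x' i - x i" for i
    define f where "f t = w1 k (\<lambda>i. x i + t * v i)" for t
    have bx: "\<bar>x i + t * v i\<bar> \<le> r" if "0 \<le> t" "t \<le> 1" "i < n" for t i
    proof -
      have "x i + t * v i = (1 - t) * x i + t * x' i" by (simp add: v_def algebra_simps)
      also have "\<bar>\<dots>\<bar> \<le> (1 - t) * \<bar>x i\<bar> + t * \<bar>x' i\<bar>"
        using abs_triangle_ineq[of "(1 - t) * x i" "t * x' i"] that by (simp add: abs_mult)
      also have "\<dots> \<le> (1 - t) * R + t * R"
        using int[OF that(3)] int2[OF that(3)] that by (intro add_mono mult_left_mono) auto
      finally show ?thesis using R by (simp add: algebra_simps)
    qed
    have "\<exists>z>0. z < 1 \<and> f 1 - f 0 = (1 - 0) * (\<Sum>j<n. v j * w2 k j (\<lambda>i. x i + z * v i))"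
      unfolding f_def using bx by (intro MVT2) (auto intro!: C2_approx.grad_line_deriv[OF ap k])
    then obtain z where z: "z > 0" "z < 1" "f 1 - f 0 = (\<Sum>j<n. v j * w2 k j (\<lambda>i. x i + z * v i))" by auto
    have "f 1 = w1 k x'" "f 0 = w1 k x" by (auto simp: f_def v_def)
    then have "\<bar>w1 k x' - w1 k x\<bar> \<le> (\<Sum>j<n. \<bar>v j * w2 k j (\<lambda>i. x i + z * v i)\<bar>)"
      using z(3) sum_abs[of "\<lambda>j. v j * w2 k j (\<lambda>i. x i + z * v i)" "{..<n}"] by simp
    also have "\<dots> \<le> (\<Sum>j<n. h * \<Theta>)"
    proof (rule sum_mono)
      fix j assume "j \<in> {..<n}"
      then have j: "j < n" by simp
      have "\<bar>(x i + z * v i) - x i\<bar> \<le> h" if "i < n" for i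
      proof -
        have "z * \<bar>v i\<bar> \<le> 1 * \<bar>v i\<bar>" using z by (intro mult_right_mono) auto
        then show ?thesis using close[OF that] z by (simp add: abs_mult v_def)
      qed
      from osc[OF this k j] hess_bound[OF k j] have "\<bar>w2 k j (\<lambda>i. x i + z * v i)\<bar> \<le> \<Theta>"
        unfolding \<Theta>_def c_def by linarith
      then show "\<bar>v j * w2 k j (\<lambda>i. x i + z * v i)\<bar> \<le> h * \<Theta>"
        unfolding abs_mult using close[OF j] h by (intro mult_mono) (auto simp: v_def)
    qed
    finally show ?thesis by simp
  qed
  have "D \<le> (\<Sum>k<n. \<bar>w1 k x' - w1 k x\<bar>)" unfolding D_def by (rule enorm_le_sum)
  also have "\<dots> \<le> (\<Sum>k<n. real n * (h * \<Theta>))" using step by (intro sum_mono) auto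
  finally have D: "D \<le> (real n)\<^sup>2 * (h * \<Theta>)" by (simp add: power2_eq_square mult_ac)
  have D_eq: "D = enorm n (\<lambda>i. C / (2 * A ^ 3) * (x i - y i) - C / (2 * A' ^ 3) * (x' i - y' i))"
    unfolding D_def using grad cusp_contact_derivatives(1)[OF ap R con2 int2 A2 C]
    by (intro enorm_cong) simp
  have "enorm n (\<lambda>i. (x i - y i) - (x' i - y' i)) \<le> 16 / C * A ^ 3 * D"
  proof (rule cusp_gradient_inverse_lipschitz[OF C A(2) A_sq A2(2) _ D_eq])
    show "A'\<^sup>2 = enorm n (\<lambda>i. x' i - y' i)" using A2 by (simp add: edist_def)
    show "D \<le> C / (4 * A)" using gradclose by (simp add: D_def)
  qed
  also have "\<dots> \<le> 16 / C * A ^ 3 * ((real n)\<^sup>2 * (h * \<Theta>))" using C A D by (intro mult_left_mono) auto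
  finally have "\<bar>(x i - y i) - (x' i - y' i)\<bar> \<le> 16 / C * A ^ 3 * ((real n)\<^sup>2 * (h * \<Theta>))"
    using component_le_enorm[OF i, of "\<lambda>i. (x i - y i) - (x' i - y' i)"] by linarith
  then have "\<bar>y i - y' i\<bar> \<le> h + 16 / C * A ^ 3 * ((real n)\<^sup>2 * (h * \<Theta>))" using close[OF i] by linarith
  also have "h + k * A ^ 3 * ((real n)\<^sup>2 * (h * \<Theta>)) = h * (1 + k * (real n)\<^sup>2 *
      (A ^ 3 * T + A ^ 3 * c + A ^ 3))" for k
    unfolding \<Theta>_def by (simp add: algebra_simps)
  also have "A ^ 3 * c = C / 2" using A(2) by (simp add: c_def)
  finally show ?thesis .
qed

text \<open>The estimate is made at a point \<open>z\<close> near \<open>x\<close>, since the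
  contact point itself may be exceptional for the equation. Where true and mollified gradient are
  close at \<open>z\<close>, the true one has length at least
  \<open>C / (2 A) - 2 \<ge> 2 > \<gamma>\<close>, and the equation bounds the second-order part by
  \<open>|b| C / A\<close>. Elsewhere \<open>bad\<close> is \<open>1\<close> and the Hessian entries
  themselves serve as the bound. Multiplication by \<open>A^3\<close> removes the singular factors,
  and \<open>P\<close> collects the coefficients that remain.\<close>

lemma trace_bound:
  assumes z: "\<And>i. i < n \<Longrightarrow> \<bar>z i - x i\<bar> \<le> h"
    and gradclose: "enorm n (\<lambda>i. w1 i z - w1 i x) \<le> 1"
    and lam: "0 < lam" "lam \<le> Lam"
    and a_sym: "\<And>i j. i < n \<Longrightarrow> j < n \<Longrightarrow> a i j = a j i"
    and a_lower: "\<And>\<xi>. lam * (\<Sum>i<n. (\<xi> i)\<^sup>2) \<le> quad n a \<xi>"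
    and a_upper: "\<And>\<xi>. quad n a \<xi> \<le> Lam * (\<Sum>i<n. (\<xi> i)\<^sup>2)"
    and L: "\<gamma> < enorm n (\<lambda>i. d i z) \<Longrightarrow> (\<Sum>i<n. \<Sum>j<n. a i j * H i j z) + (\<Sum>i<n. b i * d i z) \<le> 0"
    and \<gamma>: "\<gamma> < 1" and A4: "4 \<le> C / (2 * A)" and Am: "A \<le> Am"
    and bad: "bad \<ge> 0" "\<not> enorm n (\<lambda>i. d i z - w1 i z) \<le> 1 \<Longrightarrow> bad = 1"
    and D: "D = (\<Sum>i<n. \<Sum>j<n. \<bar>H i j z - w2 i j z\<bar>)" and Hs: "Hs = (\<Sum>i<n. \<Sum>j<n. \<bar>H i j z\<bar>)"
    and P: "P = Am ^ 3 * Lam + (real n)\<^sup>2 * Lam * Am ^ 3 + real n * Lam * C / 2 + C * Am\<^sup>2"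
  shows "lam * (A ^ 3 * T) \<le> P * (1 + enorm n b + D + bad * Hs)"
proof -
  define c where "c = C / (2 * A ^ 3)"
  define S where "S = (\<Sum>i<n. \<Sum>j<n. a i j * H i j z)"
  have c0: "c \<ge> 0" using C A by (simp add: c_def)
  have D0: "D \<ge> 0" "Hs \<ge> 0" unfolding D Hs by (intro sum_nonneg; simp)+
  have a0: "0 \<le> quad n a \<xi>" for \<xi>
  proof -
    have "0 \<le> lam * (\<Sum>i<n. (\<xi> i)\<^sup>2)" using lam by (intro mult_nonneg_nonneg sum_nonneg) auto
    then show ?thesis using a_lower[of \<xi>] by linarith
  qed
  have ab: "\<bar>a i j\<bar> \<le> Lam" if "i < n" "j < n" for i j
    using elliptic_entry_bound[OF a0 a_upper a_sym that] that by simp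
  have S_le: "S \<le> enorm n b * (C / A) + Lam * (bad * Hs)"
  proof (cases "enorm n (\<lambda>i. d i z - w1 i z) \<le> 1")
    case True
    have e1: "\<bar>enorm n (\<lambda>i. d i z) - enorm n (\<lambda>i. w1 i z)\<bar> \<le> 1"
      using enorm_reverse_triangle[of n "\<lambda>i. d i z" "\<lambda>i. w1 i z"] True by simp
    have e2: "\<bar>enorm n (\<lambda>i. w1 i z) - enorm n (\<lambda>i. w1 i x)\<bar> \<le> 1"
      using enorm_reverse_triangle[of n "\<lambda>i. w1 i z" "\<lambda>i. w1 i x"] gradclose by simp
    have "\<gamma> < enorm n (\<lambda>i. d i z)" using e1 e2 A4 \<gamma> unfolding enorm_grad by linarith
    from L[OF this] have "S \<le> \<bar>\<Sum>i<n. b i * d i z\<bar>" unfolding S_def by linarith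
    also have "\<dots> \<le> enorm n b * enorm n (\<lambda>i. d i z)" by (rule abs_inner_le_enorm)
    also have "\<dots> \<le> enorm n b * (C / (2 * A) + C / (2 * A))"
      using e1 e2 A4 unfolding enorm_grad by (intro mult_left_mono) auto
    also have "C / (2 * A) + C / (2 * A) = C / A" using A by (simp add: field_simps)
    finally have "S \<le> enorm n b * (C / A)" .
    moreover have "0 \<le> Lam * (bad * Hs)" using lam bad D0 by (intro mult_nonneg_nonneg) auto
    ultimately show ?thesis by linarith
  next
    case False
    have "S \<le> (\<Sum>i<n. \<Sum>j<n. Lam * \<bar>H i j z\<bar>)"
      unfolding S_def
    proof (intro sum_mono)
      fix i j assume "i \<in> {..<n}" "j \<in> {..<n}"
      then have "\<bar>a i j\<bar> * \<bar>H i j z\<bar> \<le> Lam * \<bar>H i j z\<bar>" by (intro mult_right_mono ab) auto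
      then show "a i j * H i j z \<le> Lam * \<bar>H i j z\<bar>" using abs_ge_self[of "a i j * H i j z"] by
          (simp add: abs_mult)
    qed
    also have "\<dots> = Lam * (bad * Hs)" using bad(2)[OF False] by (simp add: Hs sum_distrib_left)
    finally show ?thesis using C A by (simp add: add_increasing)
  qed
  have "lam * T \<le> (\<Sum>i<n. \<Sum>j<n. a i j * N i j)"
    unfolding trace[symmetric] using a_lower psd sym by (rule elliptic_trace_bound)
  \<comment> \<open>Passing from the Hessian of \<open>w\<close> at \<open>x\<close> to
    \<open>H\<close> at \<open>z\<close> costs, per entry, the deviation of \<open>H\<close> from
    \<open>w2\<close> and an oscillation of \<open>1\<close>; the diagonal shift contributes
    \<open>Lam * c\<close>.\<close>
  also have "\<dots> \<le> (\<Sum>i<n. \<Sum>j<n. a i j * H i j z + Lam * \<bar>H i j z - w2 i j z\<bar> + Lam +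
      (if i = j then Lam * c else 0))"
  proof (intro sum_mono)
    fix i j assume "i \<in> {..<n}" "j \<in> {..<n}"
    then have ij: "i < n" "j < n" by auto
    have "a i j * (w2 i j x - H i j z) \<le> \<bar>a i j\<bar> * \<bar>w2 i j x - H i j z\<bar>" by (simp add: abs_mult[symmetric])
    also have "\<dots> \<le> Lam * (\<bar>H i j z - w2 i j z\<bar> + 1)"
      using ab[OF ij] osc[OF z ij] lam by (intro mult_mono) auto
    finally have 1: "a i j * w2 i j x \<le> a i j * H i j z + Lam * \<bar>H i j z - w2 i j z\<bar> + Lam" by
        (simp add: algebra_simps)
    have 2: "a i j * c \<le> Lam * c" using ab[OF ij] c0 by (intro mult_right_mono) auto
    show "a i j * N i j \<le> a i j * H i j z + Lam * \<bar>H i j z - w2 i j z\<bar> + Lam +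
        (if i = j then Lam * c else 0)"
      using 1 2 unfolding c_def by (auto simp: distrib_left)
  qed
  also have "\<dots> = S + Lam * D + (real n)\<^sup>2 * Lam + real n * Lam * c"
    unfolding S_def D by (simp add: sum.distrib sum_distrib_left power2_eq_square)
  finally have "lam * T \<le> enorm n b * (C / A) + Lam * (bad * Hs) + Lam * D + (real n)\<^sup>2 * Lam + real n *
      Lam * c"
    using S_le by linarith
  then have "A ^ 3 * (lam * T) \<le> A ^ 3 * (enorm n b * (C / A) + Lam * (bad * Hs) + Lam * D + (real n)\<^sup>2
      * Lam + real n * Lam * c)"
    using A by (intro mult_left_mono) auto
  also have "\<dots> = C * A\<^sup>2 * enorm n b + A ^ 3 * (Lam * (bad * Hs)) + A ^ 3 * (Lam * D) + A ^ 3 *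
      ((real n)\<^sup>2 * Lam) + real n * Lam * C / 2"
    using A by (simp add: c_def power2_eq_square power3_eq_cube field_simps)
  also have "\<dots> \<le> C * Am\<^sup>2 * enorm n b + Am ^ 3 * (Lam * (bad * Hs)) + Am ^ 3 * (Lam * D) + Am ^ 3 *
      ((real n)\<^sup>2 * Lam) + real n * Lam * C / 2"
    using A Am C lam bad D0
    by (intro add_mono mult_right_mono mult_left_mono power_mono order_refl) auto
  also have "\<dots> \<le> P * (1 + enorm n b + D + bad * Hs)"
  proof -
    have Am0: "0 \<le> Am" using A(2) Am by linarith
    have nn: "0 \<le> Am ^ 3 * Lam" "0 \<le> (real n)\<^sup>2 * Lam * Am ^ 3" "0 \<le> real n * Lam * C / 2" "0 \<le> C * Am\<^sup>2"
      using Am0 C lam by simp_all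
    have "C * Am\<^sup>2 * enorm n b \<le> P * enorm n b" using nn unfolding P by (intro mult_right_mono) auto
    moreover have "Am ^ 3 * Lam * (bad * Hs) \<le> P * (bad * Hs)"
      using nn bad D0 unfolding P by (intro mult_right_mono) auto
    moreover have "Am ^ 3 * Lam * D \<le> P * D" using nn D0 unfolding P by (intro mult_right_mono) auto
    moreover have "(real n)\<^sup>2 * Lam * Am ^ 3 + real n * Lam * C / 2 \<le> P" using nn unfolding P by auto
    ultimately show ?thesis by (simp add: algebra_simps)
  qed
  finally show ?thesis by (simp add: mult_ac)
qed

end

text \<open>Half-open intervals make the cells a partition, so no point is counted twice.\<close>

definition cell :: "nat \<Rightarrow> real \<Rightarrow> (nat \<Rightarrow> int) \<Rightarrow> rvec set" where
  "cell n h m = (\<Pi>\<^sub>E i\<in>{..<n}. {h * m i..<h * (m i + 1)})"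

lemma cell_index:
  assumes "h > 0" "i < n" "x \<in> cell n h m"
  shows "m i = \<lfloor>x i / h\<rfloor>"
proof -
  have "h * m i \<le> x i" "x i < h * (m i + 1)" using assms by (auto simp: cell_def PiE_iff)
  then show ?thesis using assms(1) by (intro floor_unique[symmetric]) (auto simp: field_simps)
qed

lemma cell_floor:
  assumes "h > 0" "x \<in> Rn n"
  shows "x \<in> cell n h (\<lambda>i\<in>{..<n}. \<lfloor>x i / h\<rfloor>)"
proof -
  have "h * \<lfloor>t / h\<rfloor> \<le> t" "t < h * (\<lfloor>t / h\<rfloor> + 1)" for t :: real
  proof -
    have "h * \<lfloor>t / h\<rfloor> \<le> h * (t / h)" using assms(1) by (intro mult_left_mono) auto
    moreover have "h * (t / h) < h * (\<lfloor>t / h\<rfloor> + 1)" using assms(1) by (intro mult_strict_left_mono)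
        linarith+
    ultimately show "h * \<lfloor>t / h\<rfloor> \<le> t" "t < h * (\<lfloor>t / h\<rfloor> + 1)" using assms(1) by simp_all
  qed
  then show ?thesis using assms(2) by (auto simp: cell_def Rn_def PiE_iff)
qed

lemma cell_diff:
  assumes "x \<in> cell n h m" "z \<in> cell n h m" "i < n"
  shows "\<bar>z i - x i\<bar> \<le> h"
proof -
  have "h * m i \<le> x i" "x i < h * (m i + 1)" "h * m i \<le> z i" "z i < h * (m i + 1)"
    using assms by (auto simp: cell_def PiE_iff)
  moreover have "h * (m i + 1) = h * m i + h" by (simp add: algebra_simps)
  ultimately show ?thesis by linarith
qed

text \<open>One representative vertex per occupied cell suffices: all vertices with contact point in
  that cell lie in a cube of volume \<open>2^n l^n h^n\<close>. Here \<open>h^n\<close> is the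
  volume of the cell, on which \<open>F\<close> dominates \<open>l^n\<close>, so the grid size
  cancels and summation over cells gives the integral of \<open>F\<close>. The conclusion is a
  measurable superset because \<open>Y\<close> is an arbitrary set and \<open>X\<close> an arbitrary
  selection.\<close>

lemma grid_covering:
  fixes X :: "rvec \<Rightarrow> rvec" and l :: "rvec \<Rightarrow> real" and F :: "rvec \<Rightarrow> ennreal"
  assumes h: "h > 0" and Y: "Y \<subseteq> Rn n" and X: "\<And>y. y \<in> Y \<Longrightarrow> X y \<in> nbox n R" and l: "\<And>y. y \<in> Y \<Longrightarrow> 0 \<le> l y"
    and close: "\<And>y1 y2 i. y1 \<in> Y \<Longrightarrow> y2 \<in> Y \<Longrightarrow> (\<And>i. i < n \<Longrightarrow> \<bar>X y2 i - X y1 i\<bar> \<le> h) \<Longrightarrow> i < n \<Longrightarrow>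
      \<bar>y1 i - y2 i\<bar> \<le> h * l y1"
    and F: "F \<in> borel_measurable (prodleb n)"
    and lF: "\<And>y. y \<in> Y \<Longrightarrow> AE x in prodleb n. (\<forall>i<n. \<bar>x i - X y i\<bar> \<le> h) \<longrightarrow> ennreal (l y ^ n) \<le> F x"
  shows "\<exists>Z\<in>sets (prodleb n). Y \<subseteq> Z \<and> emeasure (prodleb n) Z \<le> ennreal (2 ^ n) * (\<integral>\<^sup>+x. F x \<partial>prodleb n)"
proof -
  \<comment> \<open>A range of indices that includes every cell meeting the box of contact points,
    so that finitely many cells occur.\<close>
  define L where "L = \<lceil>\<bar>R\<bar> / h\<rceil> + 1"
  define G where "G = {m \<in> (\<Pi>\<^sub>E i\<in>{..<n}. {-L..L}). \<exists>y\<in>Y. X y \<in> cell n h m}"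
  have "finite ((\<Pi>\<^sub>E i\<in>{..<n}. {-L..L}) :: (nat \<Rightarrow> int) set)" by (rule finite_PiE) auto
  then have "finite G" unfolding G_def by simp
  have "\<forall>m\<in>G. \<exists>y. y \<in> Y \<and> X y \<in> cell n h m" unfolding G_def by blast
  then obtain y where y: "\<And>m. m \<in> G \<Longrightarrow> y m \<in> Y" "\<And>m. m \<in> G \<Longrightarrow> X (y m) \<in> cell n h m" by metis
  define B where "B m = (\<Pi>\<^sub>E i\<in>{..<n}. {y m i - h * l (y m)..y m i + h * l (y m)})" for m
  have Bs: "B m \<in> sets (prodleb n)" for m unfolding B_def by (rule sets_PiM_I_finite) auto
  have cs [measurable]: "cell n h m \<in> sets (prodleb n)" for m unfolding cell_def by
      (rule sets_PiM_I_finite) auto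
  have ce: "emeasure (prodleb n) (cell n h m) = ennreal (h ^ n)" for m
  proof -
    have "emeasure (prodleb n) (cell n h m) = (\<Prod>i<n. emeasure lborel {h * m i..<h * (m i + 1)})"
      unfolding cell_def by (intro lborel_prod.emeasure_PiM) auto
    also have "\<dots> = (\<Prod>i<n. ennreal h)"
      using h by (intro prod.cong refl) (simp add: algebra_simps)
    finally show ?thesis using h by (simp add: ennreal_power)
  qed
  have Be: "emeasure (prodleb n) (B m) \<le> ennreal (2 ^ n) * (\<integral>\<^sup>+x. F x * indicator (cell n h m) x
      \<partial>prodleb n)"
    if m: "m \<in> G" for m
  proof -
    have hl: "0 \<le> h * l (y m)" using h l y(1)[OF m] by simp
    have "emeasure (prodleb n) (B m) = (\<Prod>i<n. emeasure lborel {y m i - h * l (y m)..y m i + h * l (y m)})"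
      unfolding B_def by (intro lborel_prod.emeasure_PiM) auto
    also have "\<dots> = (\<Prod>i<n. ennreal (2 * (h * l (y m))))"
      using hl by (intro prod.cong refl) simp
    also have "\<dots> = ennreal ((2 * (h * l (y m))) ^ n)" using hl by (simp add: ennreal_power)
    also have "\<dots> = ennreal (2 ^ n) * (ennreal (l (y m) ^ n) * ennreal (h ^ n))"
      using h l y(1)[OF m] by (simp add: power_mult_distrib ennreal_mult[symmetric] mult_ac)
    also have "ennreal (l (y m) ^ n) * ennreal (h ^ n) = (\<integral>\<^sup>+x. ennreal (l (y m) ^ n) * indicator
        (cell n h m) x \<partial>prodleb n)"
      by (simp add: nn_integral_cmult_indicator ce)
    also have "\<dots> \<le> (\<integral>\<^sup>+x. F x * indicator (cell n h m) x \<partial>prodleb n)"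
    proof (rule nn_integral_mono_AE)
      show "AE x in prodleb n. ennreal (l (y m) ^ n) * indicator (cell n h m) x \<le> F x * indicator
          (cell n h m) x"
        using lF[OF y(1)[OF m]]
      proof eventually_elim
        case (elim x)
        then show ?case using cell_diff[OF y(2)[OF m]] by (auto simp: indicator_def)
      qed
    qed
    finally show ?thesis by (simp add: mult_left_mono)
  qed
  have disj: "(\<Sum>m\<in>G. F x * indicator (cell n h m) x) \<le> F x" if "x \<in> Rn n" for x
  proof -
    let ?m = "\<lambda>i\<in>{..<n}. \<lfloor>x i / h\<rfloor>"
    have "m = ?m" if "m \<in> G" "x \<in> cell n h m" for m
      using that cell_index[OF h _ that(2)] by (auto simp: G_def PiE_iff extensional_def fun_eq_iff)
    then have "(\<Sum>m\<in>G. F x * indicator (cell n h m) x) \<le> (\<Sum>m\<in>G. if m = ?m then F x else 0)"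
      by (intro sum_mono) (auto simp: indicator_def)
    also have "\<dots> \<le> F x" using \<open>finite G\<close> by simp
    finally show ?thesis .
  qed
  have "emeasure (prodleb n) (\<Union>m\<in>G. B m) \<le> (\<Sum>m\<in>G. emeasure (prodleb n) (B m))"
    using \<open>finite G\<close> Bs by (intro emeasure_subadditive_finite) auto
  also have "\<dots> \<le> (\<Sum>m\<in>G. ennreal (2 ^ n) * (\<integral>\<^sup>+x. F x * indicator (cell n h m) x \<partial>prodleb n))"
    by (intro sum_mono Be)
  also have "\<dots> = ennreal (2 ^ n) * (\<integral>\<^sup>+x. (\<Sum>m\<in>G. F x * indicator (cell n h m) x) \<partial>prodleb n)"
    using F by (simp add: sum_distrib_left nn_integral_sum)
  also have "\<dots> \<le> ennreal (2 ^ n) * (\<integral>\<^sup>+x. F x \<partial>prodleb n)"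
    using disj by (intro mult_left_mono nn_integral_mono) (auto simp: space_prodleb)
  finally have "emeasure (prodleb n) (\<Union>m\<in>G. B m) \<le> ennreal (2 ^ n) * (\<integral>\<^sup>+x. F x \<partial>prodleb n)" .
  moreover have "Y \<subseteq> (\<Union>m\<in>G. B m)"
  proof
    fix v assume v: "v \<in> Y"
    let ?m = "\<lambda>i\<in>{..<n}. \<lfloor>X v i / h\<rfloor>"
    have "\<lfloor>X v i / h\<rfloor> \<in> {-L..L}" if "i < n" for i
    proof -
      have "\<bar>X v i\<bar> \<le> \<bar>R\<bar>" using X[OF v] that by (auto simp: nbox_iff)
      then have "X v i / h \<le> \<bar>R\<bar> / h" "- \<bar>R\<bar> / h \<le> X v i / h"
        using h by (intro divide_right_mono; simp)+
      then have "\<lfloor>X v i / h\<rfloor> \<le> L" "- L \<le> \<lfloor>X v i / h\<rfloor>" unfolding L_def by linarith+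
      then show ?thesis by simp
    qed
    moreover have Xv: "X v \<in> cell n h ?m" using X[OF v] by (intro cell_floor h) (simp add: nbox_iff)
    ultimately have m: "?m \<in> G" unfolding G_def using v by auto
    have "\<bar>y ?m i - v i\<bar> \<le> h * l (y ?m)" if "i < n" for i
      using cell_diff[OF y(2)[OF m] Xv] that by (intro close y(1) m v) auto
    then have "v \<in> B ?m" using Y v by (auto simp: B_def PiE_iff Rn_def abs_le_iff algebra_simps)
    then show "v \<in> (\<Union>m\<in>G. B m)" using m by blast
  qed
  moreover have "(\<Union>m\<in>G. B m) \<in> sets (prodleb n)" using \<open>finite G\<close> Bs by auto
  ultimately show ?thesis by blast
qed

section \<open>The approximation error\<close>

lemma integrable_tail_small:
  fixes g :: "'a \<Rightarrow> real"
  assumes g: "integrable M g" "\<And>x. 0 \<le> g x" and "\<kappa> > 0"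
  shows "\<exists>m>0. (\<integral>\<^sup>+x. ennreal (if m < g x then g x else 0) \<partial>M) \<le> ennreal \<kappa>"
proof -
  have [measurable]: "g \<in> borel_measurable M" using g by auto
  have "(\<lambda>k. \<integral>\<^sup>+x. ennreal (norm (0 - (if real k < g x then g x else 0))) \<partial>M) \<longlonglongrightarrow> 0"
  proof (rule nn_integral_dominated_convergence_norm[where w = g])
    show "(\<integral>\<^sup>+x. ennreal (g x) \<partial>M) < \<infinity>"
      using g unfolding integrable_iff_bounded by simp
    show "AE x in M. (\<lambda>k. if real k < g x then g x else 0) \<longlonglongrightarrow> 0"
    proof (rule AE_I2)
      fix x
      obtain N where "g x \<le> real N" using real_arch_simple by blast
      then have "eventually (\<lambda>k. (if real k < g x then g x else 0) = 0) sequentially"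
        by (auto simp: eventually_sequentially intro!: exI[of _ N])
      then show "(\<lambda>k. if real k < g x then g x else 0) \<longlonglongrightarrow> 0" by (rule tendsto_eventually)
    qed
  qed (use g(2) in auto)
  then have "eventually (\<lambda>k. (\<integral>\<^sup>+x. ennreal (norm (0 - (if real k < g x then g x else 0))) \<partial>M) < ennreal
      \<kappa>) sequentially"
    using \<open>\<kappa> > 0\<close> by (intro order_tendstoD) auto
  then have "eventually (\<lambda>k. k \<ge> 1 \<and> (\<integral>\<^sup>+x. ennreal (norm (0 - (if real k < g x then g x else 0))) \<partial>M) <
      ennreal \<kappa>) sequentially"
    by (intro eventually_conj eventually_ge_at_top)
  then obtain k where k: "k \<ge> 1" "(\<integral>\<^sup>+x. ennreal (norm (0 - (if real k < g x then g x else 0))) \<partial>M) <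
      ennreal \<kappa>"
    by (auto simp: eventually_sequentially)
  have "(\<lambda>x. ennreal (norm (0 - (if real k < g x then g x else 0)))) =
      (\<lambda>x. ennreal (if real k < g x then g x else 0))"
    using g(2) by (auto simp: fun_eq_iff)
  then show ?thesis using k by (intro exI[of _ "real k"]) auto
qed

lemma double_sum_power_le:
  fixes f :: "nat \<Rightarrow> nat \<Rightarrow> real"
  assumes "\<And>i j. f i j \<ge> 0" "p \<ge> 1"
  shows "(\<Sum>i<n. \<Sum>j<n. f i j) ^ p \<le> (real n ^ p * real n ^ p) * (\<Sum>i<n. \<Sum>j<n. f i j ^ p)"
proof -
  have "(\<Sum>i<n. \<Sum>j<n. f i j) ^ p \<le> real n ^ p * (\<Sum>i<n. (\<Sum>j<n. f i j) ^ p)"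
    using assms by (intro sum_power_le sum_nonneg) auto
  also have "\<dots> \<le> real n ^ p * (\<Sum>i<n. real n ^ p * (\<Sum>j<n. f i j ^ p))"
    using assms by (intro mult_left_mono sum_mono sum_power_le) auto
  finally show ?thesis by (simp add: sum_distrib_left mult.assoc)
qed

definition hess_dev :: "nat \<Rightarrow> (nat \<Rightarrow> nat \<Rightarrow> rvec \<Rightarrow> real) \<Rightarrow> (nat \<Rightarrow> nat \<Rightarrow> rvec \<Rightarrow> real) \<Rightarrow> rvec \<Rightarrow> real" where
  "hess_dev n H w2 x = (\<Sum>i<n. \<Sum>j<n. \<bar>H i j x - w2 i j x\<bar>)"

definition bad_hess :: "nat \<Rightarrow> (nat \<Rightarrow> rvec \<Rightarrow> real) \<Rightarrow> (nat \<Rightarrow> rvec \<Rightarrow> real) \<Rightarrow> (nat \<Rightarrow> nat \<Rightarrow> rvec \<Rightarrow> real) \<Rightarrow>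
    rvec \<Rightarrow> real" where
  "bad_hess n d w1 H x = (if enorm n (\<lambda>i. d i x - w1 i x) \<le> 1 then 0 else 1) * (\<Sum>i<n. \<Sum>j<n. \<bar>H i j x\<bar>)"

lemma hess_dev_nonneg: "0 \<le> hess_dev n H w2 x"
  unfolding hess_dev_def by (intro sum_nonneg) auto

lemma bad_hess_nonneg: "0 \<le> bad_hess n d w1 H x"
  unfolding bad_hess_def by (intro mult_nonneg_nonneg sum_nonneg) auto

text \<open>That the bad set is small does not by itself make the Hessian small in
  \<open>L^n\<close> on it. The power sum \<open>G\<close> is split at a height \<open>m\<close>:
  the part above is a tail of an integrable function, and the part below is at most \<open>m\<close>
  times a Chebyshev bound by the gradient deviation, hence small with \<tau>. The quantifier over
  all approximations lets \<tau> be fixed before a mollification is chosen.\<close>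

lemma C2_approx_error:
  assumes n: "n \<ge> 1" and d: "\<And>i. i < n \<Longrightarrow> d i \<in> borel_measurable (prodleb n)"
    and H: "\<And>i j. i < n \<Longrightarrow> j < n \<Longrightarrow> H i j \<in> borel_measurable (prodleb n)"
    and Hi: "\<And>i j. i < n \<Longrightarrow> j < n \<Longrightarrow> integrable (prodleb n) (\<lambda>z. \<bar>H i j z\<bar> ^ n)" and "\<kappa> > 0"
  shows "\<exists>\<tau>>0. \<tau> \<le> 1 \<and> (\<forall>u w w1 w2. C2_approx n r \<tau> u d H w w1 w2 \<longrightarrow>
    (\<integral>\<^sup>+x. indicator (nbox n r) x * ennreal (hess_dev n H w2 x ^ n + bad_hess n d w1 H x ^ n) \<partial>prodleb
        n) \<le> ennreal \<kappa>)"
proof -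
  define G where "G x = (\<Sum>i<n. \<Sum>j<n. \<bar>H i j x\<bar> ^ n)" for x
  have G: "integrable (prodleb n) G" "\<And>x. 0 \<le> G x"
    unfolding G_def using Hi by (auto intro!: Bochner_Integration.integrable_sum sum_nonneg)
  then have [measurable]: "G \<in> borel_measurable (prodleb n)" by auto
  define N where "N = real n ^ n * real n ^ n"
  have N: "N > 0" using n by (simp add: N_def)
  have "\<kappa> / (2 * N) > 0" using N \<open>\<kappa> > 0\<close> by simp
  from integrable_tail_small[OF G this] obtain m where m: "m > 0"
    "(\<integral>\<^sup>+x. ennreal (if m < G x then G x else 0) \<partial>prodleb n) \<le> ennreal (\<kappa> / (2 * N))" by blast
  \<comment> \<open>\<open>K1\<close> is the coefficient of the gradient deviation after Chebyshev.
    \<open>J\<close> then collects all deviations of size \<tau>, which are \<open>n^2\<close> from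
    the Hessian and \<open>n\<close> from the gradient.\<close>
  define K1 where "K1 = N * m * real n ^ n"
  have K1: "K1 > 0" using N m n by (simp add: K1_def)
  define J where "J = N * (real n * real n) + K1 * real n"
  have J: "J \<ge> 0" using N K1 by (simp add: J_def)
  define \<tau> where "\<tau> = min 1 (\<kappa> / (2 * (J + 1)))"
  have \<tau>: "\<tau> > 0" "\<tau> \<le> 1" using J \<open>\<kappa> > 0\<close> by (auto simp: \<tau>_def)
  have J\<tau>: "J * \<tau> \<le> \<kappa> / 2"
  proof -
    have "J * \<tau> \<le> (J + 1) * (\<kappa> / (2 * (J + 1)))" using J \<tau> by (intro mult_mono) (auto simp: \<tau>_def)
    also have "\<dots> = \<kappa> / 2" using J by (simp add: field_simps)
    finally show ?thesis .
  qed
  have "(\<integral>\<^sup>+x. indicator (nbox n r) x * ennreal (hess_dev n H w2 x ^ n + bad_hess n d w1 H x ^ n)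
      \<partial>prodleb n) \<le> ennreal \<kappa>"
    if ap: "C2_approx n r \<tau> u d H w w1 w2" for u w w1 w2
  proof -
    let ?I = "\<lambda>x. indicator (nbox n r) x :: ennreal"
    have meas [measurable]: "i < n \<Longrightarrow> w1 i \<in> borel_measurable (prodleb n)" "i < n \<Longrightarrow> d i \<in>
        borel_measurable (prodleb n)"
      "i < n \<Longrightarrow> j < n \<Longrightarrow> w2 i j \<in> borel_measurable (prodleb n)" "i < n \<Longrightarrow> j < n \<Longrightarrow> H i j \<in> borel_measurable
          (prodleb n)" for i j
      using C2_approx.grad_meas[OF ap] C2_approx.hess_meas[OF ap] d H by auto
    have m1: "(\<lambda>x. ?I x * ennreal (\<bar>w2 i j x - H i j x\<bar> ^ n)) \<in> borel_measurable (prodleb n)" if "i < n"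
        "j < n" for i j
      using meas(3,4)[OF that] by measurable
    have m2: "(\<lambda>x. ?I x * ennreal (\<bar>w1 i x - d i x\<bar> ^ n)) \<in> borel_measurable (prodleb n)" if "i < n" for i
      using meas(1,2)[OF that] by measurable
    have pt: "?I x * ennreal (hess_dev n H w2 x ^ n + bad_hess n d w1 H x ^ n)
       \<le> (ennreal N * (\<Sum>i<n. \<Sum>j<n. ?I x * ennreal (\<bar>w2 i j x - H i j x\<bar> ^ n))
           + ennreal K1 * (\<Sum>i<n. ?I x * ennreal (\<bar>w1 i x - d i x\<bar> ^ n)))
           + ennreal N * ennreal (if m < G x then G x else 0)" for x
    proof (cases "x \<in> nbox n r")
      case True
      have a: "hess_dev n H w2 x ^ n \<le> N * (\<Sum>i<n. \<Sum>j<n. \<bar>w2 i j x - H i j x\<bar> ^ n)"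
        unfolding hess_dev_def N_def using double_sum_power_le[of "\<lambda>i j. \<bar>H i j x - w2 i j x\<bar>" n n] n
        by (simp add: abs_minus_commute)
      have b: "bad_hess n d w1 H x ^ n \<le> K1 * (\<Sum>i<n. \<bar>w1 i x - d i x\<bar> ^ n) + N *
          (if m < G x then G x else 0)"
      proof (cases "enorm n (\<lambda>i. d i x - w1 i x) \<le> 1")
        case True
        have "0 \<le> K1 * (\<Sum>i<n. \<bar>w1 i x - d i x\<bar> ^ n)" "0 \<le> N * (if m < G x then G x else 0)"
          using K1 N G(2)[of x] by (auto intro!: mult_nonneg_nonneg sum_nonneg)
        then show ?thesis using True n by (simp add: bad_hess_def zero_power)
      next
        case False
        have "1 \<le> (\<Sum>i<n. \<bar>d i x - w1 i x\<bar>)"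
          using False enorm_le_sum[of n "\<lambda>i. d i x - w1 i x"] by linarith
        then have "1 \<le> (\<Sum>i<n. \<bar>d i x - w1 i x\<bar>) ^ n" by (rule one_le_power)
        also have "\<dots> \<le> real n ^ n * (\<Sum>i<n. \<bar>d i x - w1 i x\<bar> ^ n)" using n by (intro sum_power_le) auto
        finally have one: "1 \<le> real n ^ n * (\<Sum>i<n. \<bar>w1 i x - d i x\<bar> ^ n)" by (simp add: abs_minus_commute)
        have "bad_hess n d w1 H x ^ n \<le> N * G x"
          unfolding bad_hess_def G_def N_def using double_sum_power_le[of "\<lambda>i j. \<bar>H i j x\<bar>" n n] n False
              by simp
        also have "N * G x \<le> N * m + N * (if m < G x then G x else 0)" using N m by auto
        also have "N * m \<le> N * m * (real n ^ n * (\<Sum>i<n. \<bar>w1 i x - d i x\<bar> ^ n))"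
          using mult_left_mono[OF one, of "N * m"] N m by simp
        finally show ?thesis unfolding K1_def by (simp add: mult.assoc)
      qed
      have nn: "0 \<le> (\<Sum>i<n. \<Sum>j<n. \<bar>w2 i j x - H i j x\<bar> ^ n)" "0 \<le> (\<Sum>i<n. \<bar>w1 i x - d i x\<bar> ^ n)"
        by (intro sum_nonneg; simp)+
      have "ennreal (hess_dev n H w2 x ^ n + bad_hess n d w1 H x ^ n)
        \<le> ennreal ((N * (\<Sum>i<n. \<Sum>j<n. \<bar>w2 i j x - H i j x\<bar> ^ n) + K1 * (\<Sum>i<n. \<bar>w1 i x - d i x\<bar> ^ n)) + N
            * (if m < G x then G x else 0))"
        using a b by (intro ennreal_leI) linarith
      also have "\<dots> = (ennreal N * ennreal (\<Sum>i<n. \<Sum>j<n. \<bar>w2 i j x - H i j x\<bar> ^ n) + ennreal K1 * ennreal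
          (\<Sum>i<n. \<bar>w1 i x - d i x\<bar> ^ n))
          + ennreal N * ennreal (if m < G x then G x else 0)"
        using nn N K1 G(2)[of x] by (subst ennreal_plus; (subst ennreal_plus)?; simp add: ennreal_mult)
      finally show ?thesis using True by (simp add: sum_ennreal sum_nonneg)
    qed simp
    have "(\<integral>\<^sup>+x. ?I x * ennreal (hess_dev n H w2 x ^ n + bad_hess n d w1 H x ^ n) \<partial>prodleb n)
       \<le> (\<integral>\<^sup>+x. (ennreal N * (\<Sum>i<n. \<Sum>j<n. ?I x * ennreal (\<bar>w2 i j x - H i j x\<bar> ^ n))
           + ennreal K1 * (\<Sum>i<n. ?I x * ennreal (\<bar>w1 i x - d i x\<bar> ^ n)))
           + ennreal N * ennreal (if m < G x then G x else 0) \<partial>prodleb n)"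
      by (intro nn_integral_mono pt)
    also have "\<dots> = (ennreal N * (\<Sum>i<n. \<Sum>j<n. Lp_dev n r n (w2 i j) (H i j))
           + ennreal K1 * (\<Sum>i<n. Lp_dev n r n (w1 i) (d i)))
           + ennreal N * (\<integral>\<^sup>+x. ennreal (if m < G x then G x else 0) \<partial>prodleb n)"
    proof -
      have s1: "(\<lambda>x. \<Sum>i<n. \<Sum>j<n. ?I x * ennreal (\<bar>w2 i j x - H i j x\<bar> ^ n)) \<in> borel_measurable (prodleb n)"
        using m1 by (intro borel_measurable_sum) auto
      have s2: "(\<lambda>x. \<Sum>i<n. ?I x * ennreal (\<bar>w1 i x - d i x\<bar> ^ n)) \<in> borel_measurable (prodleb n)"
        using m2 by (intro borel_measurable_sum) auto
      have "(\<integral>\<^sup>+x. (\<Sum>i<n. \<Sum>j<n. ?I x * ennreal (\<bar>w2 i j x - H i j x\<bar> ^ n)) \<partial>prodleb n)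
          = (\<Sum>i<n. \<integral>\<^sup>+x. (\<Sum>j<n. ?I x * ennreal (\<bar>w2 i j x - H i j x\<bar> ^ n)) \<partial>prodleb n)"
        using m1 by (intro nn_integral_sum borel_measurable_sum) auto
      also have "\<dots> = (\<Sum>i<n. \<Sum>j<n. Lp_dev n r n (w2 i j) (H i j))"
        using m1 by (intro sum.cong refl nn_integral_sum) auto
      finally have i1: "(\<integral>\<^sup>+x. (\<Sum>i<n. \<Sum>j<n. ?I x * ennreal (\<bar>w2 i j x - H i j x\<bar> ^ n)) \<partial>prodleb n) = \<dots>" .
      have i2: "(\<integral>\<^sup>+x. (\<Sum>i<n. ?I x * ennreal (\<bar>w1 i x - d i x\<bar> ^ n)) \<partial>prodleb n)
          = (\<Sum>i<n. Lp_dev n r n (w1 i) (d i))"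
        using m2 by (intro nn_integral_sum) auto
      show ?thesis
        using s1 s2 unfolding i1[symmetric] i2[symmetric]
        by (subst nn_integral_add; (subst nn_integral_add)?; simp add: nn_integral_cmult)
    qed
    also have "\<dots> \<le> (ennreal N * (\<Sum>i<n. \<Sum>j<n. ennreal \<tau>) + ennreal K1 * (\<Sum>i<n. ennreal \<tau>)) + ennreal N *
        ennreal (\<kappa> / (2 * N))"
      using C2_approx.grad_dev[OF ap] C2_approx.hess_dev[OF ap] m(2) by
          (intro add_mono mult_left_mono sum_mono) auto
    also have "\<dots> = ennreal (J * \<tau> + \<kappa> / 2)"
    proof -
      have e: "(\<Sum>i<n. ennreal c) = ennreal (real n * c)" if "c \<ge> 0" for c
        using that by (simp add: ennreal_of_nat_eq_real_of_nat ennreal_mult)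
      have e1: "(\<Sum>i<n. ennreal \<tau>) = ennreal (real n * \<tau>)" using \<tau> by (intro e) simp
      have e2: "(\<Sum>i<n. ennreal (real n * \<tau>)) = ennreal (real n * (real n * \<tau>))" using \<tau> by (intro e) simp
      show ?thesis unfolding e1 e2 using \<tau> N K1 \<open>\<kappa> > 0\<close>
        by (simp add: ennreal_mult[symmetric] ennreal_plus[symmetric] J_def algebra_simps del: ennreal_plus)
    qed
    also have "\<dots> \<le> ennreal \<kappa>" using J\<tau> by (intro ennreal_leI) simp
    finally show ?thesis .
  qed
  then show ?thesis using \<tau> by blast
qed

section \<open>Existence of contact points\<close>

lemma continuous_on_coordinate_lipschitz:
  fixes w :: "rvec \<Rightarrow> real"
  assumes "\<And>x y. \<bar>w x - w y\<bar> \<le> K * (\<Sum>i<n. \<bar>x i - y i\<bar>)"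
  shows "continuous_on S w"
  unfolding continuous_on_def
proof
  fix x assume "x \<in> S"
  have "((\<lambda>z. z i) \<longlongrightarrow> x i) (at x within S)" for i
    using continuous_on_subset[OF continuous_on_product_coordinates, of S i] \<open>x \<in> S\<close> unfolding
        continuous_on_def by auto
  then have "((\<lambda>z. K * (\<Sum>i<n. \<bar>z i - x i\<bar>)) \<longlongrightarrow> K * (\<Sum>i<n. \<bar>x i - x i\<bar>)) (at x within S)"
    by (intro tendsto_intros)
  then have "((\<lambda>z. K * (\<Sum>i<n. \<bar>z i - x i\<bar>)) \<longlongrightarrow> 0) (at x within S)" by simp
  then have "((\<lambda>z. w z - w x) \<longlongrightarrow> 0) (at x within S)"
    by (rule Lim_null_comparison[rotated]) (use assms in auto)
  then show "(w \<longlongrightarrow> w x) (at x within S)" by (rule LIM_zero_cancel)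
qed

lemma ex_cusp_contact:
  fixes w :: "rvec \<Rightarrow> real"
  assumes "\<And>x y. \<bar>w x - w y\<bar> \<le> K * (\<Sum>i<n. \<bar>x i - y i\<bar>)" and R: "R \<ge> 0"
  shows "\<exists>x. cusp_contact n R C w y x"
proof -
  have "compact (nbox n R)" unfolding nbox_def by (rule compact_PiE_Icc)
  moreover have "(\<lambda>i\<in>{..<n}. 0) \<in> nbox n R" using R by (auto simp: nbox_iff Rn_def)
  then have "nbox n R \<noteq> {}" by blast
  moreover have "continuous_on (nbox n R) (\<lambda>z. sqrt (edist n z y))"
    unfolding edist_def enorm_def L2_set_def
    by (intro continuous_intros continuous_on_subset[OF continuous_on_product_coordinates]) auto
  then have "continuous_on (nbox n R) (\<lambda>z. w z + C * sqrt (edist n z y))"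
    by (intro continuous_on_add continuous_on_mult continuous_on_const
        continuous_on_coordinate_lipschitz[OF assms(1)])
  ultimately obtain x where "x \<in> nbox n R" "\<forall>z\<in>nbox n R. w x + C * sqrt (edist n x y) \<le> w z + C * sqrt
      (edist n z y)"
    using continuous_attains_inf by blast
  then show ?thesis unfolding cusp_contact_def by blast
qed

lemma edist_eq_0:
  assumes "x \<in> Rn n" "y \<in> Rn n" "edist n x y = 0"
  shows "x = y"
proof
  fix i
  show "x i = y i"
  proof (cases "i < n")
    case True
    then show ?thesis using component_le_enorm[of i n "\<lambda>i. x i - y i"] assms(3) by (simp add: edist_def)
  qed (use assms in \<open>auto simp: Rn_def PiE_iff extensional_def\<close>)
qed

section \<open>The level set estimate\<close>

text \<open>Integrability has to be secured along the way: for a non-integrable integrand the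
  Bochner integral, and with it the norm, would be \<open>0\<close> by convention and smallness of
  the norm would say nothing.\<close>

lemma vector_Lp_norm_power:
  assumes n: "n \<ge> 1" and b: "\<And>i. i < n \<Longrightarrow> in_Lp n n (nball n \<rho>) (b i)"
    and b0: "\<And>i. i < n \<Longrightarrow> b0 i \<in> borel_measurable (prodleb n)"
      "\<And>i. i < n \<Longrightarrow> AE z in prodleb n. b0 i z = indicator (nball n \<rho>) z * b i z"
      "\<And>i. i < n \<Longrightarrow> integrable (prodleb n) (\<lambda>z. \<bar>b0 i z\<bar> ^ n)"
  shows "(\<integral>\<^sup>+z. ennreal (enorm n (\<lambda>i. b0 i z) ^ n) \<partial>prodleb n) = ennreal
      (vector_Lp_norm n n (nball n \<rho>) b ^ n)"
proof -
  let ?U = "nball n \<rho>"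
  have e0: "(\<lambda>z. enorm n (\<lambda>i. b0 i z) ^ n) \<in> borel_measurable (prodleb n)"
    unfolding enorm_def L2_set_def using b0(1)
    by (intro borel_measurable_power borel_measurable_sqrt measurable_compose[OF borel_measurable_sum
        borel_measurable_sqrt]) auto
  have i0: "integrable (prodleb n) (\<lambda>z. enorm n (\<lambda>i. b0 i z) ^ n)"
  proof (rule Bochner_Integration.integrable_bound)
    show "integrable (prodleb n) (\<lambda>z. real n ^ n * (\<Sum>i<n. \<bar>b0 i z\<bar> ^ n))" using b0(3) by auto
    show "AE z in prodleb n. norm (enorm n (\<lambda>i. b0 i z) ^ n) \<le> norm (real n ^ n * (\<Sum>i<n. \<bar>b0 i z\<bar> ^ n))"
    proof (rule AE_I2)
      fix z
      have "enorm n (\<lambda>i. b0 i z) ^ n \<le> (\<Sum>i<n. \<bar>b0 i z\<bar>) ^ n" by (intro power_mono enorm_le_sum) auto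
      also have "\<dots> \<le> real n ^ n * (\<Sum>i<n. \<bar>b0 i z\<bar> ^ n)" using n by (intro sum_power_le) auto
      finally show "norm (enorm n (\<lambda>i. b0 i z) ^ n) \<le> norm (real n ^ n * (\<Sum>i<n. \<bar>b0 i z\<bar> ^ n))"
        by (simp add: sum_nonneg)
    qed
  qed (rule e0)
  have "(LINT z:?U|leb n. enorm n (\<lambda>i. b i z) ^ n) = (LINT z|leb n. enorm n (\<lambda>i. b0 i z) ^ n)"
    unfolding set_lebesgue_integral_def
  proof (rule integral_cong_AE)
    have bm: "(\<lambda>z. indicator ?U z *\<^sub>R b i z) \<in> borel_measurable (leb n)" if "i < n" for i
      using b[OF that] unfolding in_Lp_def set_borel_measurable_def by blast
    have "(\<lambda>z. enorm n (\<lambda>i. indicator ?U z *\<^sub>R b i z) ^ n) \<in> borel_measurable (leb n)"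
      unfolding enorm_def L2_set_def using bm
      by (intro borel_measurable_power measurable_compose[OF borel_measurable_sum
          borel_measurable_sqrt]) auto
    moreover have "enorm n (\<lambda>i. indicator ?U z *\<^sub>R b i z) ^ n = indicator ?U z *\<^sub>R enorm n (\<lambda>i. b i z) ^
        n" for z
      using n by (cases "z \<in> ?U") (auto simp: enorm_def L2_set_def zero_power)
    ultimately show "(\<lambda>z. indicator ?U z *\<^sub>R enorm n (\<lambda>i. b i z) ^ n) \<in> borel_measurable (leb n)" by simp
    show "(\<lambda>z. enorm n (\<lambda>i. b0 i z) ^ n) \<in> borel_measurable (leb n)"
      unfolding leb_def by (rule measurable_completion) (rule e0)
    have "AE z in prodleb n. \<forall>i\<in>{..<n}. b0 i z = indicator ?U z * b i z"
      using b0(2) by (intro AE_finite_allI) auto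
    then show "AE z in leb n. indicator ?U z *\<^sub>R enorm n (\<lambda>i. b i z) ^ n = enorm n (\<lambda>i. b0 i z) ^ n"
      unfolding leb_def AE_completion_iff
    proof eventually_elim
      case (elim z)
      then have "enorm n (\<lambda>i. b0 i z) = enorm n (\<lambda>i. indicator ?U z * b i z)" by (intro enorm_cong) auto
      then show ?case using n by (cases "z \<in> ?U") (auto simp: enorm_def L2_set_def zero_power)
    qed
  qed
  also have "\<dots> = (LINT z|prodleb n. enorm n (\<lambda>i. b0 i z) ^ n)"
    unfolding leb_def by (rule integral_completion) (rule e0)
  finally have e: "(LINT z:?U|leb n. enorm n (\<lambda>i. b i z) ^ n) =
      (LINT z|prodleb n. enorm n (\<lambda>i. b0 i z) ^ n)" .
  have "vector_Lp_norm n n ?U b ^ n = (LINT z|prodleb n. enorm n (\<lambda>i. b0 i z) ^ n)"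
    unfolding vector_Lp_norm_def e using n by (intro real_root_pow_pos2) auto
  then show ?thesis using i0 by (subst nn_integral_eq_integral) auto
qed

lemma four_power_le:
  fixes \<beta> D E :: real
  assumes "\<beta> \<ge> 0" "D \<ge> 0" "E \<ge> 0"
  shows "(1 + \<beta> + D + E) ^ p \<le> 4 ^ p * (1 + \<beta> ^ p + (D ^ p + E ^ p))"
proof -
  have "(1 + \<beta> + D + E) ^ p = ((1 + \<beta>) + (D + E)) ^ p" by (simp add: add.assoc)
  also have "\<dots> \<le> 2 ^ p * ((1 + \<beta>) ^ p + (D + E) ^ p)" using assms by (intro add_power_le) auto
  also have "\<dots> \<le> 2 ^ p * (2 ^ p * (1 ^ p + \<beta> ^ p) + 2 ^ p * (D ^ p + E ^ p))"
    using assms by (intro mult_left_mono add_mono add_power_le) auto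
  also have "\<dots> = (2 * 2) ^ p * (1 + \<beta> ^ p + (D ^ p + E ^ p))"
    unfolding power_mult_distrib by (simp add: algebra_simps)
  finally show ?thesis by simp
qed

text \<open>Ellipticity speaks of extensional vectors. The forms depend on the first
  \<open>n\<close> coordinates alone, so restricting \<xi> extends it to all functions.\<close>

lemma ellipticD:
  assumes "elliptic_on n U lam Lam a" "x \<in> U"
  shows "\<And>i j. i < n \<Longrightarrow> j < n \<Longrightarrow> a i j x = a j i x"
    and "\<And>\<xi>. lam * (\<Sum>i<n. (\<xi> i)\<^sup>2) \<le> quad n (\<lambda>i j. a i j x) \<xi>"
    and "\<And>\<xi>. quad n (\<lambda>i j. a i j x) \<xi> \<le> Lam * (\<Sum>i<n. (\<xi> i)\<^sup>2)"
proof -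
  fix \<xi> :: "nat \<Rightarrow> real"
  let ?\<xi> = "\<lambda>i\<in>{..<n}. \<xi> i"
  have 1: "?\<xi> \<in> Rn n" by (simp add: Rn_def)
  have 2: "enorm n ?\<xi> = enorm n \<xi>" by (intro enorm_cong) auto
  have 3: "(\<Sum>i<n. \<Sum>j<n. a i j x * ?\<xi> i * ?\<xi> j) = quad n (\<lambda>i j. a i j x) \<xi>"
    unfolding quad_def by (intro sum.cong) auto
  have "lam * (enorm n ?\<xi>)\<^sup>2 \<le> (\<Sum>i<n. \<Sum>j<n. a i j x * ?\<xi> i * ?\<xi> j) \<and>
      (\<Sum>i<n. \<Sum>j<n. a i j x * ?\<xi> i * ?\<xi> j) \<le> Lam * (enorm n ?\<xi>)\<^sup>2"
    using assms 1 unfolding elliptic_on_def by blast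
  then show "lam * (\<Sum>i<n. (\<xi> i)\<^sup>2) \<le> quad n (\<lambda>i j. a i j x) \<xi>" "quad n (\<lambda>i j. a i j x) \<xi> \<le> Lam *
      (\<Sum>i<n. (\<xi> i)\<^sup>2)"
    unfolding 2 3 enorm_sq by blast+
qed (use assms in \<open>auto simp: elliptic_on_def\<close>)

text \<open>The \<open>1\<close> on the left is the volume of the cube of vertices. A vertex either
  lies in the sublevel set or has its contact point elsewhere, and then a whole neighbourhood of the
  contact point lies in the sublevel set; the covering estimate for vertices of the second kind
  produces all terms with \<open>Q\<close>. Since \<kappa> is arbitrary and \<open>Q\<close> does
  not depend on it, the last term can be made as small as desired.\<close>

lemma level_set_estimate:
  fixes n :: nat and lam Lam \<gamma> \<kappa> :: real
  assumes n2: "n \<ge> 2" and lam: "0 < lam" "lam \<le> Lam" and \<gamma>: "\<gamma> < 1" and \<kappa>: "\<kappa> > 0"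
    and ell: "elliptic_on n (nball n (4 * real n)) lam Lam a"
    and b: "\<And>i. i < n \<Longrightarrow> in_Lp n n (nball n (4 * real n)) (b i)"
    and sob: "sobolev2 n n (nball n (4 * real n)) u Du D2u"
    and cont: "continuous_on (ncball n (4 * real n)) u"
    and L: "L_gamma_nonpos n (nball n (4 * real n)) \<gamma> a b Du D2u"
    and x0: "x\<^sub>0 \<in> contact_set n (4 * real n) u 1 {origin n} \<inter> cube n 1 (origin n)"
    and C: "C = 20 * (real n)\<^sup>2" and Am: "Am = 2 * real n"
    and P: "P = Am ^ 3 * Lam + (real n)\<^sup>2 * Lam * Am ^ 3 + real n * Lam * C / 2 + C * Am\<^sup>2"
    and Kc: "Kc = 1 + 16 / C * (real n)\<^sup>2 * (P / lam + C / 2 + Am ^ 3)"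
    and Q: "Q = 8 ^ n * Kc ^ n" and M: "M = C * sqrt (sqrt (real n)) + 3"
  shows "1 \<le> (1 + Q) * measure (leb n) ({x. u x \<le> u x\<^sub>0 + M} \<inter> nball n (4 * real n))
    + Q * vector_Lp_norm n n (nball n (4 * real n)) b ^ n + Q * \<kappa>"
proof -
  define U where "U = nball n (4 * real n)"
  define sn where "sn = sqrt (real n)"
  \<comment> \<open>Contact takes place over the box of half-side \<open>R\<close>; \<open>r\<close>
    adds a unit for the grid cells, and \<open>r + 1\<close> another for the kernel. The largest box
    still fits into the ball, as
    \<open>sqrt n (2 sqrt n + 2) = 2 n + 2 sqrt n < 4 n\<close>.\<close>
  define R where "R = 2 * sn"
  define r where "r = R + 1"
  define V where "V = {x. u x \<le> u x\<^sub>0 + M} \<inter> U"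
  have n1: "n \<ge> 1" "real n \<ge> 2" using n2 by auto
  have sn2: "sn * sn = real n" by (simp add: sn_def)
  have sn14: "sn \<ge> 14/10"
    unfolding sn_def using n1(2) by (intro real_le_rsqrt) (simp add: power2_eq_square)
  have C80: "C \<ge> 80"
    using power_mono[OF n1(2), of 2] by (simp add: C)
  have C0: "C > 0" using C80 by simp
  have R0: "R \<ge> 0" using sn14 by (simp add: R_def)
  have sn_n: "sn < real n"
  proof -
    have "sn * 1 < sn * sn" using sn14 by (intro mult_strict_left_mono) auto
    then show ?thesis using sn2 by simp
  qed
  have box_sub: "nbox n s \<subseteq> U" if "s \<le> r + 1" for s
  proof
    fix x assume x: "x \<in> nbox n s"
    have s0: "s \<ge> 0" using x n2 by (auto simp: nbox_iff intro: order_trans[OF abs_ge_zero, of "x 0"])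
    have "enorm n x \<le> sn * s" unfolding sn_def using x s0 by (intro enorm_le_box) (auto simp: nbox_iff)
    also have "\<dots> \<le> sn * (2 * sn + 2)" using that sn14 by (intro mult_left_mono) (auto simp: r_def R_def)
    also have "\<dots> = 2 * real n + 2 * sn" using sn2 by (simp add: algebra_simps)
    also have "\<dots> < 4 * real n" using sn_n by simp
    finally show "x \<in> U" using x by (simp add: U_def nball_def nbox_iff)
  qed
  have U_cball: "x \<in> U \<Longrightarrow> x \<in> ncball n (4 * real n)" for x by (simp add: U_def nball_def ncball_def)
  have sobL: "in_Lp n n U u" "\<And>i. i < n \<Longrightarrow> in_Lp n n U (Du i)" "\<And>i j. i < n \<Longrightarrow> j < n \<Longrightarrow> in_Lp n n U (D2u i j)"
    using sob unfolding sobolev2_def U_def by blast+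
  define rep where "rep f f0 \<longleftrightarrow> f0 \<in> borel_measurable (prodleb n) \<and>
      (AE z in prodleb n. f0 z = indicator U z * f z) \<and>
    integrable (prodleb n) f0 \<and> integrable (prodleb n) (\<lambda>z. \<bar>f0 z\<bar> ^ n)" for f f0 :: "rvec \<Rightarrow> real"
  have rep: "\<exists>f0. rep f f0" if "in_Lp n n U f" for f
    using in_Lp_ex_borel[OF that[unfolded U_def] n1(1)] unfolding rep_def U_def by blast
  obtain u0 where u0: "rep u u0" using rep[OF sobL(1)] by blast
  obtain d where d: "\<And>i. i < n \<Longrightarrow> rep (Du i) (d i)" using rep[OF sobL(2)] by metis
  obtain b0 where b0: "\<And>i. i < n \<Longrightarrow> rep (b i) (b0 i)" using rep[OF b[folded U_def]] by metis
  obtain H where H: "\<And>i j. i < n \<Longrightarrow> j < n \<Longrightarrow> rep (D2u i j) (H i j)" using rep[OF sobL(3)] by metis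
  have good: "AE z in prodleb n. z \<in> U \<longrightarrow> u0 z = u z \<and> (\<gamma> < enorm n (\<lambda>i. d i z) \<longrightarrow>
      (\<Sum>i<n. \<Sum>j<n. a i j z * H i j z) + (\<Sum>i<n. b0 i z * d i z) \<le> 0)"
  proof -
    have "AE z in prodleb n. u0 z = indicator U z * u z" using u0 by (simp add: rep_def)
    moreover have "AE z in prodleb n. \<forall>i\<in>{..<n}. d i z = indicator U z * Du i z"
      using d by (intro AE_finite_allI) (auto simp: rep_def)
    moreover have "AE z in prodleb n. \<forall>i\<in>{..<n}. b0 i z = indicator U z * b i z"
      using b0 by (intro AE_finite_allI) (auto simp: rep_def)
    moreover have "AE z in prodleb n. \<forall>i\<in>{..<n}. \<forall>j\<in>{..<n}. H i j z = indicator U z * D2u i j z"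
      using H by (intro AE_finite_allI) (auto simp: rep_def)
    moreover have "AE z in prodleb n. z \<in> U \<longrightarrow> enorm n (\<lambda>i. Du i z) > \<gamma> \<longrightarrow> L_op n a b Du D2u z \<le> 0"
      using L unfolding L_gamma_nonpos_def U_def leb_def AE_completion_iff .
    ultimately show ?thesis
    proof eventually_elim
      case (elim z)
      show ?case
      proof (intro impI conjI)
        assume z: "z \<in> U"
        show "u0 z = u z" using elim(1) z by simp
        assume "\<gamma> < enorm n (\<lambda>i. d i z)"
        also have "enorm n (\<lambda>i. d i z) = enorm n (\<lambda>i. Du i z)" using elim(2) z by (intro enorm_cong) auto
        finally have "L_op n a b Du D2u z \<le> 0" using elim(5) z by blast
        moreover have "(\<Sum>i<n. \<Sum>j<n. a i j z * H i j z) = (\<Sum>i<n. \<Sum>j<n. a i j z * D2u i j z)"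
          using elim(4) z by (intro sum.cong refl) auto
        moreover have "(\<Sum>i<n. b0 i z * d i z) = (\<Sum>i<n. b i z * Du i z)"
          using elim(2,3) z by (intro sum.cong refl) auto
        ultimately show "(\<Sum>i<n. \<Sum>j<n. a i j z * H i j z) + (\<Sum>i<n. b0 i z * d i z) \<le> 0"
          by (simp add: L_op_def)
      qed
    qed
  qed
  obtain \<tau> where \<tau>: "\<tau> > 0" "\<tau> \<le> 1" "\<And>u w w1 w2. C2_approx n r \<tau> u d H w w1 w2 \<Longrightarrow>
    (\<integral>\<^sup>+x. indicator (nbox n r) x * ennreal (hess_dev n H w2 x ^ n + bad_hess n d w1 H x ^ n) \<partial>prodleb
        n) \<le> ennreal \<kappa>"
    using C2_approx_error[OF n1(1) _ _ _ \<kappa>, of d H r] d H unfolding rep_def by blast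
  obtain w w1 w2 where ap: "C2_approx n r \<tau> u d H w w1 w2"
    using sobolev_C2_approx[OF n1(1) sob cont, of r \<tau> u0 d H] box_sub[of "r + 1"] \<tau>(1) u0 d H
    unfolding rep_def U_def by blast
  obtain K where K: "K \<ge> 0" "\<And>x y. \<bar>w x - w y\<bar> \<le> K * (\<Sum>i<n. \<bar>x i - y i\<bar>)"
    "\<And>i x y. i < n \<Longrightarrow> \<bar>w1 i x - w1 i y\<bar> \<le> K * (\<Sum>i<n. \<bar>x i - y i\<bar>)"
    "\<And>i j x y. i < n \<Longrightarrow> j < n \<Longrightarrow> \<bar>w2 i j x - w2 i j y\<bar> \<le> K * (\<Sum>i<n. \<bar>x i - y i\<bar>)"
    using C2_approx.lipschitz[OF ap] by auto
  obtain \<delta> where \<delta>: "\<delta> > 0" "\<And>x y. x \<in> ncball n (4 * real n) \<Longrightarrow> y \<in> ncball n (4 * real n) \<Longrightarrow>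
      (\<forall>i<n. \<bar>x i - y i\<bar> \<le> \<delta>) \<Longrightarrow> \<bar>u x - u y\<bar> \<le> 1"
    using uniformly_continuous_ncball[OF cont zero_less_one] by blast
  \<comment> \<open>Chosen after \<open>w\<close>, so it may depend on \<open>K\<close>. Within
    \<open>h\<close>, the function \<open>u\<close> and each Hessian entry move by at most
    \<open>1\<close>; so does the gradient, whose \<open>n\<close> components move by at most
    \<open>K n h\<close> each, which explains the square of \<open>n\<close>.\<close>
  define h where "h = min (min \<delta> 1) (1 / (K * (real n)\<^sup>2 + 1))"
  have hh: "h > 0" "h \<le> \<delta>" "h \<le> 1" "K * (real n)\<^sup>2 * h \<le> 1"
  proof -
    have p: "K * (real n)\<^sup>2 + 1 > 0" using K(1) by (simp add: add_nonneg_pos)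
    then show "h > 0" "h \<le> \<delta>" "h \<le> 1" using \<delta>(1) by (auto simp: h_def)
    then have "(K * (real n)\<^sup>2 + 1) * h \<le> (K * (real n)\<^sup>2 + 1) * (1 / (K * (real n)\<^sup>2 + 1))"
      using p by (intro mult_left_mono) (auto simp: h_def)
    then show "K * (real n)\<^sup>2 * h \<le> 1" using p \<open>h > 0\<close> by (simp add: algebra_simps)
  qed
  have osc_sum: "K * (\<Sum>i<n. \<bar>x i - z i\<bar>) \<le> K * (real n * h)" if "\<And>i. i < n \<Longrightarrow> \<bar>x i - z i\<bar> \<le> h" for x z ::
      rvec
  proof -
    have "(\<Sum>i<n. \<bar>x i - z i\<bar>) \<le> (\<Sum>i<n. h)" using that by (intro sum_mono) auto
    then show ?thesis using K(1) by (intro mult_left_mono) auto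
  qed
  have Knh: "K * (real n * h) \<le> 1"
  proof -
    have "K * (real n * h) * 1 \<le> K * (real n * h) * real n" using K(1) hh(1) n1 by
        (intro mult_left_mono) auto
    then show ?thesis using hh(4) by (simp add: power2_eq_square mult_ac)
  qed
  have osc1: "enorm n (\<lambda>i. w1 i x - w1 i z) \<le> 1" if "\<And>i. i < n \<Longrightarrow> \<bar>x i - z i\<bar> \<le> h" for x z
  proof -
    have "enorm n (\<lambda>i. w1 i x - w1 i z) \<le> (\<Sum>i<n. \<bar>w1 i x - w1 i z\<bar>)" by (rule enorm_le_sum)
    also have "\<dots> \<le> (\<Sum>i<n. K * (real n * h))"
    proof (rule sum_mono)
      fix i assume "i \<in> {..<n}"
      then have "\<bar>w1 i x - w1 i z\<bar> \<le> K * (\<Sum>i<n. \<bar>x i - z i\<bar>)" using K(3) by simp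
      also have "\<dots> \<le> K * (real n * h)" using that by (rule osc_sum)
      finally show "\<bar>w1 i x - w1 i z\<bar> \<le> K * (real n * h)" .
    qed
    also have "\<dots> \<le> 1" using hh(4) by (simp add: power2_eq_square mult_ac)
    finally show ?thesis .
  qed
  have osc2: "\<bar>w2 i j x - w2 i j z\<bar> \<le> 1" if "\<And>i. i < n \<Longrightarrow> \<bar>x i - z i\<bar> \<le> h" "i < n" "j < n" for x z i j
  proof -
    have "K * (\<Sum>i<n. \<bar>x i - z i\<bar>) \<le> K * (real n * h)" using that(1) by (rule osc_sum)
    then show ?thesis using K(4)[OF that(2,3), of x z] Knh by linarith
  qed
  have x0R: "x\<^sub>0 \<in> Rn n" "\<And>i. i < n \<Longrightarrow> \<bar>x\<^sub>0 i\<bar> \<le> 1/2"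
    using x0 by (auto simp: cube_def origin_def)
  have x0box: "x\<^sub>0 \<in> nbox n R"
    unfolding nbox_iff R_def using x0R sn14 by force
  \<comment> \<open>The touching paraboloid of opening \<open>1\<close> and vertex \<open>0\<close>
    becomes a quadratic lower bound for \<open>u\<close> on the whole ball.\<close>
  have low: "u x\<^sub>0 - (enorm n z)\<^sup>2 / 2 \<le> u z" if "z \<in> U" for z
  proof -
    have eo: "edist n x (origin n) = enorm n x" for x
      unfolding edist_def by (rule enorm_cong) (simp add: origin_def)
    have "u x\<^sub>0 + 1 / 2 * (enorm n x\<^sub>0)\<^sup>2 \<le> u z + 1 / 2 * (enorm n z)\<^sup>2"
      using x0 U_cball[OF that] unfolding contact_set_def eo[symmetric] by auto
    moreover have "0 \<le> (enorm n x\<^sub>0)\<^sup>2" by simp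
    ultimately show ?thesis by linarith
  qed
  \<comment> \<open>Vertices in the sublevel set are counted directly; only the others have to be
    covered.\<close>
  define Y where "Y = {y \<in> nbox n (1/2). \<not> u y \<le> u x\<^sub>0 + M}"
  have "\<forall>y. \<exists>x. cusp_contact n R C w y x"
    using ex_cusp_contact[OF K(2) R0] by blast
  then obtain X where X: "\<And>y. cusp_contact n R C w y (X y)" by metis
  have Xbox: "X y \<in> nbox n R" for y using X unfolding cusp_contact_def by blast
  have Rr: "R < r" by (simp add: r_def)
  have boxRr: "x \<in> nbox n R \<Longrightarrow> x \<in> nbox n r" for x using Rr by (force simp: nbox_iff)
  have closew: "\<bar>w x - u x\<bar> \<le> 1" if "x \<in> nbox n R" for x
    using C2_approx.close[OF ap boxRr[OF that]] \<tau>(2) by linarith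
  have distx0: "sqrt (edist n x\<^sub>0 y) \<le> sqrt sn" if "y \<in> nbox n (1/2)" for y
  proof -
    have "\<bar>x\<^sub>0 i - y i\<bar> \<le> 1" if "i < n" for i using x0R(2)[OF that] \<open>y \<in> _\<close> that unfolding nbox_iff by force
    then have "edist n x\<^sub>0 y \<le> sn * 1" unfolding edist_def sn_def by (intro enorm_le_box) auto
    then show ?thesis by simp
  qed
  have val: "w (X y) + C * sqrt (edist n (X y) y) \<le> w x\<^sub>0 + C * sqrt sn" if "y \<in> nbox n (1/2)" for y
  proof -
    have "w (X y) + C * sqrt (edist n (X y) y) \<le> w x\<^sub>0 + C * sqrt (edist n x\<^sub>0 y)"
      using X x0box unfolding cusp_contact_def by blast
    also have "\<dots> \<le> w x\<^sub>0 + C * sqrt sn" using distx0[OF that] C0 by (intro add_left_mono mult_left_mono)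
        auto
    finally show ?thesis .
  qed
  \<comment> \<open>At a face, the distance from \<open>y\<close> is at least
    \<open>2 sqrt n - 1/2 \<ge> (25/16) sqrt n\<close>, where \<open>25/16 = (5/4)^2\<close>.
    Compared with the competitor \<open>x\<^sub>0\<close>, the cusp term is then larger by at least
    \<open>C / 4 = 5 n^2\<close>, whereas \<open>u\<close> can be lower by at most
    \<open>2 n^2\<close> and mollification accounts for \<open>2\<close>.\<close>
  have interior: "\<bar>X y i\<bar> < R" if y: "y \<in> nbox n (1/2)" and i: "i < n" for y i
  proof (rule ccontr)
    assume "\<not> \<bar>X y i\<bar> < R"
    moreover have "\<bar>y i\<bar> \<le> 1/2" using y i by (simp add: nbox_iff)
    ultimately have "25/16 * sn \<le> \<bar>X y i - y i\<bar>" using sn14 unfolding R_def by linarith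
    also have "\<dots> \<le> edist n (X y) y" unfolding edist_def using
        component_le_enorm[OF i, of "\<lambda>i. X y i - y i"] by simp
    finally have "sqrt (25/16 * sn) \<le> sqrt (edist n (X y) y)" by (rule real_sqrt_le_mono)
    moreover have "sqrt (25/16 * sn) = 5/4 * sqrt sn" by (simp add: real_sqrt_mult real_sqrt_divide)
    ultimately have s: "5/4 * sqrt sn \<le> sqrt (edist n (X y) y)" by (simp only:)
    have "1 \<le> sqrt sn" using sn14 by simp
    with s have "1/4 \<le> sqrt (edist n (X y) y) - sqrt sn" by linarith
    then have "C * (1/4) \<le> C * (sqrt (edist n (X y) y) - sqrt sn)" using C0 by (intro mult_left_mono) auto
    then have 1: "C / 4 \<le> w x\<^sub>0 - w (X y)" using val[OF y] by (simp add: right_diff_distrib)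
    have "enorm n (X y) \<le> sn * R" unfolding sn_def using Xbox R0 by (intro enorm_le_box)
        (auto simp: nbox_iff)
    also have "\<dots> = 2 * real n" using sn2 by (simp add: R_def)
    finally have "(enorm n (X y))\<^sup>2 \<le> (2 * real n)\<^sup>2" by (intro power_mono) auto
    moreover have "X y \<in> U" using box_sub[of R] Xbox Rr by auto
    from low[OF this] have "u x\<^sub>0 - (enorm n (X y))\<^sup>2 / 2 \<le> u (X y)" .
    ultimately have 2: "u x\<^sub>0 - u (X y) \<le> 2 * (real n)\<^sup>2"
      by (simp add: power_mult_distrib)
    have "C / 4 \<le> 2 * (real n)\<^sup>2 + 2"
      using 1 2 closew[OF x0box] closew[OF Xbox, of y] by linarith
    then show False using power_mono[OF n1(2), of 2] by (simp add: C)
  qed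
  \<comment> \<open>One unit of \<open>M\<close> is kept in reserve for passing from
    \<open>X y\<close> to points within \<open>h\<close>; the \<open>3\<close> in \<open>M\<close>
    is this unit plus two mollification errors.\<close>
  have uX: "u (X y) \<le> u x\<^sub>0 + (M - 1)" if "y \<in> nbox n (1/2)" for y
  proof -
    have "0 \<le> C * sqrt (edist n (X y) y)" using C0 by (simp add: edist_def)
    then have "w (X y) \<le> w x\<^sub>0 + C * sqrt sn" using val[OF that] by linarith
    then have "u (X y) \<le> u x\<^sub>0 + C * sqrt sn + 2"
      using closew[OF x0box] closew[OF Xbox, of y] by linarith
    then show ?thesis by (simp add: M sn_def)
  qed
  define A where "A y = sqrt (edist n (X y) y)" for y
  \<comment> \<open>Contact at the vertex itself would put \<open>y\<close> into the sublevel
    set.\<close>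
  have A0: "A y > 0" if y: "y \<in> Y" for y
  proof -
    have yb: "y \<in> nbox n (1/2)" using y by (simp add: Y_def)
    have "X y \<noteq> y" using uX[OF yb] y by (auto simp: Y_def)
    then have "edist n (X y) y \<noteq> 0" using edist_eq_0[of "X y" n y] Xbox[of y] yb by (auto simp: nbox_iff)
    then show ?thesis by (simp add: A_def edist_def less_le)
  qed
  have A_le: "A y \<le> Am" if y: "y \<in> nbox n (1/2)" for y
  proof -
    have "\<bar>X y i - y i\<bar> \<le> 3 * sn" if "i < n" for i
    proof -
      have "\<bar>X y i\<bar> \<le> R" "\<bar>y i\<bar> \<le> 1/2" using Xbox[of y] y that by (auto simp: nbox_iff)
      then show ?thesis using sn14 unfolding R_def by linarith
    qed
    then have "edist n (X y) y \<le> sn * (3 * sn)" unfolding edist_def sn_def by (intro enorm_le_box) auto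
    also have "\<dots> = 3 * real n" using sn2 by simp
    also have "\<dots> \<le> (2 * real n)\<^sup>2" using n1 by (simp add: power2_eq_square)
    finally show ?thesis unfolding A_def Am using n1 by (intro real_le_lsqrt) (auto simp: edist_def)
  qed
  \<comment> \<open>In effect \<open>C / (2 A) \<ge> 20 n^2 / (4 n) = 5 n\<close>.\<close>
  have A4: "4 \<le> C / (2 * A y)" if y: "y \<in> Y" for y
  proof -
    have "4 * (2 * A y) \<le> 16 * real n" using A_le[of y] y by (simp add: Y_def Am)
    also have "\<dots> \<le> 20 * (real n * real n)" using n1 by auto
    finally show ?thesis using A0[OF y] by (simp add: C power2_eq_square pos_le_divide_eq)
  qed
  define T where "T y = (\<Sum>k<n. w2 k k (X y) + C / (2 * A y ^ 3))" for y
  define l where "l y = 1 + 16 / C * (real n)\<^sup>2 * (A y ^ 3 * T y + C / 2 + A y ^ 3)" for y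
  have pt: "cusp_contact_point n r \<tau> R C u w d w1 H w2 y (X y) (A y) (T y) h" if y: "y \<in> Y" for y
  proof (rule cusp_contact_point.intro)
    have yb: "y \<in> nbox n (1/2)" using y by (simp add: Y_def)
    show "\<bar>X y i\<bar> < R" if "i < n" for i using interior[OF yb that] .
    show "\<bar>w2 i j z - w2 i j (X y)\<bar> \<le> 1" if "\<And>i. i < n \<Longrightarrow> \<bar>z i - X y i\<bar> \<le> h" "i < n" "j < n" for z i j
      using osc2[OF that] .
  qed (use ap Rr C0 X A0[OF y] hh in \<open>auto simp: A_def T_def\<close>)
  \<comment> \<open>The Borel version of the sublevel set \<open>V\<close>, equal to it up to a null
    set.\<close>
  define V0 where "V0 = {x \<in> U. u0 x \<le> u x\<^sub>0 + M}"
  have [measurable]: "u0 \<in> borel_measurable (prodleb n)" using u0 by (simp add: rep_def)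
  have Us [measurable]: "U \<in> sets (prodleb n)" unfolding U_def by simp
  have V0s [measurable]: "V0 \<in> sets (prodleb n)"
  proof -
    have "{x \<in> space (prodleb n). x \<in> U \<and> u0 x \<le> u x\<^sub>0 + M} \<in> sets (prodleb n)" by measurable
    also have "{x \<in> space (prodleb n). x \<in> U \<and> u0 x \<le> u x\<^sub>0 + M} = V0"
      by (auto simp: V0_def U_def nball_def space_prodleb)
    finally show ?thesis .
  qed
  define \<beta> where "\<beta> x = enorm n (\<lambda>i. b0 i x)" for x
  \<comment> \<open>A majorant for \<open>l^n\<close>, the \<open>n\<close>-th power of the local
    Lipschitz constant of the map from contact point to vertex. It is supported in the sublevel set,
    which is how that set's measure enters the estimate.\<close>
  define F where "F x = indicator (V0 \<inter> nbox n r) x * ennreal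
      ((Kc * (1 + \<beta> x + hess_dev n H w2 x + bad_hess n d w1 H x)) ^ n)" for x
  have meas: "i < n \<Longrightarrow> w1 i \<in> borel_measurable (prodleb n)" "i < n \<Longrightarrow> d i \<in> borel_measurable (prodleb n)"
    "i < n \<Longrightarrow> b0 i \<in> borel_measurable (prodleb n)"
    "i < n \<Longrightarrow> j < n \<Longrightarrow> w2 i j \<in> borel_measurable (prodleb n)" "i < n \<Longrightarrow> j < n \<Longrightarrow> H i j \<in> borel_measurable
        (prodleb n)" for i j
    using C2_approx.grad_meas[OF ap] C2_approx.hess_meas[OF ap] d H b0 by (auto simp: rep_def)
  have enm: "(\<lambda>x. enorm n (\<lambda>i. f i x)) \<in> borel_measurable (prodleb n)"
    if "\<And>i. i < n \<Longrightarrow> f i \<in> borel_measurable (prodleb n)" for f :: "nat \<Rightarrow> rvec \<Rightarrow> real"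
    unfolding enorm_def L2_set_def using that
    by (intro measurable_compose[OF borel_measurable_sum borel_measurable_sqrt]) auto
  have \<beta>m [measurable]: "\<beta> \<in> borel_measurable (prodleb n)" unfolding \<beta>_def[abs_def] using meas by
      (intro enm)
  have Dm [measurable]: "hess_dev n H w2 \<in> borel_measurable (prodleb n)"
    unfolding hess_dev_def[abs_def] using meas by (intro borel_measurable_sum borel_measurable_abs
        borel_measurable_diff) auto
  have Em [measurable]: "bad_hess n d w1 H \<in> borel_measurable (prodleb n)"
  proof -
    have [measurable]: "(\<lambda>x. enorm n (\<lambda>i. d i x - w1 i x)) \<in> borel_measurable (prodleb n)"
      using meas by (intro enm borel_measurable_diff) auto
    have [measurable]: "(\<lambda>x. \<Sum>i<n. \<Sum>j<n. \<bar>H i j x\<bar>) \<in> borel_measurable (prodleb n)"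
      using meas by (intro borel_measurable_sum borel_measurable_abs) auto
    show ?thesis unfolding bad_hess_def[abs_def] by measurable
  qed
  have Fm: "F \<in> borel_measurable (prodleb n)" unfolding F_def[abs_def] by measurable
  have Am0: "Am > 0" using n1 by (simp add: Am)
  have P0: "P \<ge> 0" unfolding P using Am0 lam C0 by auto
  have Kc1: "Kc \<ge> 1" unfolding Kc using C0 P0 lam Am0 by auto
  have lF: "AE x in prodleb n. (\<forall>i<n. \<bar>x i - X y i\<bar> \<le> h) \<longrightarrow> ennreal (l y ^ n) \<le> F x" if y: "y \<in> Y" for y
    using good AE_space
  proof eventually_elim
    case (elim x)
    interpret cusp_contact_point n r \<tau> R C u w d w1 H w2 y "X y" "A y" "T y" h using y by (rule pt)
    show ?case
    proof
      assume xh: "\<forall>i<n. \<bar>x i - X y i\<bar> \<le> h"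
      have yb: "y \<in> nbox n (1/2)" using y by (simp add: Y_def)
      have xr: "x \<in> nbox n r"
        unfolding nbox_iff
      proof (intro conjI allI impI)
        show "x \<in> Rn n" using elim(2) by (simp add: space_prodleb)
        fix i assume i: "i < n"
        then have "\<bar>x i - X y i\<bar> \<le> 1" "\<bar>X y i\<bar> \<le> R" using xh hh(3) Xbox[of y] by
            (auto simp: nbox_iff intro: order_trans)
        then show "\<bar>x i\<bar> \<le> r" unfolding r_def by linarith
      qed
      then have xU: "x \<in> U" using box_sub[of r] by auto
      have XU: "X y \<in> U" using box_sub[of R] Xbox Rr by auto
      have "\<bar>u x - u (X y)\<bar> \<le> 1"
        using \<delta>(2)[OF U_cball[OF xU] U_cball[OF XU]] xh hh(2) by (meson order_trans)
      then have "u x \<le> u x\<^sub>0 + M" using uX[OF yb] by linarith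
      then have xV: "x \<in> V0" using elim(1) xU by (simp add: V0_def)
      let ?bad = "if enorm n (\<lambda>i. d i x - w1 i x) \<le> 1 then 0 else 1 :: real"
      have "lam * (A y ^ 3 * T y) \<le> P * (1 + enorm n (\<lambda>i. b0 i x) + hess_dev n H w2 x + ?bad *
          (\<Sum>i<n. \<Sum>j<n. \<bar>H i j x\<bar>))"
      proof (rule trace_bound[where Lam = Lam and \<gamma> = \<gamma> and a = "\<lambda>i j. a i j x" and Am = Am])
        show "\<bar>x i - X y i\<bar> \<le> h" if "i < n" for i using xh that by blast
        show "enorm n (\<lambda>i. w1 i x - w1 i (X y)) \<le> 1" using xh by (intro osc1) auto
        show "\<And>i j. i < n \<Longrightarrow> j < n \<Longrightarrow> a i j x = a j i x"
          "\<And>\<xi>. lam * (\<Sum>i<n. (\<xi> i)\<^sup>2) \<le> quad n (\<lambda>i j. a i j x) \<xi>"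
          "\<And>\<xi>. quad n (\<lambda>i j. a i j x) \<xi> \<le> Lam * (\<Sum>i<n. (\<xi> i)\<^sup>2)"
          using ellipticD[OF ell[folded U_def] xU] by blast+
        show "\<gamma> < enorm n (\<lambda>i. d i x) \<Longrightarrow> (\<Sum>i<n. \<Sum>j<n. a i j x * H i j x) + (\<Sum>i<n. b0 i x * d i x) \<le> 0"
          using elim(1) xU by blast
      qed (use lam \<gamma> A4[OF y] A_le[OF yb] P in \<open>auto simp: hess_dev_def\<close>)
      then have tr: "lam * (A y ^ 3 * T y) \<le> P * (1 + \<beta> x + hess_dev n H w2 x + bad_hess n d w1 H x)"
        by (simp add: \<beta>_def bad_hess_def)
      \<comment> \<open>The summand \<open>1\<close> makes \<open>E \<ge> 1\<close>, so the bounded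
        terms \<open>C / 2\<close> and \<open>A^3\<close> are absorbed into multiples of
        \<open>E\<close>.\<close>
      define E where "E = 1 + \<beta> x + hess_dev n H w2 x + bad_hess n d w1 H x"
      have E1: "E \<ge> 1" unfolding E_def \<beta>_def using hess_dev_nonneg[of n H w2 x]
          bad_hess_nonneg[of n d w1 H x] enorm_nonneg[of n "\<lambda>i. b0 i x"] by linarith
      have 1: "A y ^ 3 * T y \<le> P / lam * E"
        using tr lam unfolding E_def[symmetric] by (simp add: pos_le_divide_eq mult.commute)
      have "A y ^ 3 \<le> Am ^ 3" using A0[OF y] A_le[OF yb] by (intro power_mono) auto
      also have "Am ^ 3 \<le> Am ^ 3 * E" using E1 Am0 by simp
      finally have 2: "A y ^ 3 \<le> Am ^ 3 * E" .
      have 3: "C / 2 \<le> C / 2 * E" using E1 C0 by simp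
      have "16 / C * (real n)\<^sup>2 * (A y ^ 3 * T y + C / 2 + A y ^ 3) \<le> 16 / C * (real n)\<^sup>2 *
          ((P / lam + C / 2 + Am ^ 3) * E)"
      proof (rule mult_left_mono)
        show "A y ^ 3 * T y + C / 2 + A y ^ 3 \<le> (P / lam + C / 2 + Am ^ 3) * E"
          unfolding distrib_right using 1 2 3 by linarith
      qed (use C0 in simp)
      then have "l y \<le> Kc * E" unfolding l_def Kc using E1 by (simp add: distrib_right mult.assoc)
      moreover have "0 \<le> l y" unfolding l_def using C0 A0[OF y] T_nonneg by auto
      ultimately have "l y ^ n \<le> (Kc * E) ^ n" by (intro power_mono)
      then show "ennreal (l y ^ n) \<le> F x" using xV xr unfolding F_def E_def by (auto intro: ennreal_leI)
    qed
  qed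
  have "\<exists>Z\<in>sets (prodleb n). Y \<subseteq> Z \<and> emeasure (prodleb n) Z \<le> ennreal (2 ^ n) * (\<integral>\<^sup>+x. F x \<partial>prodleb n)"
  proof (rule grid_covering[OF hh(1) _ _ _ _ Fm lF])
    show "Y \<subseteq> Rn n" by (auto simp: Y_def nbox_iff)
    show "X y \<in> nbox n R" for y by (rule Xbox)
    show "0 \<le> l y" if y: "y \<in> Y" for y
    proof -
      interpret cusp_contact_point n r \<tau> R C u w d w1 H w2 y "X y" "A y" "T y" h using y by (rule pt)
      show ?thesis unfolding l_def using C0 A0[OF y] T_nonneg by auto
    qed
    fix y1 y2 i assume y: "y1 \<in> Y" "y2 \<in> Y" and cl: "\<And>i. i < n \<Longrightarrow> \<bar>X y2 i - X y1 i\<bar> \<le> h" and i: "i < n"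
    interpret cusp_contact_point n r \<tau> R C u w d w1 H w2 y1 "X y1" "A y1" "T y1" h using y(1) by (rule pt)
    show "\<bar>y1 i - y2 i\<bar> \<le> h * l y1"
      unfolding l_def
    proof (rule vertices_close[OF X _ _ _ cl _ i])
      show "\<bar>X y2 i\<bar> < R" if "i < n" for i using interior[OF _ that] y(2) by (simp add: Y_def)
      show "A y2 = sqrt (edist n (X y2) y2)" "A y2 > 0" using A0[OF y(2)] by (auto simp: A_def)
      have "enorm n (\<lambda>i. w1 i (X y2) - w1 i (X y1)) \<le> 1" using cl by (rule osc1)
      also have "1 \<le> C / (4 * A y1)"
      proof -
        have "C / (4 * A y1) = C / (2 * A y1) / 2" by simp
        then show ?thesis using A4[OF y(1)] by simp
      qed
      finally show "enorm n (\<lambda>i. w1 i (X y2) - w1 i (X y1)) \<le> C / (4 * A y1)" .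
    qed
  qed
  then obtain Z where Z: "Z \<in> sets (prodleb n)" "Y \<subseteq> Z" "emeasure (prodleb n) Z \<le> ennreal (2 ^ n) *
      (\<integral>\<^sup>+x. F x \<partial>prodleb n)"
    by blast
  have Vs: "V \<in> sets (leb n)"
  proof -
    have m: "(\<lambda>x. indicator U x *\<^sub>R u x) \<in> borel_measurable (leb n)"
      using sobL(1) unfolding in_Lp_def set_borel_measurable_def by blast
    have U': "U \<in> sets (leb n)" unfolding leb_def by (rule sets_completionI_sets) (rule Us)
    have "{x \<in> space (leb n). indicator U x *\<^sub>R u x \<le> u x\<^sub>0 + M} \<inter> U \<in> sets (leb n)"
      using m U' by (intro sets.Int borel_measurable_le) auto
    also have "{x \<in> space (leb n). indicator U x *\<^sub>R u x \<le> u x\<^sub>0 + M} \<inter> U = V"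
      using sets.sets_into_space[OF U'] by (auto simp: V_def)
    finally show ?thesis .
  qed
  have Vfin: "emeasure (prodleb n) V0 < \<infinity>"
    using emeasure_mono[of V0 U "prodleb n"] nball_finite[of n "4 * real n"] unfolding V0_def U_def by auto
  have eV: "emeasure (leb n) V = emeasure (prodleb n) V0"
  proof -
    have "emeasure (leb n) V = emeasure (leb n) V0"
    proof (rule emeasure_eq_AE[OF _ Vs])
      show "AE x in leb n. x \<in> V \<longleftrightarrow> x \<in> V0"
        unfolding leb_def AE_completion_iff using good
        by eventually_elim (auto simp: V_def V0_def)
      show "V0 \<in> sets (leb n)" unfolding leb_def by (rule sets_completionI_sets) (rule V0s)
    qed
    then show ?thesis by (simp add: leb_def)
  qed
  define v where "v = measure (leb n) V"
  have ev: "emeasure (prodleb n) V0 = ennreal v"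
    unfolding v_def measure_def eV using Vfin by simp
  have F_int: "(\<integral>\<^sup>+x. F x \<partial>prodleb n) \<le> ennreal (Kc ^ n * 4 ^ n) *
      (ennreal v + ennreal (vector_Lp_norm n n U b ^ n) + ennreal \<kappa>)"
  proof -
    have "(\<integral>\<^sup>+x. F x \<partial>prodleb n) \<le> (\<integral>\<^sup>+x. ennreal (Kc ^ n * 4 ^ n) * ((indicator V0 x + ennreal (\<beta> x ^ n))
        + indicator (nbox n r) x * ennreal (hess_dev n H w2 x ^ n + bad_hess n d w1 H x ^ n)) \<partial>prodleb n)"
    proof (rule nn_integral_mono)
      fix x
      show "F x \<le> ennreal (Kc ^ n * 4 ^ n) * ((indicator V0 x + ennreal (\<beta> x ^ n))
        + indicator (nbox n r) x * ennreal (hess_dev n H w2 x ^ n + bad_hess n d w1 H x ^ n))"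
      proof (cases "x \<in> V0 \<inter> nbox n r")
        case True
        have nn: "0 \<le> \<beta> x" "0 \<le> hess_dev n H w2 x" "0 \<le> bad_hess n d w1 H x"
          using hess_dev_nonneg bad_hess_nonneg by (auto simp: \<beta>_def)
        have "(Kc * (1 + \<beta> x + hess_dev n H w2 x + bad_hess n d w1 H x)) ^ n
          \<le> Kc ^ n * (4 ^ n * (1 + \<beta> x ^ n + (hess_dev n H w2 x ^ n + bad_hess n d w1 H x ^ n)))"
          unfolding power_mult_distrib using Kc1 nn by (intro mult_left_mono four_power_le) auto
        then have "F x \<le> ennreal ((Kc ^ n * 4 ^ n) * ((1 + \<beta> x ^ n) +
            (hess_dev n H w2 x ^ n + bad_hess n d w1 H x ^ n)))"
          using True unfolding F_def by (simp add: mult.assoc ennreal_leI)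
        also have "\<dots> = ennreal (Kc ^ n * 4 ^ n) * ((1 + ennreal (\<beta> x ^ n)) + ennreal
            (hess_dev n H w2 x ^ n + bad_hess n d w1 H x ^ n))"
          using nn Kc1 by (simp add: ennreal_mult ennreal_plus[symmetric] ennreal_1[symmetric] del:
              ennreal_plus ennreal_1)
        finally show ?thesis using True by simp
      qed (auto simp: F_def)
    qed
    also have "\<dots> = ennreal (Kc ^ n * 4 ^ n) * ((emeasure (prodleb n) V0 +
        (\<integral>\<^sup>+x. ennreal (\<beta> x ^ n) \<partial>prodleb n))
        + (\<integral>\<^sup>+x. indicator (nbox n r) x * ennreal (hess_dev n H w2 x ^ n + bad_hess n d w1 H x ^ n)
            \<partial>prodleb n))"
    proof -
      let ?g = "\<lambda>x. indicator (nbox n r) x * ennreal (hess_dev n H w2 x ^ n + bad_hess n d w1 H x ^ n)"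
      have f: "(\<lambda>x. indicator V0 x :: ennreal) \<in> borel_measurable (prodleb n)"
        "(\<lambda>x. ennreal (\<beta> x ^ n)) \<in> borel_measurable (prodleb n)" "?g \<in> borel_measurable (prodleb n)"
        by measurable
      have "(\<integral>\<^sup>+x. indicator V0 x + ennreal (\<beta> x ^ n) \<partial>prodleb n) = emeasure (prodleb n) V0 +
          (\<integral>\<^sup>+x. ennreal (\<beta> x ^ n) \<partial>prodleb n)"
        by (subst nn_integral_add[OF f(1,2)]) (simp add: nn_integral_indicator[OF V0s])
      moreover have "(\<integral>\<^sup>+x. (indicator V0 x + ennreal (\<beta> x ^ n)) + ?g x \<partial>prodleb n)
         = (\<integral>\<^sup>+x. indicator V0 x + ennreal (\<beta> x ^ n) \<partial>prodleb n) + (\<integral>\<^sup>+x. ?g x \<partial>prodleb n)"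
        by (rule nn_integral_add[OF borel_measurable_add[OF f(1,2)] f(3)])
      moreover have "(\<integral>\<^sup>+x. ennreal (Kc ^ n * 4 ^ n) * ((indicator V0 x + ennreal (\<beta> x ^ n)) + ?g x)
          \<partial>prodleb n)
         = ennreal (Kc ^ n * 4 ^ n) * (\<integral>\<^sup>+x. (indicator V0 x + ennreal (\<beta> x ^ n)) + ?g x \<partial>prodleb n)"
        by (rule nn_integral_cmult[OF borel_measurable_add[OF borel_measurable_add[OF f(1,2)] f(3)]])
      ultimately show ?thesis by (simp only:)
    qed
    also have "(\<integral>\<^sup>+x. ennreal (\<beta> x ^ n) \<partial>prodleb n) = ennreal (vector_Lp_norm n n U b ^ n)"
      unfolding \<beta>_def U_def using b0 b n1(1) by (intro vector_Lp_norm_power) (auto simp: rep_def U_def)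
    also have "ennreal (Kc ^ n * 4 ^ n) * ((emeasure (prodleb n) V0 + ennreal (vector_Lp_norm n n U b ^ n))
        + (\<integral>\<^sup>+x. indicator (nbox n r) x * ennreal (hess_dev n H w2 x ^ n + bad_hess n d w1 H x ^ n)
            \<partial>prodleb n))
      \<le> ennreal (Kc ^ n * 4 ^ n) * ((ennreal v + ennreal (vector_Lp_norm n n U b ^ n)) + ennreal \<kappa>)"
      unfolding ev using \<tau>(3)[OF ap] by (intro mult_left_mono add_left_mono) auto
    finally show ?thesis .
  qed
  have S0: "0 \<le> vector_Lp_norm n n U b" and v0: "0 \<le> v"
    unfolding vector_Lp_norm_def set_lebesgue_integral_def v_def
    using n1 by (auto intro!: Bochner_Integration.integral_nonneg real_root_ge_zero)
  have "1 = emeasure (prodleb n) (nbox n (1/2))" by (subst emeasure_nbox) auto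
  also have "\<dots> = emeasure (leb n) (nbox n (1/2))" by (simp add: leb_def)
  also have "\<dots> \<le> emeasure (leb n) (V \<union> Z)"
  proof (rule emeasure_mono)
    have "nbox n (1/2) \<subseteq> U" using box_sub[of "1/2"] sn14 by (simp add: r_def R_def)
    then show "nbox n (1/2) \<subseteq> V \<union> Z" using Z(2) by (auto simp: V_def Y_def)
    show "V \<union> Z \<in> sets (leb n)" using Vs Z(1) by (auto simp: leb_def)
  qed
  also have "\<dots> \<le> emeasure (leb n) V + emeasure (leb n) Z"
    using Vs Z(1) by (intro emeasure_subadditive) (auto simp: leb_def)
  also have "\<dots> = ennreal v + emeasure (prodleb n) Z" using eV ev Z(1) by (simp add: leb_def)
  also have "\<dots> \<le> ennreal v + ennreal (2 ^ n) * (ennreal (Kc ^ n * 4 ^ n) *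
      (ennreal v + ennreal (vector_Lp_norm n n U b ^ n) + ennreal \<kappa>))"
    using Z(3) F_int by (intro add_left_mono order_trans[OF Z(3)] mult_left_mono) auto
  also have "\<dots> = ennreal (v + 2 ^ n * ((Kc ^ n * 4 ^ n) * (v + vector_Lp_norm n n U b ^ n + \<kappa>)))"
    using v0 S0 \<kappa> Kc1 by (simp add: ennreal_mult[symmetric] ennreal_plus[symmetric] del: ennreal_plus)
  finally have "ennreal 1 \<le> ennreal (v + 2 ^ n * ((Kc ^ n * 4 ^ n) * (v + vector_Lp_norm n n U b ^ n + \<kappa>)))"
    by (simp only: ennreal_1)
  moreover have "0 \<le> v + 2 ^ n * ((Kc ^ n * 4 ^ n) * (v + vector_Lp_norm n n U b ^ n + \<kappa>))"
    using v0 S0 \<kappa> Kc1 by (intro add_nonneg_nonneg mult_nonneg_nonneg) auto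
  ultimately have "1 \<le> v + 2 ^ n * ((Kc ^ n * 4 ^ n) * (v + vector_Lp_norm n n U b ^ n + \<kappa>))"
    using ennreal_le_iff by blast
  \<comment> \<open>\<open>8 = 2 * 4\<close>: a factor \<open>2^n\<close> from the covering cubes
    and \<open>4^n\<close> from splitting the power of a sum of four terms.\<close>
  also have "2 ^ n * ((Kc ^ n * 4 ^ n) * (v + vector_Lp_norm n n U b ^ n + \<kappa>)) = Q *
      (v + vector_Lp_norm n n U b ^ n + \<kappa>)"
  proof -
    have "(8::real) ^ n = 2 ^ n * 4 ^ n" by (simp add: power_mult_distrib[symmetric])
    then show ?thesis unfolding Q by simp
  qed
  finally show ?thesis unfolding v_def V_def U_def by (simp add: algebra_simps)
qed

section \<open>The choice of the constants\<close>

theorem proposition3p1: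
  "\<exists>\<epsilon>\<^sub>0::real. \<epsilon>\<^sub>0 > 0 \<and>
    (\<forall>n::nat. n \<ge> 2 \<longrightarrow>
      (\<exists>M::real. \<forall>lam Lam :: real. 0 < lam \<and> lam \<le> Lam \<longrightarrow>
        (\<exists>\<delta> \<eta>\<^sub>0 :: real. \<delta> > 0 \<and> \<eta>\<^sub>0 > 0 \<and>
          (\<forall>(a :: nat \<Rightarrow> nat \<Rightarrow> rvec \<Rightarrow> real) (b :: nat \<Rightarrow> rvec \<Rightarrow> real) (\<gamma> :: real)
             (u :: rvec \<Rightarrow> real) (Du :: nat \<Rightarrow> rvec \<Rightarrow> real)
             (D2u :: nat \<Rightarrow> nat \<Rightarrow> rvec \<Rightarrow> real) (x\<^sub>0 :: rvec).
            (\<forall>i<n. \<forall>j<n. set_borel_measurable (leb n) (nball n (4 * real n)) (a i j)) \<longrightarrow>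
            elliptic_on n (nball n (4 * real n)) lam Lam a \<longrightarrow>
            (\<forall>i<n. in_Lp n n (nball n (4 * real n)) (b i)) \<longrightarrow>
            \<gamma> \<ge> 0 \<longrightarrow>
            sobolev2 n n (nball n (4 * real n)) u Du D2u \<longrightarrow>
            continuous_on (ncball n (4 * real n)) u \<longrightarrow>
            L_gamma_nonpos n (nball n (4 * real n)) \<gamma> a b Du D2u \<longrightarrow>
            x\<^sub>0 \<in> contact_set n (4 * real n) u 1 {origin n} \<inter> cube n 1 (origin n) \<longrightarrow>
            \<gamma> < \<epsilon>\<^sub>0 \<longrightarrow>
            vector_Lp_norm n n (nball n (4 * real n)) b < \<eta>\<^sub>0 \<longrightarrow>
            measure (leb n) ({x. u x \<le> u x\<^sub>0 + M} \<inter> nball n (4 * real n))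
              / measure (leb n) (nball n (4 * real n)) \<ge> \<delta>))))"
proof (rule exI[of _ 1], intro conjI allI impI, goal_cases)
  case (2 n)
  then have n: "n \<ge> 2" .
  define C where "C = 20 * (real n)\<^sup>2"
  define Am where "Am = 2 * real n"
  define M where "M = C * sqrt (sqrt (real n)) + 3"
  define m where "m = measure (leb n) (nball n (4 * real n))"
  have "nbox n 1 \<subseteq> nball n (4 * real n)"
  proof
    fix x assume x: "x \<in> nbox n 1"
    have "enorm n x \<le> (\<Sum>i<n. \<bar>x i\<bar>)" by (rule enorm_le_sum)
    also have "\<dots> \<le> (\<Sum>i<n. 1)" using x by (intro sum_mono) (auto simp: nbox_iff)
    also have "\<dots> < 4 * real n" using n by simp
    finally show "x \<in> nball n (4 * real n)" using x by (simp add: nball_def nbox_iff)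
  qed
  then have "emeasure (prodleb n) (nbox n 1) \<le> emeasure (prodleb n) (nball n (4 * real n))"
    by (intro emeasure_mono) auto
  then have "0 < emeasure (prodleb n) (nball n (4 * real n))"
    by (rule less_le_trans[rotated]) (simp add: emeasure_nbox)
  then have m: "m > 0"
    using nball_finite[of n "4 * real n"] unfolding m_def leb_def
    by (simp add: measure_def enn2real_positive_iff)
  show ?case
  proof (rule exI[of _ M], intro allI impI, goal_cases)
    case (1 lam Lam)
    then have lam: "0 < lam \<and> lam \<le> Lam" .
    define P where "P = Am ^ 3 * Lam + (real n)\<^sup>2 * Lam * Am ^ 3 + real n * Lam * C / 2 + C * Am\<^sup>2"
    define Kc where "Kc = 1 + 16 / C * (real n)\<^sup>2 * (P / lam + C / 2 + Am ^ 3)"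
    define Q where "Q = 8 ^ n * Kc ^ n"
    have "C \<ge> 0" "Am \<ge> 0" by (auto simp: C_def Am_def)
    then have "P \<ge> 0" "Kc \<ge> 0" unfolding P_def Kc_def using lam by auto
    then have Q: "Q \<ge> 0" by (simp add: Q_def)
    \<comment> \<open>Because \<eta> \<le> 1, a norm below \<eta> has \<open>n\<close>-th power at
      most \<eta>, and \<eta> is also taken for \<kappa>. Both error terms are then at most
      \<open>1/4\<close>, which leaves half of the unit volume to \<open>(1 + Q)\<close> times the
      measure of the sublevel set; \<delta> is the resulting bound divided by the volume of the
      ball.\<close>
    define \<eta> where "\<eta> = 1 / (4 * (Q + 1))"
    have \<eta>: "\<eta> > 0" "\<eta> \<le> 1" "Q * \<eta> \<le> 1/4" using Q by (auto simp: \<eta>_def field_simps)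
    define \<delta> where "\<delta> = 1 / (2 * (1 + Q)) / m"
    have \<delta>: "\<delta> > 0" using Q m by (simp add: \<delta>_def)
    have main: "\<delta> \<le> measure (leb n) ({x. u x \<le> u x\<^sub>0 + M} \<inter> nball n (4 * real n)) / measure (leb n)
        (nball n (4 * real n))"
      if "elliptic_on n (nball n (4 * real n)) lam Lam a" "\<forall>i<n. in_Lp n n (nball n (4 * real n)) (b i)"
        "sobolev2 n n (nball n (4 * real n)) u Du D2u" "continuous_on (ncball n (4 * real n)) u"
        "L_gamma_nonpos n (nball n (4 * real n)) \<gamma> a b Du D2u"
        "x\<^sub>0 \<in> contact_set n (4 * real n) u 1 {origin n} \<inter> cube n 1 (origin n)" "\<gamma> < 1"
        and S: "vector_Lp_norm n n (nball n (4 * real n)) b < \<eta>"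
      for a b \<gamma> u Du D2u x\<^sub>0
    proof -
      let ?S = "vector_Lp_norm n n (nball n (4 * real n)) b"
      let ?v = "measure (leb n) ({x. u x \<le> u x\<^sub>0 + M} \<inter> nball n (4 * real n))"
      have S0: "0 \<le> ?S"
        unfolding vector_Lp_norm_def set_lebesgue_integral_def
        using n by (auto intro!: Bochner_Integration.integral_nonneg real_root_ge_zero)
      have "?S ^ n \<le> \<eta> ^ n" using S S0 by (intro power_mono) auto
      also have "\<dots> \<le> \<eta> ^ 1" using \<eta> n by (intro power_decreasing) auto
      finally have "Q * ?S ^ n \<le> Q * \<eta>" using Q by (intro mult_left_mono) auto
      moreover have "1 \<le> (1 + Q) * ?v + Q * ?S ^ n + Q * \<eta>"
        using lam that by (intro level_set_estimate[OF n _ _ \<open>\<gamma> < 1\<close> \<eta>(1) _ _ _ _ _ _ C_def Am_def P_def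
            Kc_def Q_def M_def]) auto
      ultimately have "1 / 2 \<le> (1 + Q) * ?v" using \<eta>(3) by linarith
      then have "1 / (2 * (1 + Q)) \<le> ?v" using Q by (simp add: field_simps)
      then show ?thesis unfolding \<delta>_def m_def[symmetric] using m by (intro divide_right_mono) auto
    qed
    show ?case
      by (rule exI[of _ \<delta>], rule exI[of _ \<eta>], intro conjI allI impI \<delta> \<eta>(1), rule main) assumption+
  qed
qed simp

end
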